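(* $\mathrm{ptime}\mbox{-}2\mathrm{NPD}/\mathrm{poly}=\mathrm{ptime}\mbox{-}2\mathrm{UPD}/\mathrm{poly}$.
   Context: A promise problem over $\Sigma$ is $(A,R)$ with $A,R\subseteq\Sigma^*$, $A\cap R=\varnothing$; families are $\mathcal{L}=\{(L_n^{(+)},L_n^{(-)})\}_{n\in\mathbb{N}}$ over a common alphabet. A 2npda is a two-way nondeterministic pushdown automaton (finite state set $Q$, input between endmarkers, two-way read-only head, stack alphabet $\Gamma$); it is unambiguous (a 2upda) on $(A,R)$ if it has at most one accepting computation path on each input in $A\cup R$. A machine solves $(A,R)$ if every $x\in A$ has an accepting path and for every $x\in R$ all (halting) paths reject. Size of a 2npda is $|Q|\cdot|\Gamma^{\le e}|$ ($e$ maximal push length); polynomial size means size$(M_n)\le p(n)$ for a polynomial $p$. $\mathrm{ptime}\mbox{-}2\mathrm{NPD}$ ($\mathrm{ptime}\mbox{-}2\mathrm{UPD}$) is the class of families $\mathcal{L}$ for which a polynomial-size family of 2npda's (unambiguous 2npda's) $\{M_n\}$ and a polynomial $p$ exist such that $M_n$ solves $(L_n^{(+)},L_n^{(-)})$ within $p(n,|x|)$ steps for all $n$. $\mathcal{C}/\mathrm{poly}$ is the set of families in $\mathcal{C}$ with a polynomial ceiling: a polynomial $p$ with $L_n^{(+)}\cup L_n^{(-)}\subseteq\Sigma^{\le p(n)}$ for all $n$. *)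

theory Defs
  imports "HOL-Computational_Algebra.Polynomial"
begin

section \<open>Families of promise problems\<close>

text \<open>A pair \<open>(A, R)\<close>: the instances to be accepted and the instances to be rejected.\<close>

type_synonym 'a promise_problem = "'a list set \<times> 'a list set"

type_synonym 'a family = "nat \<Rightarrow> 'a promise_problem"

definition promise_problem_over :: "'a set \<Rightarrow> 'a promise_problem \<Rightarrow> bool" where
  "promise_problem_over \<Sigma> P \<longleftrightarrow>
     fst P \<subseteq> lists \<Sigma> \<and> snd P \<subseteq> lists \<Sigma> \<and> fst P \<inter> snd P = {}"

definition alphabet :: "'a set \<Rightarrow> bool" where
  "alphabet \<Sigma> \<longleftrightarrow> finite \<Sigma> \<and> \<Sigma> \<noteq> {}"

definition strings_upto :: "'a set \<Rightarrow> nat \<Rightarrow> 'a list set" where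
  "strings_upto \<Sigma> k = {w \<in> lists \<Sigma>. length w \<le> k}"


section \<open>Two-way nondeterministic pushdown automata\<close>

datatype 'a tape_symbol = Left_End | Input 'a | Right_End

text \<open>\<open>(p, d, w) \<in> trans M q \<sigma> a\<close> means: in state \<open>q\<close>, scanning \<open>\<sigma>\<close>, with \<open>a\<close> on top of the
  stack, \<open>M\<close> may enter \<open>p\<close>, move its head by \<open>d\<close> cells and replace \<open>a\<close> by \<open>w\<close>.
  Stacks are lists whose head is the topmost symbol.\<close>

record ('q, 'a, 'g) pda =
  states :: "'q set"
  stack_alph :: "'g set"
  trans :: "'q \<Rightarrow> 'a tape_symbol \<Rightarrow> 'g \<Rightarrow> ('q \<times> int \<times> 'g list) set"
  start :: 'q
  bottom :: 'g
  acc_states :: "'q set"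
  rej_states :: "'q set"

definition halt_states :: "('q, 'a, 'g) pda \<Rightarrow> 'q set" where
  "halt_states M = acc_states M \<union> rej_states M"

definition tape_alph :: "'a set \<Rightarrow> 'a tape_symbol set" where
  "tape_alph \<Sigma> = {Left_End, Right_End} \<union> Input ` \<Sigma>"

text \<open>The transition function matters only on
  \<open>(Q - Q\<^sub>h\<^sub>a\<^sub>l\<^sub>t) \<times> (\<Sigma> \<union> endmarkers) \<times> \<Gamma>\<close>.
  The last two conditions keep the bottom marker at the bottom of the stack and nowhere else.\<close>

definition two_npda :: "'a set \<Rightarrow> ('q, 'a, 'g) pda \<Rightarrow> bool" where
  "two_npda \<Sigma> M \<longleftrightarrow>
     finite (states M) \<and> finite (stack_alph M) \<and>
     start M \<in> states M \<and> bottom M \<in> stack_alph M \<and>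
     acc_states M \<subseteq> states M \<and> rej_states M \<subseteq> states M \<and>
     acc_states M \<inter> rej_states M = {} \<and>
     (\<forall>q \<in> states M - halt_states M. \<forall>\<sigma> \<in> tape_alph \<Sigma>. \<forall>a \<in> stack_alph M.
        finite (trans M q \<sigma> a) \<and>
        (\<forall>(p, d, w) \<in> trans M q \<sigma> a.
           p \<in> states M \<and> d \<in> {-1, 0, 1} \<and> w \<in> lists (stack_alph M) \<and>
           (\<sigma> = Left_End \<longrightarrow> d \<noteq> -1) \<and> (\<sigma> = Right_End \<longrightarrow> d \<noteq> 1) \<and>
           (a = bottom M \<longrightarrow> (\<exists>u. w = u @ [bottom M] \<and> bottom M \<notin> set u)) \<and>
           (a \<noteq> bottom M \<longrightarrow> bottom M \<notin> set w)))"

text \<open>The maximal length \<open>e\<close> of a pushed string. The supremum ranges over a finite set of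
  natural numbers; it is \<open>0\<close> if there is no transition at all.\<close>

definition push_size :: "'a set \<Rightarrow> ('q, 'a, 'g) pda \<Rightarrow> nat" where
  "push_size \<Sigma> M = Sup {length w | q \<sigma> a p d w.
     q \<in> states M - halt_states M \<and> \<sigma> \<in> tape_alph \<Sigma> \<and> a \<in> stack_alph M \<and>
     (p, d, w) \<in> trans M q \<sigma> a}"

definition pda_size :: "'a set \<Rightarrow> ('q, 'a, 'g) pda \<Rightarrow> nat" where
  "pda_size \<Sigma> M = card (states M) * card (strings_upto (stack_alph M) (push_size \<Sigma> M))"


section \<open>Computations\<close>

text \<open>State, head position, stack contents. On input \<open>x\<close> the left endmarker is in cell \<open>0\<close> and
  the right endmarker in cell \<open>length x + 1\<close>.\<close>

type_synonym ('q, 'g) config = "'q \<times> nat \<times> 'g list"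

definition scanned :: "'a list \<Rightarrow> nat \<Rightarrow> 'a tape_symbol" where
  "scanned x i =
     (if i = 0 then Left_End else if i \<le> length x then Input (x ! (i - 1)) else Right_End)"

definition initial :: "('q, 'a, 'g) pda \<Rightarrow> ('q, 'g) config" where
  "initial M = (start M, 0, [bottom M])"

inductive step :: "('q, 'a, 'g) pda \<Rightarrow> 'a list \<Rightarrow> ('q, 'g) config \<Rightarrow> ('q, 'g) config \<Rightarrow> bool"
  for M x where
  "step M x (q, i, a # z) (p, j, w @ z)"
  if "q \<in> states M - halt_states M" "(p, d, w) \<in> trans M q (scanned x i) a" "int j = int i + d"

text \<open>A computation path need not be complete: every initial segment of a path is a path.
  No step leaves a halting state, so halting paths cannot be extended.\<close>

definition comp_path :: "('q, 'a, 'g) pda \<Rightarrow> 'a list \<Rightarrow> ('q, 'g) config list \<Rightarrow> bool" where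
  "comp_path M x cs \<longleftrightarrow> cs \<noteq> [] \<and> hd cs = initial M \<and> successively (step M x) cs"

definition accepting_path :: "('q, 'a, 'g) pda \<Rightarrow> 'a list \<Rightarrow> ('q, 'g) config list \<Rightarrow> bool" where
  "accepting_path M x cs \<longleftrightarrow> comp_path M x cs \<and> fst (last cs) \<in> acc_states M"

definition rejecting_path :: "('q, 'a, 'g) pda \<Rightarrow> 'a list \<Rightarrow> ('q, 'g) config list \<Rightarrow> bool" where
  "rejecting_path M x cs \<longleftrightarrow> comp_path M x cs \<and> fst (last cs) \<in> rej_states M"

definition halting_path :: "('q, 'a, 'g) pda \<Rightarrow> 'a list \<Rightarrow> ('q, 'g) config list \<Rightarrow> bool" where
  "halting_path M x cs \<longleftrightarrow> comp_path M x cs \<and> fst (last cs) \<in> halt_states M"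

definition solves :: "('q, 'a, 'g) pda \<Rightarrow> 'a promise_problem \<Rightarrow> bool" where
  "solves M P \<longleftrightarrow>
     (\<forall>x \<in> fst P. \<exists>cs. accepting_path M x cs) \<and>
     (\<forall>x \<in> snd P. \<forall>cs. halting_path M x cs \<longrightarrow> rejecting_path M x cs)"

text \<open>All computation paths of \<open>M\<close> on \<open>x\<close> reach a halting state within \<open>t\<close> steps: no path makes
  more than \<open>t\<close> steps, and a path gets stuck only in a halting state.\<close>

definition halts_within :: "('q, 'a, 'g) pda \<Rightarrow> 'a list \<Rightarrow> nat \<Rightarrow> bool" where
  "halts_within M x t \<longleftrightarrow>
     (\<forall>cs. comp_path M x cs \<longrightarrow>
        length cs - 1 \<le> t \<and> (halting_path M x cs \<or> (\<exists>c. step M x (last cs) c)))"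

definition solves_within ::
  "('q, 'a, 'g) pda \<Rightarrow> 'a promise_problem \<Rightarrow> (nat \<Rightarrow> nat) \<Rightarrow> bool" where
  "solves_within M P t \<longleftrightarrow>
     solves M P \<and> (\<forall>x \<in> fst P \<union> snd P. halts_within M x (t (length x)))"

definition unambiguous_on :: "('q, 'a, 'g) pda \<Rightarrow> 'a promise_problem \<Rightarrow> bool" where
  "unambiguous_on M P \<longleftrightarrow>
     (\<forall>x \<in> fst P \<union> snd P. \<forall>cs cs'.
        accepting_path M x cs \<longrightarrow> accepting_path M x cs' \<longrightarrow> cs = cs')"


section \<open>Nonuniform complexity classes\<close>

text \<open>The value \<open>p(n, m)\<close> of a bivariate polynomial with natural coefficients.\<close>

definition poly2 :: "nat poly poly \<Rightarrow> nat \<Rightarrow> nat \<Rightarrow> nat" where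
  "poly2 p n m = poly (poly p [:m:]) n"

text \<open>States and stack symbols are natural numbers: automata are finite, so up to renaming this
  is no restriction. The alphabet \<open>\<Sigma>\<close> may depend on the family but not on \<open>n\<close>.\<close>

type_synonym 'a pda_family = "nat \<Rightarrow> (nat, 'a, nat) pda"

definition polynomial_size :: "'a set \<Rightarrow> 'a pda_family \<Rightarrow> bool" where
  "polynomial_size \<Sigma> M \<longleftrightarrow> (\<exists>p :: nat poly. \<forall>n. pda_size \<Sigma> (M n) \<le> poly p n)"

definition ptime_2NPD :: "'a family set" where
  "ptime_2NPD = {L. \<exists>\<Sigma> M p.
     alphabet \<Sigma> \<and> (\<forall>n. promise_problem_over \<Sigma> (L n)) \<and>
     (\<forall>n. two_npda \<Sigma> (M n)) \<and> polynomial_size \<Sigma> (M :: 'a pda_family) \<and>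
     (\<forall>n. solves_within (M n) (L n) (poly2 p n))}"

definition ptime_2UPD :: "'a family set" where
  "ptime_2UPD = {L. \<exists>\<Sigma> M p.
     alphabet \<Sigma> \<and> (\<forall>n. promise_problem_over \<Sigma> (L n)) \<and>
     (\<forall>n. two_npda \<Sigma> (M n)) \<and> polynomial_size \<Sigma> (M :: 'a pda_family) \<and>
     (\<forall>n. unambiguous_on (M n) (L n)) \<and>
     (\<forall>n. solves_within (M n) (L n) (poly2 p n))}"

text \<open>The families of \<open>C\<close> with a polynomial ceiling, written \<open>C/poly\<close>. In the classes above the
  instances are already strings over a finite alphabet, so only their length is bounded here.\<close>

definition with_poly_ceiling :: "'a family set \<Rightarrow> 'a family set" where
  "with_poly_ceiling C =
     {L \<in> C. \<exists>p :: nat poly. \<forall>n. \<forall>x \<in> fst (L n) \<union> snd (L n). length x \<le> poly p n}"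

end

theory Submission
  imports Defs "HOL-Library.Countable" "HOL-Library.FuncSet"
begin

text \<open>Only the simulation of a nondeterministic automaton \<open>N\<close> by an unambiguous one is at stake. For inputs
  of polynomial length, ``\<open>N\<close> can pop \<open>w\<close> within \<open>t\<close> steps, going from state \<open>q\<close> and cell \<open>i\<close> to state
  \<open>p\<close> and cell \<open>j\<close>'' is one of polynomially many items, and an item follows from two items with smaller
  \<open>t\<close>. Hence acceptance is the value of a monotone circuit of polynomial size all of whose proof trees
  have polynomial size.

  Following Reinhardt and Allender, weights on the wires make proof trees of minimum weight unique. For a
  fixed input, a random weight of an \<open>Or\<close> gate makes its two alternatives equally good with small
  probability, since the minimum weights of the gates below do not depend on it. So at least half of all
  weight tables are free of ties, and polynomially many tables, hardwired into the automaton, suffice for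
  all inputs. The unambiguous automaton determines the minimum weights gate by gate by inductive counting:
  knowing how many of the gates below \<open>v\<close> are derivable and the sum of their minimum weights, it can guess,
  in exactly one way, which of them are derivable and a proof tree of minimum weight for each.\<close>

section \<open>Guided computations and machines with an addressed tape\<close>

text \<open>The obstacle is that nondeterministic search certifies only success, while unique
  guessing also needs to know which gates fail. Counting turns failure into arithmetic: skipping a
  derivable gate leaves the count short, a tree above minimum weight leaves the sum too large, and
  neither error can be repaired later in the pass. No table has to be trusted in advance: gate
  \<open>v\<close> is reached only if no tie was met below it, so all guesses made under a table are
  unique even if that table is given up later. The time bound of \<open>N\<close> limits proof trees
  with repetitions of shared gates counted, hence also their weights; so all counters fit into the
  finite control, and only pending gates go to the stack. The ceiling keeps the number of inputs
  below \<open>2 ^ k\<close> for a polynomial \<open>k\<close>. With weights below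
  \<open>2 * m\<close> a fixed gate is tied with probability at most \<open>1 / (2 * m)\<close>, so
  \<open>m\<close> gates contribute at most one half; and \<open>k\<close> tables, chosen one after
  the other so that each halves the set of inputs not yet served, are enough.\<close>

lemma step_not_halting: "step M x c c' \<Longrightarrow> fst c \<in> states M - halt_states M"
  by (cases rule: step.cases) auto

lemma successively_invariant:
  assumes "successively R cs" "cs \<noteq> []" "P (hd cs)" "\<And>c c'. P c \<Longrightarrow> R c c' \<Longrightarrow> P c'"
  shows "\<forall>c \<in> set cs. P c"
  using assms(1-3)
proof (induction cs rule: induct_list012)
  case (3 c c' cs)
  have "P c'" using 3(3,5) assms(4)[of c c'] by simp
  then show ?case using 3 by simp
qed auto

lemma successively_rank:
  fixes r :: "'c \<Rightarrow> nat"
  assumes "successively R cs" "cs \<noteq> []" "P (hd cs)" "\<And>c c'. P c \<Longrightarrow> R c c' \<Longrightarrow> P c'"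
    and "\<And>c c'. P c \<Longrightarrow> R c c' \<Longrightarrow> r c' < r c"
  shows "length cs - 1 + r (last cs) \<le> r (hd cs)"
  using assms(1-3)
proof (induction cs rule: induct_list012)
  case (3 c c' cs)
  have "P c'" "r c' < r c" using 3(3,5) assms(4,5)[of c c'] by simp_all
  moreover have "successively R (c' # cs)" using 3(3) by simp
  ultimately show ?case using "3.IH"(2) by simp
qed auto

text \<open>The relation may branch; only successors satisfying \<open>P\<close> have to agree. The
  last two premises prevent one run from being a proper prefix of the other.\<close>

lemma successively_deterministic:
  assumes "successively R cs" "successively R cs'" "cs \<noteq> []" "cs' \<noteq> []" "hd cs = hd cs'"
    and "\<forall>c \<in> set cs. P c" "\<forall>c \<in> set cs'. P c"
    and "\<And>c c1 c2. P c \<Longrightarrow> R c c1 \<Longrightarrow> R c c2 \<Longrightarrow> P c1 \<Longrightarrow> P c2 \<Longrightarrow> c1 = c2"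
    and "\<And>c. \<not> R (last cs) c" "\<And>c. \<not> R (last cs') c"
  shows "cs = cs'"
  using assms(1-7,9,10)
proof (induction cs arbitrary: cs')
  case (Cons c cs)
  from Cons.prems obtain ds where cs': "cs' = c # ds" by (cases cs') auto
  show ?case
  proof (cases "cs = [] \<or> ds = []")
    case True
    then show ?thesis
      using Cons.prems cs' by (cases cs; cases ds) auto
  next
    case False
    then obtain d es d' es' where cs: "cs = d # es" and ds: "ds = d' # es'"
      by (meson neq_Nil_conv)
    have "P c" "P d" "P d'" "R c d" "R c d'"
      using Cons.prems(1,2,6,7) unfolding cs' cs ds by simp_all
    then have "d = d'" using assms(8) by blast
    moreover have "successively R cs" "successively R ds"
      using Cons.prems(1,2) unfolding cs' cs ds by simp_all
    moreover have "last (c # cs) = last cs" "last cs' = last ds"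
      using cs ds cs' by simp_all
    ultimately have "cs = ds" using Cons.prems(6-9) cs ds \<open>d = d'\<close> unfolding cs'
      by (intro Cons.IH) simp_all
    then show ?thesis using cs' by simp
  qed
qed simp

text \<open>The good configurations are those on the intended computation; the dead ones can no longer
  reach acceptance. Every wrong guess leads from a good configuration to a dead one.\<close>

locale guided_run =
  fixes M :: "('q, 'a, 'g) pda" and x :: "'a list" and good dead :: "('q, 'g) config \<Rightarrow> bool"
    and rank :: "('q, 'g) config \<Rightarrow> nat" and P :: bool
  assumes initial_good: "good (initial M)"
    and good_step: "good c \<Longrightarrow> step M x c c' \<Longrightarrow> good c' \<or> dead c'"
    and dead_step: "dead c \<Longrightarrow> step M x c c' \<Longrightarrow> dead c'"
    and dead_not_acc: "dead c \<Longrightarrow> fst c \<notin> acc_states M"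
    and good_unique: "good c \<Longrightarrow> step M x c c1 \<Longrightarrow> step M x c c2 \<Longrightarrow> good c1 \<Longrightarrow> good c2 \<Longrightarrow> c1 = c2"
    and good_progress: "P \<Longrightarrow> good c \<Longrightarrow> fst c \<notin> halt_states M \<Longrightarrow> \<exists>c'. step M x c c' \<and> good c'"
    and progress: "good c \<or> dead c \<Longrightarrow> fst c \<notin> halt_states M \<Longrightarrow> \<exists>c'. step M x c c'"
    and rank_step: "good c \<or> dead c \<Longrightarrow> step M x c c' \<Longrightarrow> rank c' < rank c"
    and good_acc: "good c \<Longrightarrow> fst c \<in> acc_states M \<Longrightarrow> P"
    and good_not_rej: "good c \<Longrightarrow> fst c \<notin> rej_states M"
begin

lemma halts: "halts_within M x (rank (initial M))"
  unfolding halts_within_def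
proof (intro allI impI)
  fix cs assume cp: "comp_path M x cs"
  then have cs: "cs \<noteq> []" "hd cs = initial M" "successively (step M x) cs"
    by (auto simp: comp_path_def)
  have inv: "\<forall>c \<in> set cs. good c \<or> dead c"
  proof (rule successively_invariant[OF cs(3,1)])
    show "good (hd cs) \<or> dead (hd cs)" using cs(2) initial_good by simp
  qed (use good_step dead_step in blast)
  have "length cs - 1 + rank (last cs) \<le> rank (hd cs)"
  proof (rule successively_rank[where P = "\<lambda>c. good c \<or> dead c", OF cs(3,1)])
    show "good (hd cs) \<or> dead (hd cs)" using cs(2) initial_good by simp
  qed (use good_step dead_step rank_step in blast)+
  moreover have "good (last cs) \<or> dead (last cs)" using inv cs by auto
  then have "halting_path M x cs \<or> (\<exists>c. step M x (last cs) c)"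
    using progress[of "last cs"] cp by (auto simp: halting_path_def)
  ultimately show "length cs - 1 \<le> rank (initial M) \<and>
      (halting_path M x cs \<or> (\<exists>c. step M x (last cs) c))"
    using cs(2) by auto
qed

text \<open>Dead configurations are closed under steps and never accept, so a single wrong guess
  would make the last configuration dead.\<close>

lemma accepting_path_good:
  assumes "accepting_path M x cs"
  shows "\<forall>c \<in> set cs. good c"
proof -
  have "successively (step M x) cs \<Longrightarrow> cs \<noteq> [] \<Longrightarrow> good (hd cs) \<Longrightarrow> fst (last cs) \<in> acc_states M \<Longrightarrow>
      \<forall>c \<in> set cs. good c" for cs
  proof (induction cs rule: induct_list012)
    case (3 c c' cs)
    have "good c'"
    proof (rule ccontr)
      assume "\<not> good c'"
      moreover have "good c" "step M x c c'" using "3.prems" by auto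
      ultimately have "dead c'" using good_step by blast
      have "\<forall>d \<in> set (c' # cs). dead d"
      proof (rule successively_invariant[where R = "step M x"])
        show "dead d'" if "dead d" "step M x d d'" for d d'
          using that by (rule dead_step)
      qed (use "3.prems" \<open>dead c'\<close> in auto)
      then have "dead (last (c' # cs))" using last_in_set by blast
      then show False using dead_not_acc[of "last (c' # cs)"] "3.prems" by simp
    qed
    moreover have "good c" "successively (step M x) (c' # cs)" "fst (last (c' # cs)) \<in> acc_states M"
      using "3.prems" by auto
    ultimately show ?case using "3.IH"(2) by simp
  qed auto
  then show ?thesis
    using assms initial_good by (auto simp: accepting_path_def comp_path_def)
qed

lemma accepting_path_imp: "accepting_path M x cs \<Longrightarrow> P"
  using accepting_path_good[of cs] good_acc[of "last cs"]
  by (auto simp: accepting_path_def comp_path_def)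

lemma accepting_path_unique:
  assumes "accepting_path M x cs" "accepting_path M x cs'"
  shows "cs = cs'"
proof (rule successively_deterministic[where R = "step M x" and P = good])
  have "\<not> step M x (last ds) c" if "accepting_path M x ds" for ds c
    using that step_not_halting[of M x "last ds" c] unfolding accepting_path_def halt_states_def by blast
  then show "\<not> step M x (last cs) c" "\<not> step M x (last cs') c" for c
    using assms by blast+
qed (use assms accepting_path_good good_unique in \<open>auto simp: accepting_path_def comp_path_def\<close>)

text \<open>Following good successors ends because \<open>rank\<close> falls. Without
  \<open>P\<close> a good configuration may have only dead successors.\<close>

lemma accepting_path_exists:
  assumes P
  shows "\<exists>cs. accepting_path M x cs"
proof -
  have "\<exists>ds. successively (step M x) (c # ds) \<and> fst (last (c # ds)) \<in> acc_states M" if "good c" for c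
    using that
  proof (induction "rank c" arbitrary: c rule: less_induct)
    case less
    show ?case
    proof (cases "fst c \<in> halt_states M")
      case True
      then show ?thesis
        using good_not_rej[OF less.prems] by (intro exI[of _ "[]"]) (auto simp: halt_states_def)
    next
      case False
      then obtain c' where c': "step M x c c'" "good c'"
        using good_progress[OF assms less.prems] by blast
      then obtain ds where "successively (step M x) (c' # ds)" "fst (last (c' # ds)) \<in> acc_states M"
        using less.hyps rank_step less.prems by blast
      then show ?thesis using c' by (intro exI[of _ "c' # ds"]) auto
    qed
  qed
  then obtain ds where "successively (step M x) (initial M # ds)"
      "fst (last (initial M # ds)) \<in> acc_states M"
    using initial_good by blast
  then show ?thesis
    by (intro exI[of _ "initial M # ds"]) (auto simp: accepting_path_def comp_path_def)
qed

end

text \<open>An abstract pushdown machine whose transition in state \<open>s\<close> depends on the tape cell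
  \<open>addr s\<close>; a pushdown automaton simulates it by walking to that cell. Cells beyond the right
  endmarker read as the right endmarker, so the length of the input need not be known.
  The bottom marker is invisible: \<open>None\<close> stands for an empty stack.\<close>

locale addr_pda =
  fixes St :: "'s::countable set" and s0 sacc srej :: 's and gm L :: nat
    and addr :: "'s \<Rightarrow> nat"
    and delta :: "'s \<Rightarrow> 'a tape_symbol \<Rightarrow> nat option \<Rightarrow> ('s \<times> nat list) set"
  assumes fin_St: "finite St" and in_St: "s0 \<in> St" "sacc \<in> St" "srej \<in> St"
    and acc_rej: "sacc \<noteq> srej"
    and addr_le: "s \<in> St \<Longrightarrow> addr s \<le> L"
    and delta_finite: "finite (delta s \<sigma> tp)"
    and delta_lists: "s \<in> St \<Longrightarrow> (s', w) \<in> delta s \<sigma> tp \<Longrightarrow> set_option tp \<subseteq> {..<gm} \<Longrightarrow> set w \<subseteq> {..<gm}"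
    and delta_length: "(s', w) \<in> delta s \<sigma> tp \<Longrightarrow> length w \<le> (if tp = None then 1 else 2)"
    and delta_ne: "s \<in> St \<Longrightarrow> s \<noteq> sacc \<Longrightarrow> s \<noteq> srej \<Longrightarrow> delta s \<sigma> tp \<noteq> {}"
begin

text \<open>States outside the finite set \<open>St\<close> are redirected to rejection. So
  \<open>St\<close> need not be closed under \<open>delta\<close>; it is enough that the intended
  run stays inside, and runs whose registers overflow may be cut off.\<close>

definition clamp :: "'s \<Rightarrow> 's" where
  "clamp s = (if s \<in> St then s else srej)"

definition astep :: "'a list \<Rightarrow> 's \<times> nat list \<Rightarrow> 's \<times> nat list \<Rightarrow> bool" where
  "astep x c c' \<longleftrightarrow> fst c \<in> St - {sacc, srej} \<and>
     (\<exists>s' w. (s', w) \<in> delta (fst c) (scanned x (addr (fst c)))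
         (case snd c of [] \<Rightarrow> None | a # _ \<Rightarrow> Some a) \<and>
       c' = (clamp s', w @ tl (snd c)))"

text \<open>The finite control remembers the head position \<open>h\<close>, which makes the walk to
  \<open>addr s\<close> deterministic. Symbol \<open>0\<close> is the bottom marker and
  \<open>Suc y\<close> stands for \<open>y\<close>. The empty set at the left endmarker concerns
  states whose recorded \<open>h\<close> exceeds the true position.\<close>

definition ptrans :: "'s \<times> nat \<Rightarrow> 'a tape_symbol \<Rightarrow> nat \<Rightarrow> (nat \<times> int \<times> nat list) set" where
  "ptrans sh \<sigma> a = (case sh of (s, h) \<Rightarrow>
     if h = addr s \<or> \<sigma> = Right_End \<and> h < addr s
     then (\<lambda>(s', w). (to_nat (clamp s', h), 0, map Suc w @ (if a = 0 then [0] else []))) `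
       delta s \<sigma> (if a = 0 then None else Some (a - 1))
     else if h < addr s then {(to_nat (s, Suc h), 1, [a])}
     else if \<sigma> = Left_End then {}
     else {(to_nat (s, h - 1), -1, [a])})"

definition compiled :: "(nat, 'a, nat) pda" where
  "compiled = \<lparr>states = to_nat ` (St \<times> {..L}), stack_alph = {..gm},
     trans = (\<lambda>n. ptrans (from_nat n)),
     start = to_nat (s0, 0 :: nat), bottom = 0,
     acc_states = to_nat ` ({sacc} \<times> {..L}), rej_states = to_nat ` ({srej} \<times> {..L})\<rparr>"

lemma clamp_in: "clamp s \<in> St"
  using in_St by (simp add: clamp_def)

lemma halt_compiled: "halt_states compiled = to_nat ` ({sacc, srej} \<times> {..L})"
  by (auto simp: halt_states_def compiled_def)

lemma ptrans_length: "(p, d, w) \<in> ptrans sh \<sigma> a \<Longrightarrow> length w \<le> 2"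
  using delta_length by (fastforce simp: ptrans_def split: if_splits prod.splits)

lemma two_npda_compiled: "two_npda \<Sigma> compiled"
proof -
  have "finite (ptrans (s, h) \<sigma> a) \<and> (\<forall>(p, d, w) \<in> ptrans (s, h) \<sigma> a.
      p \<in> to_nat ` (St \<times> {..L}) \<and> d \<in> {-1, 0, 1} \<and> w \<in> lists {..gm} \<and>
      (\<sigma> = Left_End \<longrightarrow> d \<noteq> -1) \<and> (\<sigma> = Right_End \<longrightarrow> d \<noteq> 1) \<and>
      (a = 0 \<longrightarrow> (\<exists>u. w = u @ [0] \<and> 0 \<notin> set u)) \<and> (a \<noteq> 0 \<longrightarrow> 0 \<notin> set w))"
    if sh: "s \<in> St" "h \<le> L" and a: "a \<le> gm" for s h \<sigma> a
  proof -
    let ?tp = "if a = 0 then None else Some (a - 1)"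
    have "set w \<subseteq> {..<gm}" if "(s', w) \<in> delta s \<sigma> ?tp" for s' w
      by (rule delta_lists[OF sh(1) that]) (use a in auto)
    then have "map Suc w @ (if a = 0 then [0] else []) \<in> lists {..gm}" if "(s', w) \<in> delta s \<sigma> ?tp" for s' w
      using that by fastforce
    then show ?thesis
      using addr_le[OF sh(1)] sh a clamp_in delta_finite[of s \<sigma> ?tp]
      by (auto simp: ptrans_def in_lists_conv_set simp del: lists_eq_set)
  qed
  note * = this
  have tr: "finite (trans compiled q \<sigma> a) \<and> (\<forall>(p, d, w) \<in> trans compiled q \<sigma> a.
      p \<in> states compiled \<and> d \<in> {-1, 0, 1} \<and> w \<in> lists (stack_alph compiled) \<and>
      (\<sigma> = Left_End \<longrightarrow> d \<noteq> -1) \<and> (\<sigma> = Right_End \<longrightarrow> d \<noteq> 1) \<and>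
      (a = bottom compiled \<longrightarrow> (\<exists>u. w = u @ [bottom compiled] \<and> bottom compiled \<notin> set u)) \<and>
      (a \<noteq> bottom compiled \<longrightarrow> bottom compiled \<notin> set w))"
    if "q \<in> states compiled" "a \<in> stack_alph compiled" for q \<sigma> a
  proof -
    from that(1) obtain s h where q: "q = to_nat (s, h)" "s \<in> St" "h \<le> L"
      by (auto simp: compiled_def)
    have eqs: "trans compiled q \<sigma> a = ptrans (s, h) \<sigma> a" "states compiled = to_nat ` (St \<times> {..L})"
      "stack_alph compiled = {..gm}" "bottom compiled = 0"
      using q by (simp_all add: compiled_def)
    have "a \<le> gm" using that(2) by (simp add: compiled_def)
    show ?thesis unfolding eqs by (rule *[OF q(2,3) \<open>a \<le> gm\<close>])
  qed
  have st: "finite (states compiled)" "finite (stack_alph compiled)"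
    "start compiled \<in> states compiled" "bottom compiled \<in> stack_alph compiled"
    "acc_states compiled \<subseteq> states compiled" "rej_states compiled \<subseteq> states compiled"
    "acc_states compiled \<inter> rej_states compiled = {}"
    using fin_St in_St acc_rej by (auto simp: compiled_def)
  have "\<forall>q \<in> states compiled - halt_states compiled. \<forall>\<sigma> \<in> tape_alph \<Sigma>. \<forall>a \<in> stack_alph compiled.
      finite (trans compiled q \<sigma> a) \<and> (\<forall>(p, d, w) \<in> trans compiled q \<sigma> a.
      p \<in> states compiled \<and> d \<in> {-1, 0, 1} \<and> w \<in> lists (stack_alph compiled) \<and>
      (\<sigma> = Left_End \<longrightarrow> d \<noteq> -1) \<and> (\<sigma> = Right_End \<longrightarrow> d \<noteq> 1) \<and>
      (a = bottom compiled \<longrightarrow> (\<exists>u. w = u @ [bottom compiled] \<and> bottom compiled \<notin> set u)) \<and>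
      (a \<noteq> bottom compiled \<longrightarrow> bottom compiled \<notin> set w))"
    by (intro ballI tr) auto
  with st show ?thesis unfolding two_npda_def by (intro conjI)
qed

lemma push_size_compiled: "push_size \<Sigma> compiled \<le> 2"
proof -
  define X where "X = {length w | q \<sigma> a p d w.
     q \<in> states compiled - halt_states compiled \<and> \<sigma> \<in> tape_alph \<Sigma> \<and> a \<in> stack_alph compiled \<and>
     (p, d, w) \<in> trans compiled q \<sigma> a}"
  have le: "y \<le> 2" if "y \<in> X" for y
    using that ptrans_length by (auto simp: compiled_def X_def)
  have "Sup X \<le> 2"
  proof (cases "X = {}")
    case False
    then show ?thesis using le by (rule cSup_least)
  qed simp
  then show ?thesis by (simp add: push_size_def X_def)
qed

definition conc :: "'s \<Rightarrow> nat \<Rightarrow> nat list \<Rightarrow> (nat, nat) config" where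
  "conc s h z = (to_nat (s, h), h, map Suc z @ [0])"

lemma conc_inject: "conc s h z = conc s' h' z' \<longleftrightarrow> s = s' \<and> h = h' \<and> z = z'"
  by (auto simp: conc_def inj_map_eq_map)

definition arrived :: "'a list \<Rightarrow> 's \<Rightarrow> nat \<Rightarrow> bool" where
  "arrived x s h \<longleftrightarrow> h = min (addr s) (length x + 1)"

lemma scanned_Right_End: "scanned x h = Right_End \<longleftrightarrow> h > length x"
  by (auto simp: scanned_def)

lemma scanned_Left_End: "scanned x h = Left_End \<longleftrightarrow> h = 0"
  by (auto simp: scanned_def)

lemma scanned_arrived: "arrived x s h \<Longrightarrow> scanned x h = scanned x (addr s)"
  by (auto simp: arrived_def scanned_def min_def)

text \<open>Recorded and true head position agree, and an address beyond the input counts as reached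
  at the right endmarker. So a concrete step is either an abstract step on the spot or one cell of a
  walk that leaves no choice.\<close>

lemma step_conc:
  assumes "s \<in> St" "h \<le> length x + 1" "length x + 1 \<le> L"
  shows "step compiled x (conc s h z) c \<longleftrightarrow> s \<noteq> sacc \<and> s \<noteq> srej \<and>
    (if arrived x s h then \<exists>s' z'. astep x (s, z) (s', z') \<and> c = conc s' h z'
     else if h < addr s then c = conc s (Suc h) z else c = conc s (h - 1) z)" (is "?L = ?R")
proof -
  \<comment> \<open>An empty abstract stack shows the bottom marker, which every transition puts
    back.\<close>
  let ?a = "case z of [] \<Rightarrow> 0 | a # _ \<Rightarrow> Suc a"
  let ?z = "case z of [] \<Rightarrow> [] | _ # z' \<Rightarrow> map Suc z' @ [0]"
  have stack: "map Suc z @ [0] = ?a # ?z" by (cases z) auto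
  have nh: "to_nat (s, h) \<in> states compiled - halt_states compiled \<longleftrightarrow> s \<noteq> sacc \<and> s \<noteq> srej"
    using assms unfolding halt_compiled by (auto simp: compiled_def)
  have "?L \<longleftrightarrow> s \<noteq> sacc \<and> s \<noteq> srej \<and> (\<exists>p d w j. (p, d, w) \<in> ptrans (s, h) (scanned x h) ?a \<and>
      int j = int h + d \<and> c = (p, j, w @ ?z))"
  proof
    assume ?L
    then obtain q i a w' p j w d where *: "conc s h z = (q, i, a # w')" "c = (p, j, w @ w')"
      "q \<in> states compiled - halt_states compiled" "(p, d, w) \<in> trans compiled q (scanned x i) a"
      "int j = int i + d"
      by (cases rule: step.cases) blast
    then have "q = to_nat (s, h)" "i = h" "a = ?a" "w' = ?z"
      unfolding conc_def stack by auto
    with * show "s \<noteq> sacc \<and> s \<noteq> srej \<and> (\<exists>p d w j. (p, d, w) \<in> ptrans (s, h) (scanned x h) ?a \<and>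
      int j = int h + d \<and> c = (p, j, w @ ?z))"
      using nh by (auto simp: compiled_def)
  next
    assume "s \<noteq> sacc \<and> s \<noteq> srej \<and> (\<exists>p d w j. (p, d, w) \<in> ptrans (s, h) (scanned x h) ?a \<and>
      int j = int h + d \<and> c = (p, j, w @ ?z))"
    then obtain p d w j where *: "s \<noteq> sacc" "s \<noteq> srej" "(p, d, w) \<in> ptrans (s, h) (scanned x h) ?a"
      "int j = int h + d" "c = (p, j, w @ ?z)"
      by blast
    show ?L
      unfolding conc_def stack *(5)
      using nh * by (intro step.intros[where d = d]) (auto simp: compiled_def)
  qed
  also have "(\<exists>p d w j. (p, d, w) \<in> ptrans (s, h) (scanned x h) ?a \<and>
      int j = int h + d \<and> c = (p, j, w @ ?z)) \<longleftrightarrow>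
    (if arrived x s h then \<exists>s' w. (s', w) \<in> delta s (scanned x (addr s))
        (case z of [] \<Rightarrow> None | a # _ \<Rightarrow> Some a) \<and> c = conc (clamp s') h (w @ tl z)
     else if h < addr s then c = conc s (Suc h) z else c = conc s (h - 1) z)"
  proof (cases "arrived x s h")
    case True
    then have ar: "h = addr s \<or> scanned x h = Right_End \<and> h < addr s"
      by (auto simp: arrived_def scanned_Right_End min_def split: if_splits)
    let ?D = "delta s (scanned x (addr s)) (case z of [] \<Rightarrow> None | a # _ \<Rightarrow> Some a)"
    have "(if ?a = 0 then None else Some (?a - 1)) = (case z of [] \<Rightarrow> None | a # _ \<Rightarrow> Some a)"
      by (cases z) auto
    then have pt: "ptrans (s, h) (scanned x h) ?a =
        (\<lambda>(s', w). (to_nat (clamp s', h), 0, map Suc w @ (if ?a = 0 then [0] else []))) ` ?D"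
      unfolding scanned_arrived[OF True, symmetric] ptrans_def using ar by (simp only: prod.case if_True)
    have ap: "(map Suc w @ (if ?a = 0 then [0] else [])) @ ?z = map Suc (w @ tl z) @ [0]" for w
      by (cases z) auto
    have j: "int j = int h + 0 \<longleftrightarrow> j = h" for j by simp
    show ?thesis
      unfolding pt if_P[OF True] conc_def ap[symmetric] j[symmetric] by (auto simp del: append_assoc)
  next
    case False
    then have 1: "\<not> (h = addr s \<or> scanned x h = Right_End \<and> h < addr s)"
      using assms by (auto simp: arrived_def scanned_Right_End min_def split: if_splits)
    have "h < addr s \<or> h > addr s" using 1 by linarith
    then show ?thesis
    proof
      assume h: "h < addr s"
      then have "ptrans (s, h) (scanned x h) ?a = {(to_nat (s, Suc h), 1, [?a])}"
        using 1 by (simp add: ptrans_def)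
      moreover have "int j = int h + 1 \<longleftrightarrow> j = Suc h" for j by linarith
      ultimately show ?thesis
        using False h unfolding conc_def stack by simp
    next
      assume "h > addr s"
      moreover from this have "scanned x h \<noteq> Left_End" by (simp add: scanned_Left_End)
      ultimately have "ptrans (s, h) (scanned x h) ?a = {(to_nat (s, h - 1), -1, [?a])}"
        using 1 by (simp add: ptrans_def)
      moreover from \<open>h > addr s\<close> have "int j = int h - 1 \<longleftrightarrow> j = h - 1" for j by linarith
      ultimately show ?thesis
        using False \<open>h > addr s\<close> unfolding conc_def stack by simp
    qed
  qed
  also have "s \<noteq> sacc \<and> s \<noteq> srej \<and> \<dots> \<longleftrightarrow> ?R"
    using assms(1) unfolding astep_def fst_conv snd_conv prod.inject by (cases "arrived x s h") (simp, blast, simp)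
  finally show ?thesis .
qed

end

section \<open>Transfer of guided runs from the abstract machine to the automaton\<close>

locale guided_addr_pda = addr_pda St s0 sacc srej gm L addr delta
  for St :: "'s::countable set" and s0 sacc srej gm L addr
    and delta :: "'s \<Rightarrow> 'a tape_symbol \<Rightarrow> nat option \<Rightarrow> ('s \<times> nat list) set" +
  fixes x :: "'a list" and good dead :: "'s \<times> nat list \<Rightarrow> bool" and rank :: "'s \<times> nat list \<Rightarrow> nat"
    and P :: bool
  assumes length_x: "length x + 1 \<le> L"
    and a_initial_good: "good (s0, [])"
    and a_good_step: "good c \<Longrightarrow> astep x c c' \<Longrightarrow> good c' \<or> dead c'"
    and a_dead_step: "dead c \<Longrightarrow> astep x c c' \<Longrightarrow> dead c'"
    and a_dead_not_acc: "\<not> dead (sacc, z)"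
    and a_good_unique: "good c \<Longrightarrow> astep x c c1 \<Longrightarrow> astep x c c2 \<Longrightarrow> good c1 \<Longrightarrow> good c2 \<Longrightarrow> c1 = c2"
    and a_good_progress: "P \<Longrightarrow> good c \<Longrightarrow> fst c \<in> St - {sacc, srej} \<Longrightarrow> \<exists>c'. astep x c c' \<and> good c'"
    and a_rank_step: "good c \<or> dead c \<Longrightarrow> astep x c c' \<Longrightarrow> rank c' < rank c"
    and a_good_acc: "good (sacc, z) \<Longrightarrow> P"
    and a_good_not_rej: "\<not> good (srej, z)"
begin

definition lift :: "('s \<times> nat list \<Rightarrow> bool) \<Rightarrow> (nat, nat) config \<Rightarrow> bool" where
  "lift Q c \<longleftrightarrow> (\<exists>s h z. c = conc s h z \<and> s \<in> St \<and> h \<le> length x + 1 \<and> Q (s, z))"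

definition dist_to :: "'s \<Rightarrow> nat \<Rightarrow> nat" where
  "dist_to s h = (let a = min (addr s) (length x + 1) in (h - a) + (a - h))"

text \<open>A lexicographic order packed into one number: a walk is at most \<open>L\<close> cells
  long, so a drop of the abstract rank by one, worth \<open>L + 2\<close>, pays for the next walk.
  \<open>butlast\<close> and the decrement undo the stack coding of \<open>conc\<close>.\<close>

definition crank :: "(nat, nat) config \<Rightarrow> nat" where
  "crank c = (case c of (n, h, z) \<Rightarrow> case from_nat n of (s, _ :: nat) \<Rightarrow>
     rank (s, map (\<lambda>y. y - 1) (butlast z)) * (L + 2) + dist_to s h)"

lemma crank_conc: "crank (conc s h z) = rank (s, z) * (L + 2) + dist_to s h"
  by (simp add: crank_def conc_def comp_def)

lemma dist_to_le: "h \<le> length x + 1 \<Longrightarrow> dist_to s h \<le> L"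
  using length_x by (auto simp: dist_to_def Let_def min_def)

lemma lift_cases:
  assumes "lift Q c"
  obtains s h z where "c = conc s h z" "s \<in> St" "h \<le> length x + 1" "Q (s, z)"
  using assms unfolding lift_def by blast

lemma step_lift:
  assumes c: "s \<in> St" "h \<le> length x + 1" and st: "step compiled x (conc s h z) c'"
  shows "s \<noteq> sacc \<and> s \<noteq> srej \<and> (\<exists>s' h' z'. c' = conc s' h' z' \<and> s' \<in> St \<and> h' \<le> length x + 1 \<and>
    (arrived x s h \<and> astep x (s, z) (s', z') \<or>
     \<not> arrived x s h \<and> s' = s \<and> z' = z \<and> dist_to s h' < dist_to s h))"
proof -
  have *: "s \<noteq> sacc \<and> s \<noteq> srej \<and>
    (if arrived x s h then \<exists>s' z'. astep x (s, z) (s', z') \<and> c' = conc s' h z'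
     else if h < addr s then c' = conc s (Suc h) z else c' = conc s (h - 1) z)"
    using st step_conc[OF c length_x] by blast
  have cl: "s' \<in> St" if "astep x (s, z) (s', z')" for s' z'
    using that clamp_in by (auto simp: astep_def)
  show ?thesis
  proof (cases "arrived x s h")
    case True
    then show ?thesis using * cl c by simp blast
  next
    case False
    show ?thesis
    proof (cases "h < addr s")
      case True
      then have "Suc h \<le> length x + 1" "dist_to s (Suc h) < dist_to s h"
        using False c by (auto simp: arrived_def dist_to_def Let_def min_def split: if_splits)
      then show ?thesis using * False True c by auto
    next
      case f: False
      then have "dist_to s (h - 1) < dist_to s h"
        using False c by (auto simp: arrived_def dist_to_def Let_def min_def)
      then show ?thesis using * False f c by auto
    qed
  qed
qed

lemma initial_compiled: "initial compiled = conc s0 0 []"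
  by (simp add: initial_def compiled_def conc_def)

lemma fst_conc_acc: "h \<le> L \<Longrightarrow> fst (conc s h z) \<in> acc_states compiled \<longleftrightarrow> s = sacc"
  and fst_conc_rej: "h \<le> L \<Longrightarrow> fst (conc s h z) \<in> rej_states compiled \<longleftrightarrow> s = srej"
  by (auto simp: conc_def compiled_def)

lemma fst_conc_halt: "h \<le> L \<Longrightarrow> fst (conc s h z) \<in> halt_states compiled \<longleftrightarrow> s = sacc \<or> s = srej"
  using fst_conc_acc fst_conc_rej by (auto simp: halt_states_def)

sublocale run: guided_run compiled x "lift good" "lift dead" crank P
proof
  show "lift good (initial compiled)"
    using a_initial_good in_St unfolding lift_def initial_compiled by force
next
  fix c c' assume "lift good c" and st: "step compiled x c c'"
  from \<open>lift good c\<close> obtain s h z where c: "c = conc s h z" "s \<in> St" "h \<le> length x + 1" "good (s, z)"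
    by (rule lift_cases)
  from step_lift[OF c(2,3)] st c a_good_step[OF c(4)] show "lift good c' \<or> lift dead c'"
    unfolding lift_def by blast
next
  fix c c' assume "lift dead c" and st: "step compiled x c c'"
  from \<open>lift dead c\<close> obtain s h z where c: "c = conc s h z" "s \<in> St" "h \<le> length x + 1" "dead (s, z)"
    by (rule lift_cases)
  from step_lift[OF c(2,3)] st c a_dead_step[OF c(4)] show "lift dead c'"
    unfolding lift_def by blast
next
  fix c assume "lift dead c"
  then obtain s h z where c: "c = conc s h z" "s \<in> St" "h \<le> length x + 1" "dead (s, z)"
    by (rule lift_cases)
  then show "fst c \<notin> acc_states compiled"
    using fst_conc_acc[of h s z] length_x a_dead_not_acc[of z] by auto
next
  fix c c1 c2 assume "lift good c" and st: "step compiled x c c1" "step compiled x c c2"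
    and g: "lift good c1" "lift good c2"
  from \<open>lift good c\<close> obtain s h z where c: "c = conc s h z" "s \<in> St" "h \<le> length x + 1" "good (s, z)"
    by (rule lift_cases)
  show "c1 = c2"
  proof (cases "arrived x s h")
    case True
    with st c step_conc[OF c(2,3) length_x] obtain s1 z1 s2 z2 where
      "astep x (s, z) (s1, z1)" "c1 = conc s1 h z1" "astep x (s, z) (s2, z2)" "c2 = conc s2 h z2"
      by auto
    moreover from this g have "good (s1, z1)" "good (s2, z2)"
      by (auto simp: lift_def conc_inject)
    ultimately show ?thesis using a_good_unique[OF c(4)] by blast
  next
    case False
    with st c step_conc[OF c(2,3) length_x] show ?thesis by (auto split: if_splits)
  qed
next
  fix c assume P and "lift good c" and nh: "fst c \<notin> halt_states compiled"
  from \<open>lift good c\<close> obtain s h z where c: "c = conc s h z" "s \<in> St" "h \<le> length x + 1" "good (s, z)"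
    by (rule lift_cases)
  have s: "s \<noteq> sacc" "s \<noteq> srej"
    using nh c fst_conc_halt[of h s z] length_x by auto
  show "\<exists>c'. step compiled x c c' \<and> lift good c'"
  proof (cases "arrived x s h")
    case True
    obtain s' z' where "astep x (s, z) (s', z')" "good (s', z')"
      using a_good_progress[OF \<open>P\<close> c(4)] c(2) s by auto
    moreover from this have "s' \<in> St" using clamp_in by (auto simp: astep_def)
    ultimately show ?thesis
      using True s c step_conc[OF c(2,3) length_x, of z "conc s' h z'"]
      by (intro exI[of _ "conc s' h z'"]) (auto simp: lift_def)
  next
    case False
    let ?c = "if h < addr s then conc s (Suc h) z else conc s (h - 1) z"
    have "step compiled x c ?c"
      using False s c step_conc[OF c(2,3) length_x, of z ?c] by auto
    then show ?thesis
      using step_lift[OF c(2,3)] c False unfolding lift_def by blast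
  qed
next
  fix c assume "lift good c \<or> lift dead c" and nh: "fst c \<notin> halt_states compiled"
  then obtain s h z where c: "c = conc s h z" "s \<in> St" "h \<le> length x + 1"
    using lift_cases by metis
  have s: "s \<noteq> sacc" "s \<noteq> srej"
    using nh c fst_conc_halt[of h s z] length_x by auto
  show "\<exists>c'. step compiled x c c'"
  proof (cases "arrived x s h")
    case True
    obtain s' w where "(s', w) \<in> delta s (scanned x (addr s)) (case z of [] \<Rightarrow> None | a # _ \<Rightarrow> Some a)"
      using delta_ne[OF c(2) s] by fast
    then have "astep x (s, z) (clamp s', w @ tl z)"
      using c s by (auto simp: astep_def)
    then have "step compiled x c (conc (clamp s') h (w @ tl z))"
      using True s c step_conc[OF c(2,3) length_x] by metis
    then show ?thesis ..
  next
    case False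
    then show ?thesis using s c step_conc[OF c(2,3) length_x] by (cases "h < addr s") auto
  qed
next
  fix c c' assume gd: "lift good c \<or> lift dead c" and st: "step compiled x c c'"
  then obtain s h z where c: "c = conc s h z" "s \<in> St" "h \<le> length x + 1" "good (s, z) \<or> dead (s, z)"
    using lift_cases by metis
  from step_lift[OF c(2,3)] st c(1) obtain s' h' z' where c': "c' = conc s' h' z'" "h' \<le> length x + 1"
    "astep x (s, z) (s', z') \<or> s' = s \<and> z' = z \<and> dist_to s h' < dist_to s h"
    by blast
  from c'(3) show "crank c' < crank c"
  proof
    assume "astep x (s, z) (s', z')"
    then have "Suc (rank (s', z')) \<le> rank (s, z)" using a_rank_step c(4) by fastforce
    then have "Suc (rank (s', z')) * (L + 2) \<le> rank (s, z) * (L + 2)" by (rule mult_le_mono1)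
    moreover have "dist_to s' h' \<le> L" using dist_to_le c' by blast
    ultimately show ?thesis using c(1) c'(1) by (simp add: crank_conc)
  qed (use c c' in \<open>simp add: crank_conc\<close>)
next
  fix c assume "lift good c" "fst c \<in> acc_states compiled"
  then show P
    using fst_conc_acc length_x a_good_acc by (elim lift_cases) fastforce
next
  fix c assume "lift good c"
  then obtain s h z where c: "c = conc s h z" "s \<in> St" "h \<le> length x + 1" "good (s, z)"
    by (rule lift_cases)
  then show "fst c \<notin> rej_states compiled"
    using fst_conc_rej[of h s z] length_x a_good_not_rej[of z] by auto
qed

lemma halts_compiled: "halts_within compiled x (rank (s0, []) * (L + 2) + L)"
proof -
  have "crank (initial compiled) \<le> rank (s0, []) * (L + 2) + L"
    using dist_to_le[of 0 s0] by (simp add: initial_compiled crank_conc)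
  then show ?thesis using run.halts unfolding halts_within_def by fastforce
qed

end

section \<open>Inductive counting on a weighted circuit\<close>

datatype ('a, 'n) gate = Lit nat "'a tape_symbol set" | And 'n 'n | Or 'n 'n

text \<open>Literals have no children; \<open>0\<close> is a placeholder, since \<open>comb\<close>
  and \<open>tied\<close> consult child values only at \<open>And\<close> and \<open>Or\<close>
  gates.\<close>

fun lc :: "('a, nat) gate \<Rightarrow> nat" where
  "lc (Lit _ _) = 0" | "lc (And a _) = a" | "lc (Or a _) = a"

fun rc :: "('a, nat) gate \<Rightarrow> nat" where
  "rc (Lit _ _) = 0" | "rc (And _ b) = b" | "rc (Or _ b) = b"

fun gaddr :: "('a, nat) gate \<Rightarrow> nat" where
  "gaddr (Lit a _) = a" | "gaddr _ = 0"

inductive der :: "('n \<Rightarrow> ('a, 'n) gate) \<Rightarrow> 'a list \<Rightarrow> 'n \<Rightarrow> bool" for C x where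
  Lit: "der C x v" if "C v = Lit a S" "scanned x a \<in> S"
| And: "der C x v" if "C v = And a b" "der C x a" "der C x b"
| OrL: "der C x v" if "C v = Or a b" "der C x a"
| OrR: "der C x v" if "C v = Or a b" "der C x b"

fun comb :: "('a, nat) gate \<Rightarrow> nat \<Rightarrow> 'a tape_symbol \<Rightarrow> nat option \<Rightarrow> nat option \<Rightarrow> nat option" where
  "comb (Lit _ S) w \<sigma> p q = (if \<sigma> \<in> S then Some 0 else None)"
| "comb (And _ _) w \<sigma> (Some p) (Some q) = Some (p + q)"
| "comb (And _ _) w \<sigma> p q = None"
| "comb (Or _ _) w \<sigma> (Some p) (Some q) = Some (min (p + w) q)"
| "comb (Or _ _) w \<sigma> (Some p) None = Some (p + w)"
| "comb (Or _ _) w \<sigma> None q = q"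

text \<open>Exactly here a tree of minimum weight would stop being unique: with one underivable
  child an \<open>Or\<close> gate leaves no choice.\<close>

fun tied :: "('a, nat) gate \<Rightarrow> nat \<Rightarrow> nat option \<Rightarrow> nat option \<Rightarrow> bool" where
  "tied (Or _ _) w (Some p) (Some q) \<longleftrightarrow> p + w = q"
| "tied _ _ _ _ \<longleftrightarrow> False"

text \<open>The minimum weight of a proof tree for gate \<open>v\<close>, where each use of the left wire of an
  \<open>Or\<close> gate \<open>u\<close> costs \<open>w u\<close>; \<open>None\<close> if there is no proof tree.\<close>

function min_weight :: "(nat \<Rightarrow> ('a, nat) gate) \<Rightarrow> (nat \<Rightarrow> nat) \<Rightarrow> 'a list \<Rightarrow> nat \<Rightarrow> nat option" where
  "min_weight C w x v = comb (C v) (w v) (scanned x (gaddr (C v)))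
     (if lc (C v) < v then min_weight C w x (lc (C v)) else None)
     (if rc (C v) < v then min_weight C w x (rc (C v)) else None)"
  by auto
termination by (relation "measure (\<lambda>(C, w, x, v). v)") auto

declare min_weight.simps [simp del]

text \<open>The guards are those of \<open>min_weight\<close>, where they force termination for an
  arbitrary \<open>C\<close>; at the \<open>And\<close> and \<open>Or\<close> gates of a
  \<open>circuit\<close> they hold.\<close>

definition child_weights :: "(nat \<Rightarrow> ('a, nat) gate) \<Rightarrow> (nat \<Rightarrow> nat) \<Rightarrow> 'a list \<Rightarrow> nat \<Rightarrow> nat option \<times> nat option" where
  "child_weights C w x v =
     (if lc (C v) < v then min_weight C w x (lc (C v)) else None,
      if rc (C v) < v then min_weight C w x (rc (C v)) else None)"

definition tie :: "(nat \<Rightarrow> ('a, nat) gate) \<Rightarrow> (nat \<Rightarrow> nat) \<Rightarrow> 'a list \<Rightarrow> nat \<Rightarrow> bool" where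
  "tie C w x v = tied (C v) (w v) (fst (child_weights C w x v)) (snd (child_weights C w x v))"

definition wt :: "nat option \<Rightarrow> nat" where
  "wt d = (case d of None \<Rightarrow> 0 | Some y \<Rightarrow> y)"

definition ind :: "nat option \<Rightarrow> nat" where
  "ind d = (if d = None then 0 else 1)"

lemma wt_simps [simp]: "wt None = 0" "wt (Some y) = y"
  by (simp_all add: wt_def)

lemma ind_simps [simp]: "ind None = 0" "ind (Some y) = 1"
  by (simp_all add: ind_def)

text \<open>\<open>tau v\<close> bounds the size of every proof tree of gate \<open>v\<close>.\<close>

locale circuit =
  fixes C :: "nat \<Rightarrow> ('a, nat) gate" and m T L :: nat and tau :: "nat \<Rightarrow> nat"
  assumes m_pos: "0 < m"
    and And_less: "v < m \<Longrightarrow> C v = And a b \<Longrightarrow> a < v \<and> b < v \<and> tau a + tau b < tau v"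
    and Or_less: "v < m \<Longrightarrow> C v = Or a b \<Longrightarrow> a < v \<and> b < v \<and> tau a < tau v \<and> tau b < tau v"
    and tau_pos: "v < m \<Longrightarrow> 0 < tau v"
    and tau_le: "v < m \<Longrightarrow> tau v \<le> T"
    and gaddr_le: "v < m \<Longrightarrow> gaddr (C v) \<le> L"
begin

lemma min_weight_Lit: "C v = Lit a S \<Longrightarrow> min_weight C w x v = (if scanned x a \<in> S then Some 0 else None)"
  by (subst min_weight.simps) simp

lemma min_weight_And:
  "v < m \<Longrightarrow> C v = And a b \<Longrightarrow>
   min_weight C w x v = comb (And a b :: ('a, nat) gate) 0 Left_End (min_weight C w x a) (min_weight C w x b)"
  using And_less[of v a b] by (subst min_weight.simps) (cases "min_weight C w x a"; cases "min_weight C w x b"; simp)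

lemma min_weight_Or:
  "v < m \<Longrightarrow> C v = Or a b \<Longrightarrow>
   min_weight C w x v = comb (Or a b :: ('a, nat) gate) (w v) Left_End (min_weight C w x a) (min_weight C w x b)"
  using Or_less[of v a b] by (subst min_weight.simps) (cases "min_weight C w x a"; cases "min_weight C w x b"; simp)

lemma tie_Or:
  "v < m \<Longrightarrow> C v = Or a b \<Longrightarrow>
   tie C w x v = tied (Or a b :: ('a, nat) gate) (w v) (min_weight C w x a) (min_weight C w x b)"
  using Or_less[of v a b] by (simp add: tie_def child_weights_def)

lemma min_weight_der: "v < m \<Longrightarrow> min_weight C w x v \<noteq> None \<longleftrightarrow> der C x v"
proof (induction v rule: less_induct)
  case (less v)
  show ?case
  proof (cases "C v")
    case (Lit a S)
    then show ?thesis by (simp add: min_weight_Lit der.simps[of C x v])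
  next
    case (And a b)
    with less And_less[of v a b] have "min_weight C w x a \<noteq> None \<longleftrightarrow> der C x a" "min_weight C w x b \<noteq> None \<longleftrightarrow> der C x b"
      by auto
    then show ?thesis using And less.prems
      by (cases "min_weight C w x a"; cases "min_weight C w x b") (auto simp: min_weight_And der.simps[of C x v])
  next
    case (Or a b)
    with less Or_less[of v a b] have "min_weight C w x a \<noteq> None \<longleftrightarrow> der C x a" "min_weight C w x b \<noteq> None \<longleftrightarrow> der C x b"
      by auto
    then show ?thesis using Or less.prems
      by (cases "min_weight C w x a"; cases "min_weight C w x b") (auto simp: min_weight_Or der.simps[of C x v])
  qed
qed

text \<open>A proof tree uses at most \<open>tau v\<close> weighted wires, each of cost at most
  \<open>K\<close>. The strict inequality \<open>tau a < tau v\<close> at an \<open>Or\<close> gate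
  leaves room for its own wire.\<close>

lemma min_weight_le:
  assumes w: "\<And>v. v < m \<Longrightarrow> w v \<le> K"
  shows "v < m \<Longrightarrow> wt (min_weight C w x v) \<le> K * tau v"
proof (induction v rule: less_induct)
  case (less v)
  show ?case
  proof (cases "C v")
    case (Lit a S)
    then show ?thesis by (simp add: min_weight_Lit)
  next
    case (And a b)
    then have ab: "a < v" "b < v" "tau a + tau b < tau v" using And_less less.prems by blast+
    then have "K * tau a + K * tau b \<le> K * tau v"
      by (metis add_mult_distrib2 less_imp_le_nat mult_le_mono2)
    moreover have "wt (min_weight C w x a) \<le> K * tau a" "wt (min_weight C w x b) \<le> K * tau b"
      using less ab by simp_all
    ultimately show ?thesis
      using And less.prems by (cases "min_weight C w x a"; cases "min_weight C w x b") (auto simp: min_weight_And)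
  next
    case (Or a b)
    then have ab: "a < v" "b < v" "tau a < tau v" "tau b < tau v" using Or_less less.prems by blast+
    have "K * Suc (tau a) \<le> K * tau v" "K * tau b \<le> K * tau v"
      using ab by (auto intro: mult_le_mono2 less_imp_le simp del: mult_Suc_right)
    then have "K * tau a + K \<le> K * tau v" "K * tau b \<le> K * tau v" by simp_all
    moreover have "wt (min_weight C w x a) \<le> K * tau a" "wt (min_weight C w x b) \<le> K * tau b" "w v \<le> K"
      using less ab w by simp_all
    ultimately have "wt (min_weight C w x a) + w v \<le> K * tau v" "wt (min_weight C w x b) \<le> K * tau v"
      by linarith+
    then show ?thesis
      using Or less.prems
      by (cases "min_weight C w x a"; cases "min_weight C w x b") (auto simp: min_weight_Or)
  qed
qed

end

text \<open>The unambiguous machine. In \<open>(i, v, c, s)\<close>, \<open>i\<close> is the current weight table, and \<open>c\<close> and \<open>s\<close>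
  are the number of derivable gates below \<open>v\<close> and the sum of their minimum weights. To find the
  minimum weight of gate \<open>v\<close>, a pass \<open>(u, c', s', p, q)\<close> goes through the gates \<open>u < v\<close>; each of
  them is either skipped or verified by guessing a proof tree, depth first with pending gates on the
  stack. Since at the end \<open>c'\<close> and \<open>s'\<close> have to equal \<open>c\<close> and \<open>s\<close>, only the skipping of underivable
  gates and trees of minimum weight survive, and \<open>p\<close>, \<open>q\<close> are the values of the two children of \<open>v\<close>.
  A tie at \<open>v\<close> makes the machine turn to the next table.\<close>

type_synonym outer = "nat \<times> nat \<times> nat \<times> nat"
type_synonym inner = "nat \<times> nat \<times> nat \<times> nat option \<times> nat option"

datatype st = Pass outer inner | Dfs outer inner nat nat | Ret outer inner nat | Acc | Rej

instance st :: countable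
  by countable_datatype

text \<open>Every transition removes the top symbol; \<open>keep\<close> puts it back.\<close>

definition keep :: "nat option \<Rightarrow> nat list" where
  "keep tp = (case tp of None \<Rightarrow> [] | Some a \<Rightarrow> [a])"

definition start_pass :: "outer \<Rightarrow> st" where
  "start_pass out = Pass out (0, 0, 0, None, None)"

locale counting = circuit C m T L tau
  for C :: "nat \<Rightarrow> ('a, nat) gate" and m T L :: nat and tau :: "nat \<Rightarrow> nat" +
  fixes W :: "nat \<Rightarrow> nat \<Rightarrow> nat" and k K :: nat
  assumes W_le: "i < k \<Longrightarrow> v < m \<Longrightarrow> W i v \<le> K" and k_pos: "0 < k"
begin

text \<open>Gate \<open>m - 1\<close> is the output, so its value decides the answer. After a tie
  the counting restarts at gate \<open>0\<close>, because counts and weights obtained under the old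
  table say nothing about the new sums.\<close>

definition pass_end :: "outer \<Rightarrow> inner \<Rightarrow> 'a tape_symbol \<Rightarrow> st" where
  "pass_end out inn \<sigma> = (case out of (i, v, c, s) \<Rightarrow> case inn of (u, c', s', p, q) \<Rightarrow>
     if c' \<noteq> c \<or> s' \<noteq> s then Rej
     else if tied (C v) (W i v) p q then (if Suc i < k then start_pass (Suc i, 0, 0, 0) else Rej)
     else let d = comb (C v) (W i v) \<sigma> p q in
       if Suc v = m then (if d = None then Rej else Acc)
       else start_pass (i, Suc v, c + ind d, s + wt d))"

text \<open>In \<open>Dfs\<close>, \<open>g\<close> is the gate being expanded and \<open>t\<close>
  the weight spent so far on the tree of \<open>u\<close>. \<open>Ret\<close> fetches the next
  pending gate; an empty stack means that the tree is complete, and then \<open>t\<close> is taken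
  as the weight of \<open>u\<close>.\<close>

fun delta :: "st \<Rightarrow> 'a tape_symbol \<Rightarrow> nat option \<Rightarrow> (st \<times> nat list) set" where
  "delta (Pass (i, v, c, s) (u, c', s', p, q)) \<sigma> tp = (\<lambda>r. (r, keep tp)) `
     (if u < v then {Pass (i, v, c, s) (Suc u, c', s', p, q), Dfs (i, v, c, s) (u, c', s', p, q) u 0}
      else {pass_end (i, v, c, s) (u, c', s', p, q) \<sigma>})"
| "delta (Dfs out inn g t) \<sigma> tp = (case C g of
     Lit a S \<Rightarrow> {(if \<sigma> \<in> S then Ret out inn t else Rej, keep tp)}
   | And a b \<Rightarrow> {(Dfs out inn a t, b # keep tp)}
   | Or a b \<Rightarrow> {(Dfs out inn a (t + W (fst out) g), keep tp), (Dfs out inn b t, keep tp)})"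
| "delta (Ret (i, v, c, s) (u, c', s', p, q) t) \<sigma> None =
     {(Pass (i, v, c, s) (Suc u, Suc c', s' + t,
         if lc (C v) = u then Some t else p, if rc (C v) = u then Some t else q), [])}"
| "delta (Ret out inn t) \<sigma> (Some b) = {(Dfs out inn b t, [])}"
| "delta Acc \<sigma> tp = {}"
| "delta Rej \<sigma> tp = {}"

fun addr :: "st \<Rightarrow> nat" where
  "addr (Pass (i, v, c, s) inn) = gaddr (C v)"
| "addr (Dfs out inn g t) = gaddr (C g)"
| "addr _ = 0"

text \<open>The first summand bounds the sum of \<open>m\<close> minimum weights of at most
  \<open>K * T\<close> each, the second bounds counts and gate numbers.\<close>

definition B :: nat where
  "B = m * (K * T) + m"

fun regs_ok :: "outer \<Rightarrow> inner \<Rightarrow> bool" where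
  "regs_ok (i, v, c, s) (u, c', s', p, q) \<longleftrightarrow> i < k \<and> v < m \<and> u < m \<and>
     c \<le> B \<and> s \<le> B \<and> c' \<le> B \<and> s' \<le> B \<and> wt p \<le> B \<and> wt q \<le> B"

fun reg_ok :: "st \<Rightarrow> bool" where
  "reg_ok (Pass out inn) \<longleftrightarrow> regs_ok out inn"
| "reg_ok (Dfs out inn g t) \<longleftrightarrow> regs_ok out inn \<and> g < m \<and> t \<le> B"
| "reg_ok (Ret out inn t) \<longleftrightarrow> regs_ok out inn \<and> t \<le> B"
| "reg_ok Acc \<longleftrightarrow> True"
| "reg_ok Rej \<longleftrightarrow> True"

definition St :: "st set" where
  "St = Collect reg_ok"

fun opt_of :: "nat \<Rightarrow> nat option" where
  "opt_of 0 = None" | "opt_of (Suc n) = Some n"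

text \<open>Serves only to count states: a constructor tag, four outer and five inner registers, a
  gate and a weight make twelve numbers.\<close>

fun decode :: "nat list \<Rightarrow> st" where
  "decode [n, i, v, c, s, u, c', s', p, q, g, t] =
     (if n = 0 then Pass (i, v, c, s) (u, c', s', opt_of p, opt_of q)
      else if n = 1 then Dfs (i, v, c, s) (u, c', s', opt_of p, opt_of q) g t
      else Ret (i, v, c, s) (u, c', s', opt_of p, opt_of q) t)"
| "decode [] = Acc"
| "decode _ = Rej"

lemma opt_of_ex: "wt p \<le> B \<Longrightarrow> \<exists>n \<le> Suc B. p = opt_of n"
proof (cases p)
  case None
  then show ?thesis by (intro exI[of _ 0]) simp
next
  case (Some y)
  then show "wt p \<le> B \<Longrightarrow> \<exists>n \<le> Suc B. p = opt_of n" by (intro exI[of _ "Suc y"]) simp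
qed

text \<open>The common bound \<open>B + k + 2\<close> covers registers up to \<open>B\<close>, table
  indices below \<open>k\<close>, shifted options up to \<open>Suc B\<close>, and the tags
  \<open>0\<close>, \<open>1\<close>, \<open>2\<close>.\<close>

lemma St_subset:
  "St \<subseteq> {Acc, Rej} \<union> decode ` {l. set l \<subseteq> {..B + k + 2} \<and> length l = 12}"
proof
  fix r assume "r \<in> St"
  then have ok: "reg_ok r" by (simp add: St_def)
  have mB: "m \<le> B" by (simp add: B_def)
  have main: "\<exists>p0 q0. p0 \<le> Suc B \<and> q0 \<le> Suc B \<and> p = opt_of p0 \<and> q = opt_of q0 \<and>
      set [i, v, c, s, u, c', s', p0, q0] \<subseteq> {..B + k + 2}"
    if inv: "regs_ok (i, v, c, s) (u, c', s', p, q)" for i v c s u c' s' p q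
  proof -
    obtain p0 q0 where "p0 \<le> Suc B" "q0 \<le> Suc B" "p = opt_of p0" "q = opt_of q0"
      using inv opt_of_ex[of p] opt_of_ex[of q] by auto
    then show ?thesis using inv mB by (intro exI[of _ p0] exI[of _ q0]) auto
  qed
  show "r \<in> {Acc, Rej} \<union> decode ` {l. set l \<subseteq> {..B + k + 2} \<and> length l = 12}"
  proof (cases r)
    case (Pass out inn)
    obtain i v c s u c' s' p q where o: "out = (i, v, c, s)" "inn = (u, c', s', p, q)"
      by (cases out, cases inn) auto
    obtain p0 q0 where *: "p = opt_of p0" "q = opt_of q0"
      "set [i, v, c, s, u, c', s', p0, q0] \<subseteq> {..B + k + 2}"
      using main[of i v c s u c' s' p q] ok Pass o by auto
    then show ?thesis
      unfolding Pass o
      by (intro UnI2 image_eqI[of _ _ "[0, i, v, c, s, u, c', s', p0, q0, 0, 0]"]) auto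
  next
    case (Dfs out inn g t)
    obtain i v c s u c' s' p q where o: "out = (i, v, c, s)" "inn = (u, c', s', p, q)"
      by (cases out, cases inn) auto
    obtain p0 q0 where *: "p = opt_of p0" "q = opt_of q0"
      "set [i, v, c, s, u, c', s', p0, q0] \<subseteq> {..B + k + 2}"
      using main[of i v c s u c' s' p q] ok Dfs o by auto
    moreover have "g \<le> B" "t \<le> B" using ok mB Dfs by auto
    ultimately show ?thesis
      unfolding Dfs o
      by (intro UnI2 image_eqI[of _ _ "[1, i, v, c, s, u, c', s', p0, q0, g, t]"]) auto
  next
    case (Ret out inn t)
    obtain i v c s u c' s' p q where o: "out = (i, v, c, s)" "inn = (u, c', s', p, q)"
      by (cases out, cases inn) auto
    obtain p0 q0 where *: "p = opt_of p0" "q = opt_of q0"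
      "set [i, v, c, s, u, c', s', p0, q0] \<subseteq> {..B + k + 2}"
      using main[of i v c s u c' s' p q] ok Ret o by auto
    moreover have "t \<le> B" using ok Ret by auto
    ultimately show ?thesis
      unfolding Ret o
      by (intro UnI2 image_eqI[of _ _ "[2, i, v, c, s, u, c', s', p0, q0, 0, t]"]) auto
  qed auto
qed

lemma finite_St: "finite St"
  and card_St: "card St \<le> 2 + (B + k + 3) ^ 12"
proof -
  have fin: "finite {l. set l \<subseteq> {..B + k + 2} \<and> length l = 12}" (is "finite ?X")
    by (rule finite_lists_length_eq) simp
  then have fin': "finite ({Acc, Rej} \<union> decode ` ?X)" by simp
  then show "finite St" using St_subset by (rule rev_finite_subset)
  have "card St \<le> card ({Acc, Rej} \<union> decode ` ?X)" using St_subset fin' by (rule card_mono[rotated])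
  also have "\<dots> \<le> card {Acc, Rej} + card (decode ` ?X)" by (rule card_Un_le)
  also have "\<dots> \<le> 2 + card ?X" using fin by (intro add_mono card_image_le) auto
  also have "card ?X = (B + k + 3) ^ 12"
  proof -
    have "card {..B + k + 2} = B + k + 3" by simp
    then show ?thesis using card_lists_length_eq[of "{..B + k + 2}" 12] by (simp only: finite_atMost)
  qed
  finally show "card St \<le> 2 + (B + k + 3) ^ 12" .
qed

lemma st_cases:
  obtains i v c s u c' s' p q where "r = Pass (i, v, c, s) (u, c', s', p, q)"
  | i v c s u c' s' p q g t where "r = Dfs (i, v, c, s) (u, c', s', p, q) g t"
  | i v c s u c' s' p q t where "r = Ret (i, v, c, s) (u, c', s', p, q) t"
  | "r = Acc" | "r = Rej"
  by (cases r) (metis prod_cases4 prod_cases5)+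

sublocale machine: addr_pda St "start_pass (0, 0, 0, 0)" Acc Rej m L addr delta
proof
  show "finite St" by (rule finite_St)
  show "start_pass (0, 0, 0, 0) \<in> St" using k_pos m_pos by (simp add: St_def start_pass_def)
  show "Acc \<in> St" "Rej \<in> St" by (simp_all add: St_def)
  show "Acc \<noteq> Rej" by simp
next
  fix r assume "r \<in> St"
  then show "addr r \<le> L" by (cases r rule: st_cases) (auto simp: St_def gaddr_le)
next
  fix r \<sigma> tp show "finite (delta r \<sigma> tp)"
    by (cases r rule: st_cases; cases tp) (auto split: gate.splits)
next
  fix r r' w \<sigma> tp assume "r \<in> St" "(r', w) \<in> delta r \<sigma> tp" "set_option tp \<subseteq> {..<m}"
  moreover have "b < m" if "g < m" "C g = And a b" for g a b
    using And_less[OF that] that(1) by simp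
  ultimately show "set w \<subseteq> {..<m}"
    by (cases r rule: st_cases; cases tp)
      (auto simp: keep_def St_def split: gate.splits if_splits)
next
  fix r r' w \<sigma> tp assume "(r', w) \<in> delta r \<sigma> tp"
  then show "length w \<le> (if tp = None then 1 else 2)"
    by (cases r rule: st_cases; cases tp) (auto simp: keep_def split: gate.splits if_splits)
next
  fix r \<sigma> tp assume "r \<in> St" "r \<noteq> Acc" "r \<noteq> Rej"
  then show "delta r \<sigma> tp \<noteq> {}"
    by (cases r rule: st_cases; cases tp) (auto split: gate.splits)
qed

end

section \<open>Correctness of the counting machine on a fixed input\<close>

locale counting_run = counting C m T L tau W k K
  for C :: "nat \<Rightarrow> ('a, nat) gate" and m T L :: nat and tau :: "nat \<Rightarrow> nat"
    and W :: "nat \<Rightarrow> nat \<Rightarrow> nat" and k K :: nat +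
  fixes x :: "'a list"
  assumes length_x: "length x + 1 \<le> L"
    and tie_free_table: "\<exists>i < k. \<forall>v < m. \<not> tie C (W i) x v"
begin

abbreviation D :: "nat \<Rightarrow> nat \<Rightarrow> nat option" where
  "D i v \<equiv> min_weight C (W i) x v"

definition cnt :: "nat \<Rightarrow> nat \<Rightarrow> nat" where
  "cnt i u = (\<Sum>y<u. ind (D i y))"

definition sm :: "nat \<Rightarrow> nat \<Rightarrow> nat" where
  "sm i u = (\<Sum>y<u. wt (D i y))"

definition sw :: "nat \<Rightarrow> nat list \<Rightarrow> nat" where
  "sw i zs = sum_list (map (\<lambda>y. wt (D i y)) zs)"

lemma sw_simps [simp]: "sw i [] = 0" "sw i (y # zs) = wt (D i y) + sw i zs"
  by (simp_all add: sw_def)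

lemma cnt_simps [simp]: "cnt i 0 = 0" "cnt i (Suc u) = cnt i u + ind (D i u)"
  by (simp_all add: cnt_def)

lemma sm_simps [simp]: "sm i 0 = 0" "sm i (Suc u) = sm i u + wt (D i u)"
  by (simp_all add: sm_def)

definition derivable :: "nat \<Rightarrow> nat list \<Rightarrow> bool" where
  "derivable i zs \<longleftrightarrow> (\<forall>y \<in> set zs. D i y \<noteq> None)"

lemma derivable_simps [simp]: "derivable i []" "derivable i (y # zs) \<longleftrightarrow> D i y \<noteq> None \<and> derivable i zs"
  by (auto simp: derivable_def)

text \<open>The ties of all earlier tables ensure that the machine never moves past a tie-free one;
  the absence of ties below \<open>v\<close> makes the guesses of the current pass unique.\<close>

fun outer_ok :: "outer \<Rightarrow> bool" where
  "outer_ok (i, v, c, s) \<longleftrightarrow> i < k \<and> v < m \<and> (\<forall>i' < i. \<exists>u < m. tie C (W i') x u) \<and>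
     (\<forall>u < v. \<not> tie C (W i) x u) \<and> c = cnt i v \<and> s = sm i v"

text \<open>What the register \<open>p\<close> must hold after the gates below \<open>u\<close>:
  \<open>None\<close> stands both for a child not yet visited and for an underivable one.\<close>

definition lval :: "nat \<Rightarrow> nat \<Rightarrow> nat \<Rightarrow> nat option" where
  "lval i v u = (if lc (C v) < u then D i (lc (C v)) else None)"

definition rval :: "nat \<Rightarrow> nat \<Rightarrow> nat \<Rightarrow> nat option" where
  "rval i v u = (if rc (C v) < u then D i (rc (C v)) else None)"

lemma lval_Suc: "lval i v (Suc u) = (if lc (C v) = u then D i u else lval i v u)"
  and rval_Suc: "rval i v (Suc u) = (if rc (C v) = u then D i u else rval i v u)"
  by (auto simp: lval_def rval_def less_Suc_eq)

lemma lval_None: "D i u = None \<Longrightarrow> lval i v (Suc u) = lval i v u"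
  and rval_None: "D i u = None \<Longrightarrow> rval i v (Suc u) = rval i v u"
  by (auto simp: lval_def rval_def less_Suc_eq)

lemma lval_0: "lval i v 0 = None" and rval_0: "rval i v 0 = None"
  by (simp_all add: lval_def rval_def)

definition P :: bool where
  "P \<longleftrightarrow> der C x (m - 1)"

text \<open>Inside a tree, weight spent plus the minimum weights of the pending gates equals the
  minimum weight of \<open>u\<close>: the partial tree can still be completed optimally. Pending
  gates are at most \<open>u\<close>, hence below \<open>v\<close>, where no tie occurs.\<close>

fun good :: "st \<times> nat list \<Rightarrow> bool" where
  "good (Pass (i, v, c, s) (u, c', s', p, q), z) \<longleftrightarrow> outer_ok (i, v, c, s) \<and> z = [] \<and> u \<le> v \<and>
     c' = cnt i u \<and> s' = sm i u \<and> p = lval i v u \<and> q = rval i v u"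
| "good (Dfs (i, v, c, s) (u, c', s', p, q) g t, z) \<longleftrightarrow> outer_ok (i, v, c, s) \<and> u < v \<and>
     c' = cnt i u \<and> s' = sm i u \<and> p = lval i v u \<and> q = rval i v u \<and>
     (\<forall>y \<in> set (g # z). y \<le> u) \<and> derivable i (g # z) \<and> D i u = Some (t + sw i (g # z))"
| "good (Ret (i, v, c, s) (u, c', s', p, q) t, z) \<longleftrightarrow> outer_ok (i, v, c, s) \<and> u < v \<and>
     c' = cnt i u \<and> s' = sm i u \<and> p = lval i v u \<and> q = rval i v u \<and>
     (\<forall>y \<in> set z. y \<le> u) \<and> derivable i z \<and> D i u = Some (t + sw i z)"
| "good (Acc, z) \<longleftrightarrow> P"
| "good (Rej, z) \<longleftrightarrow> False"

text \<open>Either the count is already short, or it is exact and even an optimal completion makes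
  the sum too large. If a pending gate is underivable, nothing more is required, since such a tree
  is never completed. The values \<open>p\<close> and \<open>q\<close> may be wrong here.\<close>

fun dead :: "st \<times> nat list \<Rightarrow> bool" where
  "dead (Pass (i, v, c, s) (u, c', s', p, q), z) \<longleftrightarrow> outer_ok (i, v, c, s) \<and> z = [] \<and> u \<le> v \<and>
     c' \<le> cnt i u \<and> (c' < cnt i u \<or> sm i u < s')"
| "dead (Dfs (i, v, c, s) (u, c', s', p, q) g t, z) \<longleftrightarrow> outer_ok (i, v, c, s) \<and> u < v \<and>
     c' \<le> cnt i u \<and> (\<forall>y \<in> set (g # z). y \<le> u) \<and>
     (derivable i (g # z) \<longrightarrow>
       D i u \<noteq> None \<and> (c' < cnt i u \<or> sm i (Suc u) < s' + t + sw i (g # z)))"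
| "dead (Ret (i, v, c, s) (u, c', s', p, q) t, z) \<longleftrightarrow> outer_ok (i, v, c, s) \<and> u < v \<and>
     c' \<le> cnt i u \<and> (\<forall>y \<in> set z. y \<le> u) \<and>
     (derivable i z \<longrightarrow> D i u \<noteq> None \<and> (c' < cnt i u \<or> sm i (Suc u) < s' + t + sw i z))"
| "dead (Acc, z) \<longleftrightarrow> False"
| "dead (Rej, z) \<longleftrightarrow> True"

definition top_of :: "nat list \<Rightarrow> nat option" where
  "top_of z = (case z of [] \<Rightarrow> None | a # _ \<Rightarrow> Some a)"

lemma keep_top [simp]: "keep (top_of z) @ tl z = z"
  by (cases z) (simp_all add: keep_def top_of_def)

lemma keep_top_Nil [simp]: "keep (top_of []) = []"
  by (simp add: keep_def top_of_def)

lemma wt_D_le: "i < k \<Longrightarrow> v < m \<Longrightarrow> wt (D i v) \<le> K * T"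
  using min_weight_le[of "W i" K v x] W_le tau_le[of v] by (meson le_trans mult_le_mono2)

lemma B_ge: "u \<le> m \<Longrightarrow> u * (K * T) \<le> B" "K * T \<le> B" "m \<le> B"
proof -
  show "u \<le> m \<Longrightarrow> u * (K * T) \<le> B" unfolding B_def by (meson mult_le_mono1 trans_le_add1)
  have "1 * (K * T) \<le> m * (K * T)" using m_pos by (intro mult_le_mono1) simp
  then show "K * T \<le> B" unfolding B_def by linarith
  show "m \<le> B" by (simp add: B_def)
qed

lemma cnt_le: "cnt i u \<le> u"
  by (induction u) (auto simp: ind_def)

lemma sm_le: "i < k \<Longrightarrow> u \<le> m \<Longrightarrow> sm i u \<le> u * (K * T)"
proof (induction u)
  case (Suc u)
  then show ?case using wt_D_le[of i u] by simp
qed simp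

lemma lval_rval_le:
  assumes "i < k" "v < m" "p = lval i v u \<and> q = rval i v u" "u \<le> v"
  shows "wt p \<le> B" "wt q \<le> B"
proof -
  have *: "wt (D i y) \<le> B" if "y < m" for y
    using wt_D_le[OF assms(1) that] B_ge(2) by linarith
  show "wt p \<le> B" "wt q \<le> B"
    using assms *[of "lc (C v)"] *[of "rc (C v)"] by (auto simp: lval_def rval_def split: if_splits)
qed

lemma good_regs_ok:
  assumes "outer_ok (i, v, c, s)" "u \<le> v" "c' = cnt i u" "s' = sm i u" "p = lval i v u \<and> q = rval i v u"
  shows "regs_ok (i, v, c, s) (u, c', s', p, q)"
proof -
  have "i < k" "v < m" "c = cnt i v" "s = sm i v" using assms(1) by auto
  moreover have "cnt i v \<le> B" "cnt i u \<le> B"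
    using cnt_le[of i v] cnt_le[of i u] B_ge(3) \<open>v < m\<close> assms(2) by linarith+
  moreover have "sm i v \<le> B" "sm i u \<le> B"
    using sm_le[OF \<open>i < k\<close>, of v] sm_le[OF \<open>i < k\<close>, of u] B_ge(1)[of v] B_ge(1)[of u] \<open>v < m\<close> assms(2)
    by linarith+
  moreover have "wt p \<le> B" "wt q \<le> B"
    using lval_rval_le[OF \<open>i < k\<close> \<open>v < m\<close> assms(5,2)] by simp_all
  moreover have "u < m" using \<open>v < m\<close> assms(2) by simp
  ultimately show ?thesis using assms(3,4) by (simp only: regs_ok.simps)
qed

text \<open>Clamping therefore leaves the intended run untouched: true counts, sums and partial
  weights never exceed \<open>B\<close>.\<close>

lemma good_in_St: "good (r, z) \<Longrightarrow> r \<in> St"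
proof (cases r rule: st_cases)
  case (1 i v c s u c' s' p q)
  then show "good (r, z) \<Longrightarrow> r \<in> St"
    unfolding St_def by (auto simp del: regs_ok.simps outer_ok.simps intro: good_regs_ok)
next
  case (2 i v c s u c' s' p q g t)
  assume g: "good (r, z)"
  then have D: "i < k" "v < m" "u < v" "D i u = Some (t + sw i (g # z))" "g \<le> u" using 2 by auto
  then have "t \<le> B" using wt_D_le[of i u] B_ge(2) by simp
  moreover have "regs_ok (i, v, c, s) (u, c', s', p, q)"
    using g 2 by (auto simp del: regs_ok.simps outer_ok.simps intro: good_regs_ok)
  ultimately show ?thesis using 2 D by (simp add: St_def)
next
  case (3 i v c s u c' s' p q t)
  assume g: "good (r, z)"
  then have D: "i < k" "v < m" "u < v" "D i u = Some (t + sw i z)" using 3 by auto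
  then have "t \<le> B" using wt_D_le[of i u] B_ge(2) by simp
  moreover have "regs_ok (i, v, c, s) (u, c', s', p, q)"
    using g 3 by (auto simp del: regs_ok.simps outer_ok.simps intro: good_regs_ok)
  ultimately show ?thesis using 3 D by (simp add: St_def)
qed (auto simp: St_def)

lemma good_clamp: "good (machine.clamp r, z) \<longleftrightarrow> good (r, z)"
  using good_in_St[of r z] by (auto simp: machine.clamp_def)

lemma clamp_good: "good (r, z) \<Longrightarrow> machine.clamp r = r"
  using good_in_St[of r z] by (auto simp: machine.clamp_def)

lemma dead_clamp: "dead (r, z) \<Longrightarrow> dead (machine.clamp r, z)"
  by (auto simp: machine.clamp_def)

text \<open>The minimum is split into its uses: either child gives an upper bound, so a wrong branch
  never gains weight; one child attains it, so a right branch exists; if both attain it there is a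
  tie.\<close>

lemma D_Or:
  assumes "g < m" "C g = Or a b"
  shows "a < g" "b < g" "D i a \<noteq> None \<Longrightarrow> D i g \<noteq> None \<and> wt (D i g) \<le> wt (D i a) + W i g"
    "D i b \<noteq> None \<Longrightarrow> D i g \<noteq> None \<and> wt (D i g) \<le> wt (D i b)"
    "D i g \<noteq> None \<Longrightarrow> D i a \<noteq> None \<and> wt (D i g) = wt (D i a) + W i g \<or>
      D i b \<noteq> None \<and> wt (D i g) = wt (D i b)"
    "D i a \<noteq> None \<Longrightarrow> D i b \<noteq> None \<Longrightarrow> wt (D i a) + W i g = wt (D i b) \<Longrightarrow> tie C (W i) x g"
proof -
  show "a < g" "b < g" using Or_less[OF assms] by auto
  show "D i a \<noteq> None \<Longrightarrow> D i g \<noteq> None \<and> wt (D i g) \<le> wt (D i a) + W i g"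
    "D i b \<noteq> None \<Longrightarrow> D i g \<noteq> None \<and> wt (D i g) \<le> wt (D i b)"
    "D i g \<noteq> None \<Longrightarrow> D i a \<noteq> None \<and> wt (D i g) = wt (D i a) + W i g \<or>
      D i b \<noteq> None \<and> wt (D i g) = wt (D i b)"
    by (cases "D i a"; cases "D i b"; simp add: min_weight_Or[OF assms] min_def)+
  show "D i a \<noteq> None \<Longrightarrow> D i b \<noteq> None \<Longrightarrow> wt (D i a) + W i g = wt (D i b) \<Longrightarrow> tie C (W i) x g"
    by (auto simp: tie_Or[OF assms])
qed

lemma D_And:
  assumes "g < m" "C g = And a b"
  shows "a < g" "b < g" "D i g \<noteq> None \<longleftrightarrow> D i a \<noteq> None \<and> D i b \<noteq> None"
    "D i g \<noteq> None \<Longrightarrow> wt (D i g) = wt (D i a) + wt (D i b)"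
  using And_less[OF assms] by (cases "D i a"; cases "D i b"; simp add: min_weight_And[OF assms])+

text \<open>After a full pass \<open>p\<close> and \<open>q\<close> are exactly the two child values
  in the recursion for \<open>min_weight\<close>, so \<open>comb\<close> yields the value of gate
  \<open>v\<close>. Rejection can then occur only at the output gate.\<close>

lemma pass_end_good:
  assumes out: "outer_ok (i, v, c, s)" and u: "c' = cnt i v" "s' = sm i v" "p = lval i v v \<and> q = rval i v v"
  shows "good (pass_end (i, v, c, s) (v, c', s', p, q) (scanned x (gaddr (C v))), []) \<or>
    pass_end (i, v, c, s) (v, c', s', p, q) (scanned x (gaddr (C v))) = Rej \<and> \<not> P"
proof -
  have o: "i < k" "v < m" "\<forall>i' < i. \<exists>u < m. tie C (W i') x u" "\<forall>u < v. \<not> tie C (W i) x u" "c = cnt i v" "s = sm i v"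
    using out by auto
  have pq: "p = lval i v v" "q = rval i v v"
    using u(3) by simp_all
  have ti: "tied (C v) (W i v) p q \<longleftrightarrow> tie C (W i) x v"
    unfolding tie_def pq lval_def rval_def child_weights_def by simp
  have co: "comb (C v) (W i v) (scanned x (gaddr (C v))) p q = D i v"
    unfolding pq lval_def rval_def by (rule min_weight.simps[symmetric])
  show ?thesis
  proof (cases "tie C (W i) x v")
    case True
    \<comment> \<open>All tables up to \<open>i\<close> now have a tie, so the tie-free table comes
      later and a next table exists.\<close>
    obtain j where j: "j < k" "\<forall>v < m. \<not> tie C (W j) x v" using tie_free_table by blast
    have "\<not> j \<le> i" using j(2) o True by (metis le_neq_implies_less)
    then have "Suc i < k" using j(1) by simp
    moreover have "\<exists>u < m. tie C (W i') x u" if "i' < Suc i" for i'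
      using that o True by (metis less_antisym)
    ultimately show ?thesis
      using True o m_pos u(1,2) by (simp add: pass_end_def ti start_pass_def lval_0 rval_0)
  next
    case False
    then have nt: "\<not> tie C (W i) x u" if "u < Suc v" for u using that o by (metis less_antisym)
    show ?thesis
    proof (cases "Suc v = m")
      case True
      then have "P \<longleftrightarrow> D i v \<noteq> None"
        unfolding P_def using min_weight_der[of v "W i" x] by force
      then show ?thesis using True False u(1,2) o by (simp add: pass_end_def ti co)
    next
      case ne: False
      then have "Suc v < m" using o by simp
      then show ?thesis using False ne u(1,2) o nt
        by (simp add: pass_end_def ti co start_pass_def lval_0 rval_0 Let_def)
    qed
  qed
qed

text \<open>The three possible errors are skipping a derivable gate (count short), starting on an
  underivable gate (a pending gate without proof), and a non-optimal branch of an \<open>Or\<close>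
  gate (child underivable or sum too large).\<close>

lemma raw_good_step:
  assumes g: "good (r, z)" and d: "(r', w) \<in> delta r (scanned x (addr r)) (top_of z)"
  shows "good (r', w @ tl z) \<or> dead (r', w @ tl z)"
proof (cases r rule: st_cases)
  case (1 i v c s u c' s' p q)
  have gd: "outer_ok (i, v, c, s)" "z = []" "u \<le> v" "c' = cnt i u" "s' = sm i u" "p = lval i v u \<and> q = rval i v u"
    using g unfolding 1 by simp_all
  show ?thesis
  proof (cases "u < v")
    case True
    have "w @ tl z = []" using d gd(2) unfolding 1 by (auto simp: keep_def top_of_def)
    moreover have "r' = Pass (i, v, c, s) (Suc u, c', s', p, q) \<or> r' = Dfs (i, v, c, s) (u, c', s', p, q) u 0"
      using d True unfolding 1 by auto
    moreover have "good (Pass (i, v, c, s) (Suc u, c', s', p, q), []) \<or> dead (Pass (i, v, c, s) (Suc u, c', s', p, q), [])"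
      using gd(1) True gd(3-) by (cases "D i u") (auto simp: lval_None rval_None simp del: outer_ok.simps)
    moreover have "good (Dfs (i, v, c, s) (u, c', s', p, q) u 0, []) \<or> dead (Dfs (i, v, c, s) (u, c', s', p, q) u 0, [])"
      using gd(1) True gd(3-) by (cases "D i u") (auto simp del: outer_ok.simps)
    ultimately show ?thesis by auto
  next
    case False
    then have uv: "u = v" using gd(3) by simp
    have "w @ tl z = []" "r' = pass_end (i, v, c, s) (v, c', s', p, q) (scanned x (gaddr (C v)))"
      using d gd(2) unfolding 1 uv by (auto simp: keep_def top_of_def)
    then show ?thesis using pass_end_good[OF gd(1), of c' s' p q] gd uv by auto
  qed
next
  case (2 i v c s u c' s' p q g t)
  have gd: "outer_ok (i, v, c, s)" "u < v" "c' = cnt i u" "s' = sm i u" "p = lval i v u \<and> q = rval i v u"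
    "g \<le> u" "\<forall>y \<in> set z. y \<le> u" "D i g \<noteq> None" "derivable i z" "D i u = Some (t + (wt (D i g) + sw i z))"
    using g unfolding 2 by simp_all
  have gm: "g < m" using gd(1,2,6) by auto
  show ?thesis
  proof (cases "C g")
    case (Lit a S)
    then have "scanned x a \<in> S" "wt (D i g) = 0"
      using gd(8) by (auto simp: min_weight_Lit[OF Lit] split: if_splits)
    then have "w @ tl z = z" "r' = Ret (i, v, c, s) (u, c', s', p, q) t"
      using d Lit unfolding 2 by auto
    then show ?thesis using gd \<open>wt (D i g) = 0\<close> by (simp del: outer_ok.simps)
  next
    case (And a b)
    then have "w @ tl z = b # z" "r' = Dfs (i, v, c, s) (u, c', s', p, q) a t"
      using d unfolding 2 by auto
    then show ?thesis using gd D_And[OF gm And] by (auto simp del: outer_ok.simps)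
  next
    case (Or a b)
    have wz: "w @ tl z = z" using d Or unfolding 2 by auto
    have "r' = Dfs (i, v, c, s) (u, c', s', p, q) a (t + W i g) \<or> r' = Dfs (i, v, c, s) (u, c', s', p, q) b t"
      using d Or unfolding 2 by auto
    moreover have "good (Dfs (i, v, c, s) (u, c', s', p, q) a (t + W i g), z) \<or>
      dead (Dfs (i, v, c, s) (u, c', s', p, q) a (t + W i g), z)"
    proof (cases "D i a \<noteq> None \<and> wt (D i g) = wt (D i a) + W i g")
      case True
      then show ?thesis using gd D_Or(1)[OF gm Or] by (simp del: outer_ok.simps)
    next
      case False
      then show ?thesis using gd D_Or(1)[OF gm Or] D_Or(3)[OF gm Or, of i] by (auto simp del: outer_ok.simps)
    qed
    moreover have "good (Dfs (i, v, c, s) (u, c', s', p, q) b t, z) \<or>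
      dead (Dfs (i, v, c, s) (u, c', s', p, q) b t, z)"
    proof (cases "D i b \<noteq> None \<and> wt (D i g) = wt (D i b)")
      case True
      then show ?thesis using gd D_Or(2)[OF gm Or] by (simp del: outer_ok.simps)
    next
      case False
      then show ?thesis using gd D_Or(2)[OF gm Or] D_Or(4)[OF gm Or, of i] by (auto simp del: outer_ok.simps)
    qed
    ultimately show ?thesis using wz by metis
  qed
next
  case (3 i v c s u c' s' p q t)
  have gd: "outer_ok (i, v, c, s)" "u < v" "c' = cnt i u" "s' = sm i u" "p = lval i v u \<and> q = rval i v u"
    "\<forall>y \<in> set z. y \<le> u" "derivable i z" "D i u = Some (t + sw i z)"
    using g unfolding 3 by simp_all
  show ?thesis
  proof (cases z)
    case Nil
    then have "w @ tl z = []" "r' = Pass (i, v, c, s) (Suc u, Suc c', s' + t,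
         if lc (C v) = u then Some t else p, if rc (C v) = u then Some t else q)"
      using d unfolding 3 by (auto simp: top_of_def)
    then show ?thesis using gd Nil by (auto simp: lval_Suc rval_Suc simp del: outer_ok.simps)
  next
    case (Cons b z')
    then have "w @ tl z = z'" "r' = Dfs (i, v, c, s) (u, c', s', p, q) b t"
      using d unfolding 3 by (auto simp: top_of_def)
    then show ?thesis using gd Cons by (auto simp del: outer_ok.simps)
  qed
qed (use d in auto)

text \<open>A completed tree exists only for a derivable gate, raises the count by exactly one and
  weighs at least the minimum. So a shortage in the count persists, and with an exact count so does
  an excess in the sum.\<close>

lemma raw_dead_step:
  assumes g: "dead (r, z)" and d: "(r', w) \<in> delta r (scanned x (addr r)) (top_of z)"
  shows "dead (r', w @ tl z)"
proof (cases r rule: st_cases)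
  case (1 i v c s u c' s' p q)
  have gd: "outer_ok (i, v, c, s)" "z = []" "u \<le> v" "c' \<le> cnt i u" "c' < cnt i u \<or> sm i u < s'"
    using g unfolding 1 by simp_all
  show ?thesis
  proof (cases "u < v")
    case True
    have "w @ tl z = []" using d gd(2) unfolding 1 by (auto simp: keep_def top_of_def)
    moreover have "r' = Pass (i, v, c, s) (Suc u, c', s', p, q) \<or> r' = Dfs (i, v, c, s) (u, c', s', p, q) u 0"
      using d True unfolding 1 by auto
    moreover have "dead (Pass (i, v, c, s) (Suc u, c', s', p, q), [])"
      using gd(1) True gd(3-) by (cases "D i u") (auto simp del: outer_ok.simps)
    moreover have "dead (Dfs (i, v, c, s) (u, c', s', p, q) u 0, [])"
      using gd(1) True gd(3-) by (cases "D i u") (auto simp del: outer_ok.simps)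
    ultimately show ?thesis by auto
  next
    case False
    then have uv: "u = v" using gd(3) by simp
    have "r' = pass_end (i, v, c, s) (v, c', s', p, q) (scanned x (gaddr (C v)))"
      using d unfolding 1 uv by auto
    \<comment> \<open>For \<open>u = v\<close> the stored \<open>c\<close> and \<open>s\<close> are
      the true count and sum, so the final comparison exposes the error.\<close>
    moreover have "c' \<noteq> c \<or> s' \<noteq> s" using gd(1,5) uv by auto
    ultimately show ?thesis by (simp add: pass_end_def)
  qed
next
  case (2 i v c s u c' s' p q g t)
  have gd: "outer_ok (i, v, c, s)" "u < v" "c' \<le> cnt i u"
    "g \<le> u" "\<forall>y \<in> set z. y \<le> u"
    "D i g \<noteq> None \<Longrightarrow> derivable i z \<Longrightarrow>
       D i u \<noteq> None \<and> (c' < cnt i u \<or> sm i u + wt (D i u) < s' + t + (wt (D i g) + sw i z))"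
    using g unfolding 2 by simp_all
  have gm: "g < m" using gd(1,2,4) by auto
  show ?thesis
  proof (cases "C g")
    case (Lit a S)
    then show ?thesis
      using d gd min_weight_Lit[OF Lit] unfolding 2 by (auto simp del: outer_ok.simps split: if_splits)
  next
    case (And a b)
    then have "w @ tl z = b # z" "r' = Dfs (i, v, c, s) (u, c', s', p, q) a t"
      using d unfolding 2 by auto
    then show ?thesis using gd D_And(1,2)[OF gm And] D_And(3,4)[OF gm And, of i] by (auto simp del: outer_ok.simps)
  next
    case (Or a b)
    have wz: "w @ tl z = z" using d Or unfolding 2 by auto
    have "r' = Dfs (i, v, c, s) (u, c', s', p, q) a (t + W i g) \<or> r' = Dfs (i, v, c, s) (u, c', s', p, q) b t"
      using d Or unfolding 2 by auto
    moreover have "dead (Dfs (i, v, c, s) (u, c', s', p, q) a (t + W i g), z)"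
      using gd D_Or(1)[OF gm Or] D_Or(3)[OF gm Or, of i] by (fastforce simp del: outer_ok.simps)
    moreover have "dead (Dfs (i, v, c, s) (u, c', s', p, q) b t, z)"
      using gd D_Or(2)[OF gm Or] D_Or(4)[OF gm Or, of i] by (fastforce simp del: outer_ok.simps)
    ultimately show ?thesis using wz by metis
  qed
next
  case (3 i v c s u c' s' p q t)
  have gd: "outer_ok (i, v, c, s)" "u < v" "c' \<le> cnt i u" "\<forall>y \<in> set z. y \<le> u"
    "derivable i z \<Longrightarrow> D i u \<noteq> None \<and> (c' < cnt i u \<or> sm i u + wt (D i u) < s' + t + sw i z)"
    using g unfolding 3 by simp_all
  show ?thesis
  proof (cases z)
    case Nil
    then have "w @ tl z = []" "r' = Pass (i, v, c, s) (Suc u, Suc c', s' + t,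
         if lc (C v) = u then Some t else p, if rc (C v) = u then Some t else q)"
      using d unfolding 3 by (auto simp: top_of_def)
    then show ?thesis using gd Nil by (auto simp del: outer_ok.simps)
  next
    case (Cons b z')
    then have "w @ tl z = z'" "r' = Dfs (i, v, c, s) (u, c', s', p, q) b t"
      using d unfolding 3 by (auto simp: top_of_def)
    then show ?thesis using gd Cons by (auto simp del: outer_ok.simps)
  qed
qed (use d g in auto)

text \<open>There are only two kinds of choice: skip or verify, settled by derivability of
  \<open>u\<close>, and the branch of an \<open>Or\<close> gate, settled by the absence of ties
  below \<open>v\<close>.\<close>

lemma raw_good_unique:
  assumes g: "good (r, z)" and d1: "(r1, w1) \<in> delta r (scanned x (addr r)) (top_of z)"
    and d2: "(r2, w2) \<in> delta r (scanned x (addr r)) (top_of z)"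
    and g1: "good (r1, w1 @ tl z)" and g2: "good (r2, w2 @ tl z)"
  shows "r1 = r2 \<and> w1 = w2"
proof (cases r rule: st_cases)
  case (1 i v c s u c' s' p q)
  let ?A = "Pass (i, v, c, s) (Suc u, c', s', p, q)" and ?B = "Dfs (i, v, c, s) (u, c', s', p, q) u 0"
  have z: "z = []" and c': "c' = cnt i u" using g unfolding 1 by simp_all
  \<comment> \<open>An unchanged count is right only if \<open>D i u\<close> is \<open>None\<close>,
    whereas \<open>?B\<close> requires a proof tree.\<close>
  have no: "\<not> (good (?A, []) \<and> good (?B, []))"
    using c' by (cases "D i u") (auto simp del: outer_ok.simps)
  show ?thesis
  proof (cases "u < v")
    case True
    then have "w1 = [] \<and> w2 = []" "r1 = ?A \<or> r1 = ?B" "r2 = ?A \<or> r2 = ?B"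
      using d1 d2 z unfolding 1 by (auto simp: top_of_def keep_def)
    then show ?thesis using g1 g2 no z by (auto simp del: good.simps)
  next
    case False
    then show ?thesis using d1 d2 unfolding 1 by auto
  qed
next
  case (2 i v c s u c' s' p q g t)
  have gd: "outer_ok (i, v, c, s)" "u < v" "g \<le> u" using g unfolding 2 by simp_all
  have gm: "g < m" using gd by auto
  show ?thesis
  proof (cases "C g")
    case (Or a b)
    let ?A = "Dfs (i, v, c, s) (u, c', s', p, q) a (t + W i g)" and ?B = "Dfs (i, v, c, s) (u, c', s', p, q) b t"
    have "\<not> tie C (W i) x g" using gd by auto
    then have no: "\<not> (good (?A, z) \<and> good (?B, z))"
      using D_Or(6)[OF gm Or, of i] by (auto simp del: outer_ok.simps)
    have "w1 = keep (top_of z) \<and> w2 = keep (top_of z)" "r1 = ?A \<or> r1 = ?B" "r2 = ?A \<or> r2 = ?B"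
      using d1 d2 Or unfolding 2 by auto
    then show ?thesis using g1 g2 no by (auto simp del: good.simps)
  qed (use d1 d2 in \<open>auto simp: 2\<close>)
next
  case (3 i v c s u c' s' p q t)
  then show ?thesis using d1 d2 by (cases "top_of z") auto
qed (use d1 in auto)

lemma progressI: "good (r, w @ tl z) \<Longrightarrow> (r, w) \<in> X \<Longrightarrow> \<exists>r w. (r, w) \<in> X \<and> good (r, w @ tl z)"
  by blast

text \<open>\<open>P\<close> enters only at the end of a pass, where it excludes rejection at the
  output gate.\<close>

lemma raw_good_progress:
  assumes P and g: "good (r, z)" and r: "r \<noteq> Acc"
  shows "\<exists>r' w. (r', w) \<in> delta r (scanned x (addr r)) (top_of z) \<and> good (r', w @ tl z)"
proof (cases r rule: st_cases)
  case (1 i v c s u c' s' p q)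
  have gd: "outer_ok (i, v, c, s)" "z = []" "u \<le> v" "c' = cnt i u" "s' = sm i u" "p = lval i v u \<and> q = rval i v u"
    using g unfolding 1 by simp_all
  show ?thesis
  proof (cases "u < v")
    case True
    show ?thesis
    proof (cases "D i u")
      case None
      then have "good (Pass (i, v, c, s) (Suc u, c', s', p, q), keep (top_of z) @ tl z)"
        using gd True by (auto simp: lval_None rval_None simp del: outer_ok.simps)
      then show ?thesis unfolding 1 by (rule progressI) (use True in \<open>auto simp del: good.simps\<close>)
    next
      case (Some y)
      then have "good (Dfs (i, v, c, s) (u, c', s', p, q) u 0, keep (top_of z) @ tl z)"
        using gd True by (auto simp del: outer_ok.simps)
      then show ?thesis unfolding 1 by (rule progressI) (use True in \<open>auto simp del: good.simps\<close>)
    qed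
  next
    case False
    then have uv: "u = v" using gd(3) by simp
    have "good (pass_end (i, v, c, s) (v, c', s', p, q) (scanned x (gaddr (C v))), keep (top_of z) @ tl z)"
      using pass_end_good[OF gd(1), of c' s' p q] gd uv \<open>P\<close> by auto
    then show ?thesis unfolding 1 uv by (rule progressI) simp
  qed
next
  case (2 i v c s u c' s' p q g t)
  have gd: "outer_ok (i, v, c, s)" "u < v" "c' = cnt i u" "s' = sm i u" "p = lval i v u \<and> q = rval i v u"
    "g \<le> u" "\<forall>y \<in> set z. y \<le> u" "D i g \<noteq> None" "derivable i z" "D i u = Some (t + (wt (D i g) + sw i z))"
    using g unfolding 2 by simp_all
  have gm: "g < m" using gd(1,2,6) by auto
  show ?thesis
  proof (cases "C g")
    case (Or a b)
    let ?A = "Dfs (i, v, c, s) (u, c', s', p, q) a (t + W i g)" and ?B = "Dfs (i, v, c, s) (u, c', s', p, q) b t"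
    have "good (?A, keep (top_of z) @ tl z) \<or> good (?B, keep (top_of z) @ tl z)"
      using gd D_Or(1,2)[OF gm Or] D_Or(5)[OF gm Or gd(8)] by (auto simp del: outer_ok.simps)
    then show ?thesis
    proof
      assume "good (?A, keep (top_of z) @ tl z)"
      then show ?thesis unfolding 2 by (rule progressI) (use Or in \<open>auto simp del: good.simps\<close>)
    next
      assume "good (?B, keep (top_of z) @ tl z)"
      then show ?thesis unfolding 2 by (rule progressI) (use Or in \<open>auto simp del: good.simps\<close>)
    qed
  next
    case (And a b)
    then have "good (Dfs (i, v, c, s) (u, c', s', p, q) a t, (b # keep (top_of z)) @ tl z)"
      using gd D_And(1,2)[OF gm And] D_And(3,4)[OF gm And, of i] by (auto simp del: outer_ok.simps)
    then show ?thesis unfolding 2 by (rule progressI) (use And in \<open>auto simp del: good.simps\<close>)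
  next
    case (Lit a S)
    then have S: "scanned x a \<in> S" "wt (D i g) = 0"
      using gd(8) by (auto simp: min_weight_Lit[OF Lit] split: if_splits)
    then have "good (Ret (i, v, c, s) (u, c', s', p, q) t, keep (top_of z) @ tl z)"
      using gd by (simp del: outer_ok.simps)
    then show ?thesis unfolding 2 by (rule progressI) (use Lit S in \<open>auto simp del: good.simps\<close>)
  qed
next
  case (3 i v c s u c' s' p q t)
  obtain r' w where d: "(r', w) \<in> delta r (scanned x (addr r)) (top_of z)"
    unfolding 3 by (cases "top_of z") auto
  have "good (r', w @ tl z)"
  proof (cases z)
    case Nil
    then have *: "w @ tl z = []" "r' = Pass (i, v, c, s) (Suc u, Suc c', s' + t,
         if lc (C v) = u then Some t else p, if rc (C v) = u then Some t else q)"
      using d unfolding 3 by (auto simp: top_of_def)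
    have gd: "outer_ok (i, v, c, s)" "u < v" "c' = cnt i u" "s' = sm i u" "p = lval i v u \<and> q = rval i v u"
      "D i u = Some t"
      using g Nil unfolding 3 by simp_all
    then show ?thesis unfolding * by (auto simp: lval_Suc rval_Suc simp del: outer_ok.simps)
  next
    case (Cons b z')
    then have "w @ tl z = z'" "r' = Dfs (i, v, c, s) (u, c', s', p, q) b t"
      using d unfolding 3 by (auto simp: top_of_def)
    then show ?thesis using g Cons unfolding 3 by (auto simp del: outer_ok.simps)
  qed
  then show ?thesis using d by blast
qed (use g r in auto)

section \<open>Termination of the counting machine\<close>

definition dfs_len :: nat where
  "dfs_len = 2 * T + 2"

definition pass_len :: nat where
  "pass_len = (m + 1) * dfs_len"

definition table_len :: nat where
  "table_len = m * pass_len + 1"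

text \<open>Nested lexicographically: table, gate \<open>v\<close>, gate \<open>u\<close>, remaining
  tree. The factor 2 pays for a literal's passage through \<open>Ret\<close>; the spare terms in
  \<open>pass_len\<close> and \<open>table_len\<close> keep the drop strict when a pass or a table
  ends. As \<open>tau\<close> bounds every tree, dead runs terminate as well.\<close>

fun rank :: "st \<times> nat list \<Rightarrow> nat" where
  "rank (Pass (i, v, c, s) (u, c', s', p, q), z) =
     (k - i) * table_len + (m - v) * pass_len + (v - u) * dfs_len + 1"
| "rank (Dfs (i, v, c, s) (u, c', s', p, q) g t, z) =
     (k - i) * table_len + (m - v) * pass_len + (v - Suc u) * dfs_len + 2 * (tau g + sum_list (map tau z)) + 1"
| "rank (Ret (i, v, c, s) (u, c', s', p, q) t, z) =
     (k - i) * table_len + (m - v) * pass_len + (v - Suc u) * dfs_len + 2 * sum_list (map tau z) + 2"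
| "rank (Acc, z) = 0"
| "rank (Rej, z) = 0"

lemma diff_mult: "a < b \<Longrightarrow> (b - a) * n = n + (b - Suc a) * (n :: nat)"
  by (metis Suc_diff_Suc mult_Suc)

lemma raw_rank_step:
  assumes g: "good (r, z) \<or> dead (r, z)" and d: "(r', w) \<in> delta r (scanned x (addr r)) (top_of z)"
  shows "rank (r', w @ tl z) < rank (r, z)"
proof (cases r rule: st_cases)
  case (1 i v c s u c' s' p q)
  have gd: "i < k" "v < m" "z = []" "u \<le> v" using g unfolding 1 by auto
  show ?thesis
  proof (cases "u < v")
    case True
    have "r' = Pass (i, v, c, s) (Suc u, c', s', p, q) \<or> r' = Dfs (i, v, c, s) (u, c', s', p, q) u 0"
      "w @ tl z = []"
      using d True gd(3) unfolding 1 by (auto simp: top_of_def keep_def)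
    moreover have "tau u \<le> T" using True gd tau_le by auto
    moreover have "2 * T < dfs_len" by (simp add: dfs_len_def)
    ultimately show ?thesis
      unfolding 1 using diff_mult[OF True, of dfs_len] by (auto simp del: diff_mult_distrib)
  next
    case False
    have r': "r' = pass_end (i, v, c, s) (u, c', s', p, q) (scanned x (gaddr (C v)))"
      using d False unfolding 1 by auto
    have "dfs_len * Suc v \<le> dfs_len * m" using gd(2) by (intro mult_le_mono2) simp
    then have "Suc v * dfs_len < pass_len" by (simp add: pass_len_def dfs_len_def mult.commute)
    then have "(m - Suc v) * pass_len + Suc v * dfs_len < (m - v) * pass_len"
      using diff_mult[OF gd(2), of pass_len] by linarith
    moreover have "(k - Suc i) * table_len + m * pass_len < (k - i) * table_len"
      using diff_mult[OF gd(1), of table_len] by (simp add: table_len_def)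
    ultimately show ?thesis
      unfolding r' 1 pass_end_def start_pass_def Let_def using gd
      by (auto simp del: mult_Suc)
  qed
next
  case (2 i v c s u c' s' p q g t)
  have "v < m" "u < v" "g \<le> u" using g unfolding 2 by auto
  then have gm: "g < m" by simp
  show ?thesis
  proof (cases "C g")
    case (Lit a S)
    then show ?thesis using d tau_pos[OF gm] unfolding 2 by auto
  next
    case (And a b)
    then show ?thesis using d And_less[OF gm And] unfolding 2 by auto
  next
    case (Or a b)
    then show ?thesis using d Or_less[OF gm Or] unfolding 2 by auto
  qed
next
  case (3 i v c s u c' s' p q t)
  then show ?thesis using d by (cases z) (auto simp: top_of_def)
qed (use d in auto)

lemma astep_raw:
  "machine.astep x (r, z) c' \<longleftrightarrow> r \<in> St - {Acc, Rej} \<and>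
     (\<exists>r' w. (r', w) \<in> delta r (scanned x (addr r)) (top_of z) \<and> c' = (machine.clamp r', w @ tl z))"
  by (simp add: machine.astep_def top_of_def)

lemma astepE:
  assumes "machine.astep x c c'"
  obtains r' w where "(r', w) \<in> delta (fst c) (scanned x (addr (fst c))) (top_of (snd c))"
    "c' = (machine.clamp r', w @ tl (snd c))"
  using assms by (cases c) (auto simp: astep_raw)

sublocale grun: guided_addr_pda St "start_pass (0, 0, 0, 0)" Acc Rej m L addr delta x good dead rank P
proof
  show "length x + 1 \<le> L" by (rule length_x)
  show "good (start_pass (0, 0, 0, 0), [])" using k_pos m_pos by (simp add: start_pass_def lval_0 rval_0)
next
  fix c c' assume g: "good c" and st: "machine.astep x c c'"
  from st obtain r' w where r': "(r', w) \<in> delta (fst c) (scanned x (addr (fst c))) (top_of (snd c))"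
    "c' = (machine.clamp r', w @ tl (snd c))"
    by (rule astepE)
  have "good (r', w @ tl (snd c)) \<or> dead (r', w @ tl (snd c))"
    using raw_good_step[OF _ r'(1)] g by simp
  then show "good c' \<or> dead c'" unfolding r'(2) good_clamp using dead_clamp by blast
next
  fix c c' assume g: "dead c" and st: "machine.astep x c c'"
  from st obtain r' w where r': "(r', w) \<in> delta (fst c) (scanned x (addr (fst c))) (top_of (snd c))"
    "c' = (machine.clamp r', w @ tl (snd c))"
    by (rule astepE)
  have "dead (r', w @ tl (snd c))" using raw_dead_step[OF _ r'(1)] g by simp
  then show "dead c'" unfolding r'(2) by (rule dead_clamp)
next
  fix z show "\<not> dead (Acc, z)" by simp
next
  fix c c1 c2 assume g: "good c" "good c1" "good c2" and st: "machine.astep x c c1" "machine.astep x c c2"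
  from st(1) obtain r1 w1 where r1: "(r1, w1) \<in> delta (fst c) (scanned x (addr (fst c))) (top_of (snd c))"
    "c1 = (machine.clamp r1, w1 @ tl (snd c))"
    by (rule astepE)
  from st(2) obtain r2 w2 where r2: "(r2, w2) \<in> delta (fst c) (scanned x (addr (fst c))) (top_of (snd c))"
    "c2 = (machine.clamp r2, w2 @ tl (snd c))"
    by (rule astepE)
  have "good (fst c, snd c)" "good (r1, w1 @ tl (snd c))" "good (r2, w2 @ tl (snd c))"
    using g r1(2) r2(2) good_clamp by simp_all
  then have "r1 = r2 \<and> w1 = w2" using raw_good_unique r1(1) r2(1) by blast
  then show "c1 = c2" using r1(2) r2(2) by simp
next
  fix c assume "P" "good c" "fst c \<in> St - {Acc, Rej}"
  moreover obtain r z where c: "c = (r, z)" by (cases c)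
  ultimately obtain r' w where "(r', w) \<in> delta r (scanned x (addr r)) (top_of z)" "good (r', w @ tl z)"
    using raw_good_progress[of r z] by auto
  then show "\<exists>c'. machine.astep x c c' \<and> good c'"
    using \<open>fst c \<in> St - {Acc, Rej}\<close> unfolding c astep_raw
    using clamp_good[of r' "w @ tl z"] by (metis fst_conv)
next
  fix c c' assume gd: "good c \<or> dead c" and st: "machine.astep x c c'"
  obtain r z where c: "c = (r, z)" by (cases c)
  obtain r' w where r': "(r', w) \<in> delta r (scanned x (addr r)) (top_of z)" "c' = (machine.clamp r', w @ tl z)"
    using st unfolding c astep_raw by blast
  have "rank (r', w @ tl z) < rank (r, z)" using raw_rank_step gd r'(1) c by blast
  then show "rank c' < rank c" unfolding c r'(2) machine.clamp_def by auto
next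
  fix z assume "good (Acc, z)" then show P by simp
next
  fix z show "\<not> good (Rej, z)" by simp
qed

end

section \<open>Isolation\<close>

lemma min_weight_cong:
  "(\<And>u. u \<le> v \<Longrightarrow> w u = w' u) \<Longrightarrow> min_weight C w x v = min_weight C w' x v"
proof (induction v rule: less_induct)
  case (less v)
  have "min_weight C w x u = min_weight C w' x u" if "u < v" for u
    using less that by simp
  then show ?case
    using less.prems[of v] by (simp add: min_weight.simps[of C _ x v])
qed

lemma child_weights_cong:
  "(\<And>u. u < v \<Longrightarrow> w u = w' u) \<Longrightarrow> child_weights C w x v = child_weights C w' x v"
  unfolding child_weights_def by (auto intro!: min_weight_cong)

text \<open>The weights of the children depend only on table entries below \<open>v\<close>, so the
  equation \<open>p + w v = q\<close> has at most one solution for the entry at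
  \<open>v\<close>.\<close>

lemma tie_weight_unique:
  assumes "\<And>u. u < v \<Longrightarrow> w u = w' u" "tie C w x v" "tie C w' x v"
  shows "w v = w' v"
proof -
  have "child_weights C w x v = child_weights C w' x v" using assms(1) by (rule child_weights_cong)
  then show ?thesis using assms(2,3) unfolding tie_def
    by (cases "C v"; cases "fst (child_weights C w x v)"; cases "snd (child_weights C w x v)") auto
qed

text \<open>With \<open>2 * m\<close> possible weights each gate is tied in at most a fraction
  \<open>1 / (2 * m)\<close> of the tables, so the union bound over \<open>m\<close> gates gives one
  half.\<close>

definition weight_tables :: "nat \<Rightarrow> (nat \<Rightarrow> nat) set" where
  "weight_tables m = {..<m} \<rightarrow>\<^sub>E {..<2 * m}"

lemma finite_weight_tables: "finite (weight_tables m)"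
  by (simp add: weight_tables_def finite_PiE)

lemma card_weight_tables: "card (weight_tables m) = (2 * m) ^ m"
  by (simp add: weight_tables_def card_PiE)

text \<open>By \<open>tie_weight_unique\<close>, a table tied at \<open>v\<close> is determined by
  its other \<open>m - 1\<close> entries.\<close>

lemma card_tie:
  assumes "v < m"
  shows "card {w \<in> weight_tables m. tie C w x v} \<le> (2 * m) ^ (m - 1)"
proof -
  let ?A = "{..<m} - {v}"
  have "inj_on (\<lambda>w. restrict w ?A) {w \<in> weight_tables m. tie C w x v}"
  proof (rule inj_onI)
    fix w w' assume w: "w \<in> {w \<in> weight_tables m. tie C w x v}" "w' \<in> {w \<in> weight_tables m. tie C w x v}"
      and eq: "restrict w ?A = restrict w' ?A"
    have e: "w u = w' u" if "u < m" "u \<noteq> v" for u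
      using fun_cong[OF eq, of u] that by (simp add: restrict_def)
    have "w v = w' v"
      using e assms w by (intro tie_weight_unique[of v w w' C x]) auto
    then have "w u = w' u" if "u < m" for u using e[of u] that by (cases "u = v") auto
    then show "w = w'"
      using w by (intro PiE_ext[of w "{..<m}" "\<lambda>_. {..<2 * m}"]) (auto simp: weight_tables_def)
  qed
  moreover have "(\<lambda>w. restrict w ?A) ` {w \<in> weight_tables m. tie C w x v} \<subseteq> ?A \<rightarrow>\<^sub>E {..<2 * m}"
    unfolding weight_tables_def by (auto simp: PiE_iff restrict_def extensional_def split: if_splits)
  moreover have "finite (?A \<rightarrow>\<^sub>E {..<2 * m})" by (intro finite_PiE) auto
  ultimately have "card {w \<in> weight_tables m. tie C w x v} \<le> card (?A \<rightarrow>\<^sub>E {..<2 * m})"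
    by (rule card_inj_on_le)
  also have "\<dots> = (2 * m) ^ (m - 1)" using assms by (simp add: card_PiE)
  finally show ?thesis .
qed

lemma card_bad_tables:
  "2 * card {w \<in> weight_tables m. \<exists>v < m. tie C w x v} \<le> card (weight_tables m)"
proof (cases "m = 0")
  case False
  have "card {w \<in> weight_tables m. \<exists>v < m. tie C w x v} = card (\<Union>v<m. {w \<in> weight_tables m. tie C w x v})"
    by (rule arg_cong[of _ _ card]) auto
  also have "\<dots> \<le> (\<Sum>v<m. card {w \<in> weight_tables m. tie C w x v})" by (rule card_UN_le) simp
  also have "\<dots> \<le> (\<Sum>v<m. (2 * m) ^ (m - 1))" by (rule sum_mono) (rule card_tie, simp)
  also have "\<dots> = m * (2 * m) ^ (m - 1)" by simp
  finally have "2 * card {w \<in> weight_tables m. \<exists>v < m. tie C w x v} \<le> (2 * m) * (2 * m) ^ (m - 1)"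
    by simp
  also have "\<dots> = (2 * m) ^ m" using False power_minus_mult[of m "2 * m"] by (simp only: mult.commute neq0_conv)
  finally show ?thesis by (simp add: card_weight_tables)
qed simp

text \<open>Averaging: each input is spoiled by at most half of the tables. If every table spoiled
  more than half of the inputs, counting the spoiled pairs in the other order would give a
  contradiction.\<close>

lemma exists_half_good_table:
  assumes "finite X" "0 < m"
  shows "\<exists>w \<in> weight_tables m. 2 * card {x \<in> X. \<exists>v < m. tie C w x v} \<le> card X"
proof (rule ccontr)
  let ?W = "weight_tables m" and ?bad = "\<lambda>x w. \<exists>v < m. tie C w x v"
  assume "\<not> (\<exists>w \<in> ?W. 2 * card {x \<in> X. ?bad x w} \<le> card X)"
  then have "Suc (card X) \<le> 2 * card {x \<in> X. ?bad x w}" if "w \<in> ?W" for w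
    using that by (meson not_less_eq_eq)
  then have "(\<Sum>w\<in>?W. Suc (card X)) \<le> (\<Sum>w\<in>?W. 2 * card {x \<in> X. ?bad x w})"
    by (rule sum_mono)
  also have "\<dots> = 2 * (\<Sum>w\<in>?W. \<Sum>x\<in>X. of_bool (?bad x w))"
    using assms(1) by (simp add: sum_of_bool_eq sum_distrib_left Int_def)
  also have "(\<Sum>w\<in>?W. \<Sum>x\<in>X. of_bool (?bad x w)) = (\<Sum>x\<in>X. \<Sum>w\<in>?W. (of_bool (?bad x w) :: nat))"
    by (rule sum.swap)
  also have "\<dots> = (\<Sum>x\<in>X. card {w \<in> ?W. ?bad x w})"
    using finite_weight_tables by (simp add: sum_of_bool_eq Int_def)
  also have "2 * \<dots> = (\<Sum>x\<in>X. 2 * card {w \<in> ?W. ?bad x w})" by (simp add: sum_distrib_left)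
  also have "\<dots> \<le> (\<Sum>x\<in>X. card ?W)" by (rule sum_mono) (rule card_bad_tables)
  also have "\<dots> = card X * card ?W" by simp
  finally have "card ?W * Suc (card X) \<le> card X * card ?W" by simp
  moreover have "0 < card ?W" using assms(2) by (simp add: card_weight_tables)
  ultimately show False by simp
qed

text \<open>Greedy choice: every new table serves at least half of the inputs not yet served, so
  fewer than \<open>2 ^ k\<close> inputs are exhausted after \<open>k\<close> tables.\<close>

lemma exists_good_tables:
  assumes "0 < m"
  shows "finite X \<Longrightarrow> card X < 2 ^ k \<Longrightarrow>
    \<exists>W. (\<forall>i < k. W i \<in> weight_tables m) \<and> (\<forall>x \<in> X. \<exists>i < k. \<forall>v < m. \<not> tie C (W i) x v)"
proof (induction k arbitrary: X)
  case (Suc k)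
  obtain w where w: "w \<in> weight_tables m" "2 * card {x \<in> X. \<exists>v < m. tie C w x v} \<le> card X"
    using exists_half_good_table[OF Suc.prems(1) assms, of C] by (rule bexE)
  then have "card {x \<in> X. \<exists>v < m. tie C w x v} < 2 ^ k" using Suc.prems(2) by simp
  moreover have "finite {x \<in> X. \<exists>v < m. tie C w x v}" using Suc.prems(1) by simp
  ultimately have "\<exists>W. (\<forall>i < k. W i \<in> weight_tables m) \<and>
      (\<forall>x \<in> {x \<in> X. \<exists>v < m. tie C w x v}. \<exists>i < k. \<forall>v < m. \<not> tie C (W i) x v)"
    by (intro Suc.IH)
  then obtain W where W: "(\<forall>i < k. W i \<in> weight_tables m) \<and>
    (\<forall>x \<in> {x \<in> X. \<exists>v < m. tie C w x v}. \<exists>i < k. \<forall>v < m. \<not> tie C (W i) x v)"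
    by (rule exE)
  let ?W = "case_nat w W"
  have "\<exists>i < Suc k. \<forall>v < m. \<not> tie C (?W i) x v" if "x \<in> X" for x
  proof (cases "\<exists>v < m. tie C w x v")
    case True
    then have "x \<in> {x \<in> X. \<exists>v < m. tie C w x v}" using that by simp
    from bspec[OF conjunct2[OF W] this] obtain i where "i < k" "\<forall>v < m. \<not> tie C (W i) x v"
      by (elim exE conjE)
    then show ?thesis by (intro exI[of _ "Suc i"]) simp
  next
    case False
    then show ?thesis by (intro exI[of _ 0]) simp
  qed
  moreover have "?W i \<in> weight_tables m" if "i < Suc k" for i
    using that conjunct1[OF W] w(1) by (cases i) simp_all
  ultimately show ?case by (intro exI[of _ ?W] conjI allI impI ballI)
qed simp

section \<open>Circuits for deduction systems\<close>

text \<open>Sorting the named gates by \<open>rho\<close> puts children before parents;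
  \<open>phi\<close>, which bounds the size of proof trees, becomes \<open>tau\<close>.\<close>

lemma numbered_circuit:
  fixes gt :: "'n \<Rightarrow> ('a, 'n) gate" and rho phi :: "'n \<Rightarrow> nat"
  assumes fin: "finite G" and n0: "n0 \<in> G"
    and And: "\<And>n a b. n \<in> G \<Longrightarrow> gt n = And a b \<Longrightarrow>
      a \<in> G \<and> b \<in> G \<and> rho a < rho n \<and> rho b < rho n \<and> phi a + phi b < phi n"
    and Or: "\<And>n a b. n \<in> G \<Longrightarrow> gt n = Or a b \<Longrightarrow>
      a \<in> G \<and> b \<in> G \<and> rho a < rho n \<and> rho b < rho n \<and> phi a < phi n \<and> phi b < phi n"
    and Lit: "\<And>n a S. n \<in> G \<Longrightarrow> gt n = Lit a S \<Longrightarrow> a \<le> L"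
    and phi: "\<And>n. n \<in> G \<Longrightarrow> 0 < phi n \<and> phi n \<le> T"
  shows "\<exists>C m tau. circuit C m T L tau \<and> m \<le> card G \<and> (\<forall>x. der C x (m - 1) \<longleftrightarrow> der gt x n0)"
proof -
  obtain ys where ys: "set ys = G" "distinct ys" using finite_distinct_list[OF fin] by blast
  define xs where "xs = sort_key rho ys"
  have xs: "set xs = G" "length xs = card G" "sorted (map rho xs)"
    using ys distinct_card[of ys] by (simp_all add: xs_def)
  define idx where "idx n = (SOME i. i < length xs \<and> xs ! i = n)" for n
  have idx: "idx n < length xs \<and> xs ! idx n = n" if "n \<in> G" for n
    unfolding idx_def by (rule someI_ex) (use that xs(1) in \<open>auto simp: in_set_conv_nth\<close>)
  define C where "C v = map_gate idx (gt (xs ! v))" for v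
  have in_G: "xs ! v \<in> G" if "v < length xs" for v using that xs(1) by force
  have less: "idx a < v" if "a \<in> G" "v < length xs" "rho a < rho (xs ! v)" for a v
  proof (rule ccontr)
    assume "\<not> idx a < v"
    then have "rho (xs ! v) \<le> rho (xs ! idx a)"
      using sorted_nth_mono[OF xs(3), of v "idx a"] idx[OF that(1)] that(2) by simp
    then show False using idx[OF that(1)] that(3) by simp
  qed
  \<comment> \<open>Cutting the list after \<open>n0\<close> makes it the last gate; the remaining
    gates keep their children, which come earlier.\<close>
  define m where "m = Suc (idx n0)"
  have m: "m \<le> length xs" using idx[OF n0] by (simp add: m_def)
  have "circuit C m T L (\<lambda>v. phi (xs ! v))"
  proof
    show "0 < m" by (simp add: m_def)
  next
    fix v a' b' assume v: "v < m" and C: "C v = And a' b'"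
    then have vl: "v < length xs" using m by simp
    obtain a b where ab: "gt (xs ! v) = And a b" "a' = idx a" "b' = idx b"
      using C by (cases "gt (xs ! v)") (auto simp: C_def)
    note * = And[OF in_G[OF vl] ab(1)]
    show "a' < v \<and> b' < v \<and> phi (xs ! a') + phi (xs ! b') < phi (xs ! v)"
      unfolding ab(2,3) using * less[OF _ vl] idx by simp
  next
    fix v a' b' assume v: "v < m" and C: "C v = Or a' b'"
    then have vl: "v < length xs" using m by simp
    obtain a b where ab: "gt (xs ! v) = Or a b" "a' = idx a" "b' = idx b"
      using C by (cases "gt (xs ! v)") (auto simp: C_def)
    note * = Or[OF in_G[OF vl] ab(1)]
    show "a' < v \<and> b' < v \<and> phi (xs ! a') < phi (xs ! v) \<and> phi (xs ! b') < phi (xs ! v)"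
      unfolding ab(2,3) using * less[OF _ vl] idx by simp
  next
    fix v assume "v < m"
    then have G: "xs ! v \<in> G" using m in_G by simp
    show "0 < phi (xs ! v)" "phi (xs ! v) \<le> T" using phi[OF G] by simp_all
    show "gaddr (C v) \<le> L" using Lit[OF G] by (cases "gt (xs ! v)") (auto simp: C_def)
  qed
  moreover have "der C x (idx n)" if "der gt x n" "n \<in> G" for x n
    using that
  proof (induction rule: der.induct)
    case (Lit n a S)
    have "C (idx n) = Lit a S" using idx[OF Lit.prems] Lit.hyps(1) by (simp add: C_def)
    then show ?case using Lit.hyps(2) by (rule der.Lit)
  next
    case (And n a b)
    have "C (idx n) = And (idx a) (idx b)" using idx[OF And.prems] And.hyps(1) by (simp add: C_def)
    moreover have "der C x (idx a)" using And.IH(1) assms(3)[OF And.prems And.hyps(1)] by simp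
    moreover have "der C x (idx b)" using And.IH(2) assms(3)[OF And.prems And.hyps(1)] by simp
    ultimately show ?case by (rule der.And)
  next
    case (OrL n a b)
    have "C (idx n) = Or (idx a) (idx b)" using idx[OF OrL.prems] OrL.hyps(1) by (simp add: C_def)
    moreover have "der C x (idx a)" using OrL.IH assms(4)[OF OrL.prems OrL.hyps(1)] by simp
    ultimately show ?case by (rule der.OrL)
  next
    case (OrR n a b)
    have "C (idx n) = Or (idx a) (idx b)" using idx[OF OrR.prems] OrR.hyps(1) by (simp add: C_def)
    moreover have "der C x (idx b)" using OrR.IH assms(4)[OF OrR.prems OrR.hyps(1)] by simp
    ultimately show ?case by (rule der.OrR)
  qed
  moreover have "der gt x (xs ! v)" if "der C x v" "v < length xs" for x v
    using that
  proof (induction rule: der.induct)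
    case (Lit v a S)
    then have "gt (xs ! v) = Lit a S" by (cases "gt (xs ! v)") (auto simp: C_def)
    then show ?case using Lit by (intro der.Lit)
  next
    case (And v a' b')
    then obtain a b where ab: "gt (xs ! v) = And a b" "a' = idx a" "b' = idx b"
      by (cases "gt (xs ! v)") (auto simp: C_def)
    have "a \<in> G" "b \<in> G" using assms(3)[OF in_G ab(1)] And by simp_all
    then have "der gt x a" "der gt x b" using And.IH idx[of a] idx[of b] ab(2,3) by simp_all
    with ab(1) show ?case by (rule der.And)
  next
    case (OrL v a' b')
    then obtain a b where ab: "gt (xs ! v) = Or a b" "a' = idx a" "b' = idx b"
      by (cases "gt (xs ! v)") (auto simp: C_def)
    have "a \<in> G" "b \<in> G" using assms(4)[OF in_G ab(1)] OrL by simp_all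
    then have "der gt x a" using OrL.IH idx[of a] idx[of b] ab(2,3) by simp_all
    with ab(1) show ?case by (rule der.OrL)
  next
    case (OrR v a' b')
    then obtain a b where ab: "gt (xs ! v) = Or a b" "a' = idx a" "b' = idx b"
      by (cases "gt (xs ! v)") (auto simp: C_def)
    have "a \<in> G" "b \<in> G" using assms(4)[OF in_G ab(1)] OrR by simp_all
    then have "der gt x b" using OrR.IH idx[of a] idx[of b] ab(2,3) by simp_all
    with ab(1) show ?case by (rule der.OrR)
  qed
  moreover have "m - 1 = idx n0" by (simp add: m_def)
  ultimately have "circuit C m T L (\<lambda>v. phi (xs ! v)) \<and> m \<le> card G \<and> (\<forall>x. der C x (m - 1) \<longleftrightarrow> der gt x n0)"
    using idx[OF n0] n0 m xs(2) by fastforce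
  then show ?thesis by blast
qed

text \<open>A deduction system: item \<open>i\<close> follows from the two items \<open>j\<close> and \<open>sec i j\<close>, for any
  \<open>j \<in> set its\<close> with \<open>ok i j\<close>, if the scanned symbol in cell \<open>ad i\<close> belongs to \<open>S i j\<close>.\<close>

locale deduction =
  fixes its :: "'i list" and base :: "'i \<Rightarrow> bool" and ok :: "'i \<Rightarrow> 'i \<Rightarrow> bool" and sec :: "'i \<Rightarrow> 'i \<Rightarrow> 'i"
    and ad :: "'i \<Rightarrow> nat" and S :: "'i \<Rightarrow> 'i \<Rightarrow> 'a tape_symbol set" and mu :: "'i \<Rightarrow> nat" and L mu_max :: nat
  assumes sec_in: "i \<in> set its \<Longrightarrow> j \<in> set its \<Longrightarrow> ok i j \<Longrightarrow> sec i j \<in> set its"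
    and mu_less: "i \<in> set its \<Longrightarrow> j \<in> set its \<Longrightarrow> ok i j \<Longrightarrow> mu j + mu (sec i j) + 1 < mu i"
    and ad_le: "i \<in> set its \<Longrightarrow> ad i \<le> L"
    and mu_le: "i \<in> set its \<Longrightarrow> mu i \<le> mu_max"
begin

inductive deduc :: "'a list \<Rightarrow> 'i \<Rightarrow> bool" for x where
  base: "base i \<Longrightarrow> deduc x i"
| step: "j \<in> set its \<Longrightarrow> ok i j \<Longrightarrow> scanned x (ad i) \<in> S i j \<Longrightarrow> deduc x j \<Longrightarrow> deduc x (sec i j) \<Longrightarrow> deduc x i"

end

text \<open>Gates are binary, so the disjunction over all premises becomes a chain of
  \<open>Or\<close> gates: \<open>Chain i k\<close> tries the list from position \<open>k\<close>
  on. The input test and the two premises of an alternative are joined by two \<open>And\<close>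
  gates.\<close>

datatype 'i name = Chain 'i nat | Alt 'i 'i | Test 'i 'i | Both 'i 'i

context deduction
begin

fun gt :: "'i name \<Rightarrow> ('a, 'i name) gate" where
  "gt (Chain i k) = (if base i then Lit 0 UNIV
     else if k < length its then Or (Alt i (its ! k)) (Chain i (Suc k)) else Lit 0 {})"
| "gt (Alt i j) = (if ok i j then And (Test i j) (Both i j) else Lit 0 {})"
| "gt (Test i j) = Lit (ad i) (S i j)"
| "gt (Both i j) = And (Chain j 0) (Chain (sec i j) 0)"

fun meaning :: "'a list \<Rightarrow> 'i name \<Rightarrow> bool" where
  "meaning x (Chain i k) \<longleftrightarrow> deduc x i"
| "meaning x (Alt i j) \<longleftrightarrow> ok i j \<and> scanned x (ad i) \<in> S i j \<and> deduc x j \<and> deduc x (sec i j)"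
| "meaning x (Test i j) \<longleftrightarrow> scanned x (ad i) \<in> S i j"
| "meaning x (Both i j) \<longleftrightarrow> deduc x j \<and> deduc x (sec i j)"

lemma der_meaning: "der gt x n \<Longrightarrow> meaning x n"
proof (induction rule: der.induct)
  case (Lit n a X)
  then show ?case by (cases n) (auto split: if_splits intro: deduc.base)
next
  case (And n a b)
  then show ?case by (cases n) (auto split: if_splits)
next
  case (OrL n a b)
  then show ?case by (cases n) (auto split: if_splits intro: deduc.step[OF nth_mem])
next
  case (OrR n a b)
  then show ?case by (cases n) (auto split: if_splits)
qed

lemma deduc_der: "deduc x i \<Longrightarrow> der gt x (Chain i 0)"
proof (induction rule: deduc.induct)
  case (base i)
  then show ?case by (intro der.Lit[of _ _ 0 UNIV]) auto
next
  case (step j i)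
  obtain k where k: "k < length its" "its ! k = j" using step.hyps(1) by (auto simp: in_set_conv_nth)
  show ?case
  proof (cases "base i")
    case True
    then show ?thesis by (intro der.Lit[of _ _ 0 UNIV]) auto
  next
    case False
    have both: "der gt x (Both i j)" using gt.simps(4) step.IH by (rule der.And)
    have test: "der gt x (Test i j)" using gt.simps(3) step.hyps(3) by (rule der.Lit)
    have "gt (Alt i j) = And (Test i j) (Both i j)" using step.hyps(2) by simp
    then have alt: "der gt x (Alt i j)" using test both by (rule der.And)
    \<comment> \<open>The chain is traversed backwards from position \<open>k\<close>, where
      \<open>j\<close> stands, to its entry at \<open>0\<close>.\<close>
    have "l \<le> k \<Longrightarrow> der gt x (Chain i (k - l))" for l
    proof (induction l)
      case 0
      have "gt (Chain i k) = Or (Alt i j) (Chain i (Suc k))" using False k by simp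
      then have "der gt x (Chain i k)" using alt by (rule der.OrL)
      then show ?case by simp
    next
      case (Suc l)
      then have "Suc (k - Suc l) = k - l" by simp
      then have "gt (Chain i (k - Suc l)) = Or (Alt i (its ! (k - Suc l))) (Chain i (k - l))"
        using False k(1) by simp
      moreover have "der gt x (Chain i (k - l))" using Suc by simp
      ultimately show ?case by (rule der.OrR)
    qed
    from this[of k] show ?thesis by simp
  qed
qed

lemma der_Chain: "der gt x (Chain i 0) \<longleftrightarrow> deduc x i"
  using der_meaning[of x "Chain i 0"] deduc_der by auto

abbreviation M :: nat where "M \<equiv> length its"

text \<open>\<open>Both\<close> is limited to pairs with \<open>ok i j\<close>, because only then
  does \<open>sec i j\<close> stay in the list and does \<open>mu\<close> decrease.\<close>

definition G :: "'i name set" where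
  "G = case_prod Chain ` (set its \<times> {..M}) \<union> case_prod Alt ` (set its \<times> set its) \<union>
     case_prod Test ` (set its \<times> set its) \<union> case_prod Both ` {(i, j) \<in> set its \<times> set its. ok i j}"

text \<open>The gates of one item use offsets up to \<open>M + 3\<close>, so the factor
  \<open>M + 4\<close> places them all above the gates of items with smaller
  \<open>mu\<close>.\<close>

fun rho :: "'i name \<Rightarrow> nat" where
  "rho (Chain i k) = mu i * (M + 4) + (M - k) + 3"
| "rho (Alt i j) = mu i * (M + 4) + 2"
| "rho (Both i j) = mu i * (M + 4) + 1"
| "rho (Test i j) = mu i * (M + 4)"

text \<open>By \<open>mu_less\<close>, the values \<open>mu + 1\<close> of the two premises add up
  to at most \<open>mu i\<close>. This frees \<open>2 * M + 4\<close>, just enough for the two chain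
  terms \<open>M + 1\<close>, the \<open>- 1\<close> at \<open>Both\<close> and a strict
  decrease.\<close>

fun phi :: "'i name \<Rightarrow> nat" where
  "phi (Chain i k) = (2 * M + 4) * (mu i + 1) + (M - k) + 1"
| "phi (Alt i j) = (2 * M + 4) * (mu i + 1) + 1"
| "phi (Both i j) = (2 * M + 4) * (mu i + 1) - 1"
| "phi (Test i j) = 1"

lemma finite_G: "finite G"
  unfolding G_def by (intro finite_UnI finite_imageI) (auto intro: finite_subset[of _ "set its \<times> set its"])

lemma card_G: "card G \<le> 4 * (M + 1) ^ 2"
proof -
  have s: "card (set its) \<le> M" by (rule card_length)
  have "card (case_prod Chain ` (set its \<times> {..M})) \<le> card (set its \<times> {..M})"
    by (intro card_image_le) auto
  also have "\<dots> = card (set its) * (M + 1)" by (simp add: card_cartesian_product)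
  also have "\<dots> \<le> M * (M + 1)" using s by (rule mult_le_mono1)
  finally have 1: "card (case_prod Chain ` (set its \<times> {..M})) \<le> (M + 1) ^ 2"
    by (simp add: power2_eq_square)
  have 2: "card (f ` X) \<le> (M + 1) ^ 2" if "X \<subseteq> set its \<times> set its" for f :: "'i \<times> 'i \<Rightarrow> 'i name" and X
  proof -
    have "card (f ` X) \<le> card X" using that by (intro card_image_le) (auto intro: finite_subset)
    also have "\<dots> \<le> card (set its \<times> set its)" using that by (intro card_mono) auto
    also have "\<dots> \<le> M * M" using s by (simp add: card_cartesian_product mult_le_mono)
    finally show ?thesis by (simp add: power2_eq_square)
  qed
  have "card G \<le> (M + 1) ^ 2 + (M + 1) ^ 2 + (M + 1) ^ 2 + (M + 1) ^ 2"
    unfolding G_def by (intro order.trans[OF card_Un_le] add_mono 1 2) auto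
  then show ?thesis by simp
qed

lemma circuit_of_deduction:
  assumes "i0 \<in> set its"
  shows "\<exists>C m tau. circuit C m ((2 * M + 4) * (mu_max + 1) + M + 1) L tau \<and> m \<le> 4 * (M + 1) ^ 2 \<and>
    (\<forall>x. der C x (m - 1) \<longleftrightarrow> deduc x i0)"
proof -
  have mu: "(mu j + mu (sec i j) + 2) * c \<le> mu i * c" "(mu j + mu (sec i j) + 2) \<le> mu i"
    if "i \<in> set its" "j \<in> set its" "ok i j" for i j c
  proof -
    show "mu j + mu (sec i j) + 2 \<le> mu i" using mu_less[OF that] by simp
    then show "(mu j + mu (sec i j) + 2) * c \<le> mu i * c" by (rule mult_le_mono1)
  qed
  have "\<exists>C m tau. circuit C m ((2 * M + 4) * (mu_max + 1) + M + 1) L tau \<and> m \<le> card G \<and>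
    (\<forall>x. der C x (m - 1) \<longleftrightarrow> der gt x (Chain i0 0))"
  proof (rule numbered_circuit[where rho = rho and phi = phi])
    show "finite G" by (rule finite_G)
    show "Chain i0 0 \<in> G" using assms by (auto simp: G_def)
  next
    fix n a b assume n: "n \<in> G" and g: "gt n = And a b"
    show "a \<in> G \<and> b \<in> G \<and> rho a < rho n \<and> rho b < rho n \<and> phi a + phi b < phi n"
    proof (cases n)
      case (Alt i j)
      then show ?thesis using n g by (auto simp: G_def split: if_splits)
    next
      case (Both i j)
      then have ij: "i \<in> set its" "j \<in> set its" "ok i j" using n by (auto simp: G_def)
      have ab: "a = Chain j 0" "b = Chain (sec i j) 0" using g Both by auto
      have "mu j * (M + 4) + mu (sec i j) * (M + 4) + 2 * (M + 4) \<le> mu i * (M + 4)"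
        using mu(1)[OF ij, of "M + 4"] by (simp only: add_mult_distrib)
      moreover have "A + (M - 0) + 3 < D + 1 \<and> B + (M - 0) + 3 < D + 1" if "A + B + 2 * (M + 4) \<le> D" for A B D :: nat
        using that by auto
      ultimately have rho: "rho a < rho n \<and> rho b < rho n" unfolding ab Both rho.simps by blast
      have "mu j * (2 * M + 4) + mu (sec i j) * (2 * M + 4) + 2 * (2 * M + 4) \<le> mu i * (2 * M + 4)"
        using mu(1)[OF ij, of "2 * M + 4"] by (simp only: add_mult_distrib)
      moreover have "(A + c) + (M - 0) + 1 + ((B + c) + (M - 0) + 1) < (D + c) - 1"
        if "A + B + 2 * c \<le> D" "c = 2 * M + 4" for A B D c :: nat
        using that by linarith
      ultimately have "phi a + phi b < phi n"
        unfolding ab Both phi.simps mult.commute[of "2 * M + 4"] add_mult_distrib[of _ 1] mult_1 by blast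
      moreover have "a \<in> G" "b \<in> G" using ij sec_in[OF ij] unfolding ab by (auto simp: G_def)
      ultimately show ?thesis using rho by blast
    qed (use n g in \<open>auto split: if_splits\<close>)
  next
    fix n a b assume n: "n \<in> G" and g: "gt n = Or a b"
    show "a \<in> G \<and> b \<in> G \<and> rho a < rho n \<and> rho b < rho n \<and> phi a < phi n \<and> phi b < phi n"
      using n g by (cases n) (auto simp: G_def split: if_splits)
  next
    fix n a X assume "n \<in> G" "gt n = Lit a X"
    then show "a \<le> L" by (cases n) (auto simp: G_def ad_le split: if_splits)
  next
    fix n assume n: "n \<in> G"
    define X where "X i = (2 * M + 4) * (mu i + 1)" for i
    define Y where "Y = (2 * M + 4) * (mu_max + 1)"
    have X: "4 \<le> X i" "X i \<le> Y" if "i \<in> set its" for i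
      using mu_le[OF that] unfolding X_def Y_def by (simp, intro mult_le_mono2, simp)
    show "0 < phi n \<and> phi n \<le> (2 * M + 4) * (mu_max + 1) + M + 1"
    proof (cases n)
      case (Chain i k)
      then have "i \<in> set its" using n by (auto simp: G_def)
      from X[OF this] show ?thesis unfolding Chain phi.simps X_def[symmetric] Y_def[symmetric] by simp
    next
      case (Alt i j)
      then have "i \<in> set its" using n by (auto simp: G_def)
      from X[OF this] show ?thesis unfolding Alt phi.simps X_def[symmetric] Y_def[symmetric] by simp
    next
      case (Both i j)
      then have "i \<in> set its" using n by (auto simp: G_def)
      from X[OF this] show ?thesis unfolding Both phi.simps X_def[symmetric] Y_def[symmetric] by simp
    qed simp
  qed
  then show ?thesis using card_G der_Chain by (meson le_trans)
qed

end

section \<open>Pushdown automata as deduction systems\<close>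

lemma scanned_tape_alph: "x \<in> lists \<Sigma> \<Longrightarrow> scanned x i \<in> tape_alph \<Sigma>"
  by (auto simp: scanned_def tape_alph_def in_lists_conv_set)

lemma finite_strings_upto: "finite A \<Longrightarrow> finite (strings_upto A k)"
proof -
  have "strings_upto A k = {xs. set xs \<subseteq> A \<and> length xs \<le> k}"
    by (auto simp: strings_upto_def)
  then show "finite A \<Longrightarrow> finite (strings_upto A k)" by (simp add: finite_lists_length_le)
qed

lemma successively_imp_relpow:
  "successively R cs \<Longrightarrow> cs \<noteq> [] \<Longrightarrow> (R ^^ (length cs - 1)) (hd cs) (last cs)"
proof (induction cs rule: induct_list012)
  case (3 c c' cs)
  then have "R c c'" "(R ^^ (length (c' # cs) - 1)) (hd (c' # cs)) (last (c' # cs))" by simp_all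
  then show ?case using relpowp_Suc_I2[of R c c' "length cs" "last (c' # cs)"] by simp
qed auto

lemma rtranclp_imp_successively:
  assumes "R\<^sup>*\<^sup>* a b"
  shows "\<exists>cs. cs \<noteq> [] \<and> hd cs = a \<and> last cs = b \<and> successively R cs"
  using assms
proof (induction rule: converse_rtranclp_induct)
  case base
  show ?case by (intro exI[of _ "[b]"]) simp
next
  case (step y z)
  then obtain cs where "cs \<noteq> []" "hd cs = z" "last cs = b" "successively R cs" by blast
  then show ?case using step(1) by (intro exI[of _ "y # cs"]) (auto simp: successively_Cons)
qed

lemma two_npda_trans:
  assumes M: "two_npda \<Sigma> M"
    and t: "q \<in> states M - halt_states M" "\<sigma> \<in> tape_alph \<Sigma>" "a \<in> stack_alph M" "(p, d, w) \<in> trans M q \<sigma> a"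
  shows "p \<in> states M \<and> d \<in> {-1, 0, 1} \<and> w \<in> lists (stack_alph M) \<and>
    (\<sigma> = Left_End \<longrightarrow> d \<noteq> -1) \<and> (\<sigma> = Right_End \<longrightarrow> d \<noteq> 1) \<and>
    (a = bottom M \<longrightarrow> (\<exists>u. w = u @ [bottom M] \<and> bottom M \<notin> set u)) \<and>
    (a \<noteq> bottom M \<longrightarrow> bottom M \<notin> set w)"
proof -
  have "\<forall>(p, d, w) \<in> trans M q \<sigma> a. p \<in> states M \<and> d \<in> {-1, 0, 1} \<and> w \<in> lists (stack_alph M) \<and>
    (\<sigma> = Left_End \<longrightarrow> d \<noteq> -1) \<and> (\<sigma> = Right_End \<longrightarrow> d \<noteq> 1) \<and>
    (a = bottom M \<longrightarrow> (\<exists>u. w = u @ [bottom M] \<and> bottom M \<notin> set u)) \<and>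
    (a \<noteq> bottom M \<longrightarrow> bottom M \<notin> set w)"
    using M t(1-3) unfolding two_npda_def by (elim conjE) ((drule (1) bspec)+, erule conjunct2)
  from bspec[OF this t(4)] show ?thesis unfolding prod.case .
qed

text \<open>\<open>push_size\<close> is a \<open>Sup\<close> of naturals and bounds its members only
  when the set is finite; finiteness of the alphabet provides this.\<close>

lemma length_le_push_size:
  assumes M: "two_npda \<Sigma> M" and fin: "finite \<Sigma>"
    and t: "q \<in> states M - halt_states M" "\<sigma> \<in> tape_alph \<Sigma>" "a \<in> stack_alph M" "(p, d, w) \<in> trans M q \<sigma> a"
  shows "length w \<le> push_size \<Sigma> M"
proof -
  let ?Q = "states M - halt_states M" and ?A = "tape_alph \<Sigma>" and ?S = "stack_alph M"
  define X where "X = {length w | q \<sigma> a p d w. q \<in> ?Q \<and> \<sigma> \<in> ?A \<and> a \<in> ?S \<and> (p, d, w) \<in> trans M q \<sigma> a}"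
  define Z where "Z = (\<Union>q \<in> ?Q. \<Union>\<sigma> \<in> ?A. \<Union>a \<in> ?S. trans M q \<sigma> a)"
  have "finite ?Q" "finite ?A" "finite ?S"
    using M fin by (simp_all add: two_npda_def tape_alph_def)
  moreover have "finite (trans M q \<sigma> a)" if "q \<in> ?Q" "\<sigma> \<in> ?A" "a \<in> ?S" for q \<sigma> a
    using M that unfolding two_npda_def by blast
  ultimately have "finite Z" unfolding Z_def by (intro finite_UN_I) auto
  moreover have "X \<subseteq> (\<lambda>(p, d, w). length w) ` Z"
    unfolding X_def Z_def by force
  ultimately have "finite X" by (rule finite_surj)
  moreover have "length w \<in> X" unfolding X_def using t by blast
  ultimately have "length w \<le> Sup X" by (rule le_cSup_finite)
  then show ?thesis by (simp add: push_size_def X_def)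
qed

type_synonym item = "nat \<times> nat \<times> nat list \<times> nat \<times> nat \<times> nat"

text \<open>The item \<open>(q, i, w, t, p, j)\<close> states that the automaton can pop \<open>w\<close> within \<open>t\<close> steps, going from
  state \<open>q\<close> and cell \<open>i\<close> to state \<open>p\<close> and cell \<open>j\<close>. So that acceptance becomes an item, accepting
  states may pop any symbol, going to the state \<open>goal\<close> in cell \<open>0\<close>.\<close>

locale npda_items =
  fixes \<Sigma> :: "'a set" and N :: "(nat, 'a, nat) pda" and l T :: nat
  assumes N: "two_npda \<Sigma> N" and fin: "finite \<Sigma>"
begin

text \<open>At least 1, because \<open>wset\<close> contains \<open>[bottom N]\<close> even if
  nothing is ever pushed.\<close>

definition e :: nat where
  "e = max 1 (push_size \<Sigma> N)"

definition wset :: "nat list set" where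
  "wset = insert [bottom N] (strings_upto (stack_alph N) (push_size \<Sigma> N))"

text \<open>One unit for each of \<open>T\<close> steps, one for the initial stack symbol, and
  \<open>T * e\<close> for popping everything that \<open>T\<close> steps can have pushed.\<close>

definition fuel :: nat where
  "fuel = T + 1 + T * e"

text \<open>The default \<open>start N\<close> keeps \<open>goal\<close> a state when nothing
  accepts.\<close>

definition goal :: nat where
  "goal = (if acc_states N = {} then start N else SOME p. p \<in> acc_states N)"

definition items :: "item set" where
  "items = states N \<times> {..l + 1} \<times> wset \<times> {..fuel} \<times> states N \<times> {..l + 1}"

definition its :: "item list" where
  "its = (SOME xs. set xs = items \<and> length xs = card items)"

fun base :: "item \<Rightarrow> bool" where
  "base (q, i, w, t, p, j) \<longleftrightarrow> w = [] \<and> q = p \<and> i = j"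

text \<open>The first premise describes the fate of the top symbol: one move replaces it by
  \<open>w'\<close>, which is popped within \<open>t'\<close> steps. The second premise,
  \<open>sec\<close>, pops the rest with the remaining \<open>t - 1 - t'\<close>. Legality of the
  move depends on the scanned symbol and is left to \<open>S\<close>.\<close>

fun ok :: "item \<Rightarrow> item \<Rightarrow> bool" where
  "ok (q, i, w, t, p, j) (q', i', w', t', r, k) \<longleftrightarrow> w \<noteq> [] \<and> t' < t"

fun sec :: "item \<Rightarrow> item \<Rightarrow> item" where
  "sec (q, i, w, t, p, j) (q', i', w', t', r, k) = (r, k, tl w, t - 1 - t', p, j)"

fun ad :: "item \<Rightarrow> nat" where
  "ad (q, i, w, t, p, j) = i"

fun S :: "item \<Rightarrow> item \<Rightarrow> 'a tape_symbol set" where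
  "S (q, i, w, t, p, j) (q', i', w', t', r, k) =
     {\<sigma>. q \<in> states N - halt_states N \<and> (q', int i' - int i, w') \<in> trans N q \<sigma> (hd w) \<or>
       q \<in> acc_states N \<and> q' = goal \<and> i' = 0 \<and> w' = []}"

text \<open>An inference spends one unit of time, worth \<open>e + 1\<close>, which outweighs the at
  most \<open>e\<close> symbols of the pushed string.\<close>

fun mu :: "item \<Rightarrow> nat" where
  "mu (q, i, w, t, p, j) = (e + 1) * t + length w"

lemma Nil_in_wset [simp]: "[] \<in> wset"
  by (simp add: wset_def strings_upto_def)

lemma wset_length: "w \<in> wset \<Longrightarrow> length w \<le> e"
  by (auto simp: wset_def strings_upto_def e_def)

lemma wset_tl: "w \<in> wset \<Longrightarrow> tl w \<in> wset"
  by (cases w) (auto simp: wset_def strings_upto_def)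

lemma finite_items: "finite items"
  using N by (simp add: items_def two_npda_def wset_def finite_strings_upto)

lemma its: "set its = items" "length its = card items"
proof -
  obtain xs where "set xs = items" "distinct xs" using finite_distinct_list[OF finite_items] by blast
  then have "\<exists>xs. set xs = items \<and> length xs = card items" using distinct_card by metis
  from someI_ex[OF this] show "set its = items" "length its = card items" unfolding its_def by auto
qed

lemma goal_in: "goal \<in> states N" and goal_acc: "acc_states N \<noteq> {} \<Longrightarrow> goal \<in> acc_states N"
proof -
  show *: "acc_states N \<noteq> {} \<Longrightarrow> goal \<in> acc_states N"
    by (auto simp: goal_def intro: someI)
  show "goal \<in> states N"
    using * N by (cases "acc_states N = {}") (auto simp: goal_def two_npda_def)
qed

sublocale deduction its base ok sec ad S mu "l + 1" "(e + 1) * fuel + e"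
proof
  fix i j assume ij: "i \<in> set its" "j \<in> set its" "ok i j"
  obtain q h w t p h' where i: "i = (q, h, w, t, p, h')" by (cases i)
  obtain q' k w' t' r k' where j: "j = (q', k, w', t', r, k')" by (cases j)
  have w: "w \<noteq> []" "t' < t" "w \<in> wset" "length w' \<le> e"
    using ij unfolding i j its items_def by (auto dest: wset_length)
  have "tl w \<in> wset" using w(3) by (rule wset_tl)
  moreover have "r \<in> states N" "k' \<le> l + 1" "p \<in> states N" "h' \<le> l + 1" "t \<le> fuel"
    using ij(1,2) unfolding i j its items_def by auto
  ultimately show "sec i j \<in> set its"
    unfolding i j its items_def by simp
  obtain d where d: "t = Suc (t' + d)" using less_imp_Suc_add[OF w(2)] by blast
  have "length (tl w) + 1 = length w" using w(1) by (cases w) auto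
  then show "mu j + mu (sec i j) + 1 < mu i"
    using w(4) unfolding i j by (simp add: d algebra_simps)
next
  fix i assume i: "i \<in> set its"
  then show "ad i \<le> l + 1" unfolding its items_def by (cases i) auto
  obtain q h w t p h' where i': "i = (q, h, w, t, p, h')" by (cases i)
  have "length w \<le> e" "t \<le> fuel" using i unfolding i' its items_def by (auto dest: wset_length)
  then show "mu i \<le> (e + 1) * fuel + e" unfolding i' mu.simps by (intro add_mono mult_le_mono2)
qed

definition alt :: "'a list \<Rightarrow> nat \<Rightarrow> nat \<Rightarrow> nat \<Rightarrow> nat \<Rightarrow> nat \<Rightarrow> nat list \<Rightarrow> bool" where
  "alt x q i a q' i' w' \<longleftrightarrow>
     q \<in> states N - halt_states N \<and> (q', int i' - int i, w') \<in> trans N q (scanned x i) a \<or>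
     q \<in> acc_states N \<and> q' = goal \<and> i' = 0 \<and> w' = []"

section \<open>Deducible items and computations\<close>

lemma pops_nil: "deduc x (q, i, [], t, q, i)"
  by (intro deduc.base) simp

lemma pops_cons:
  assumes "(q', i', w', t', r, k) \<in> items" "t' < t" "alt x q i a q' i' w'"
    "deduc x (q', i', w', t', r, k)" "deduc x (r, k, w, t - 1 - t', p, j)"
  shows "deduc x (q, i, a # w, t, p, j)"
proof (rule deduc.step[of "(q', i', w', t', r, k)"])
  show "(q', i', w', t', r, k) \<in> set its" using assms(1) by (simp only: its)
  show "ok (q, i, a # w, t, p, j) (q', i', w', t', r, k)" using assms(2) by simp
  show "scanned x (ad (q, i, a # w, t, p, j)) \<in> S (q, i, a # w, t, p, j) (q', i', w', t', r, k)"
    using assms(3) by (simp add: alt_def)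
  show "deduc x (sec (q, i, a # w, t, p, j) (q', i', w', t', r, k))" using assms(5) by simp
qed (rule assms(4))

lemma pops_nilD: "deduc x (q, i, [], t, p, j) \<Longrightarrow> p = q \<and> j = i"
  by (erule deduc.cases) auto

lemma pops_consD:
  assumes "deduc x (q, i, a # w, t, p, j)"
  obtains q' i' w' t' r k where "(q', i', w', t', r, k) \<in> items" "t' < t" "alt x q i a q' i' w'"
    "deduc x (q', i', w', t', r, k)" "deduc x (r, k, w, t - 1 - t', p, j)"
  using assms
proof (cases rule: deduc.cases)
  case (step it)
  obtain q' i' w' t' r k where it: "it = (q', i', w', t', r, k)" by (cases it)
  show ?thesis
  proof (rule that)
    show "(q', i', w', t', r, k) \<in> items" using step(1) unfolding it by (simp only: its)
    show "t' < t" using step(2) unfolding it by simp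
    show "alt x q i a q' i' w'" using step(3) unfolding it by (simp add: alt_def)
    show "deduc x (q', i', w', t', r, k)" using step(4) unfolding it .
    show "deduc x (r, k, w, t - 1 - t', p, j)" using step(5) unfolding it by simp
  qed
qed simp

lemma pops_mono: "deduc x (q, i, w, t, p, j) \<Longrightarrow> t \<le> t2 \<Longrightarrow> deduc x (q, i, w, t2, p, j)"
proof (induction w arbitrary: q i t t2)
  case Nil
  then show ?case using pops_nilD pops_nil by metis
next
  case (Cons a w)
  from Cons.prems(1) obtain q' i' w' t' r k where *: "(q', i', w', t', r, k) \<in> items" "t' < t" "alt x q i a q' i' w'"
    "deduc x (q', i', w', t', r, k)" "deduc x (r, k, w, t - 1 - t', p, j)"
    by (rule pops_consD)
  have "deduc x (r, k, w, t2 - 1 - t', p, j)" using Cons.IH[OF *(5)] Cons.prems(2) by simp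
  then show ?case using * Cons.prems(2) by (intro pops_cons[OF *(1) _ *(3,4)]) simp_all
qed

lemma pops_append:
  "deduc x (q, i, u @ v, t, p, j) \<Longrightarrow> q \<in> states N \<Longrightarrow> i \<le> l + 1 \<Longrightarrow>
    \<exists>t1 t2 r k. t1 + t2 \<le> t \<and> r \<in> states N \<and> k \<le> l + 1 \<and> deduc x (q, i, u, t1, r, k) \<and> deduc x (r, k, v, t2, p, j)"
proof (induction u arbitrary: q i t)
  case Nil
  then show ?case using pops_nil[of x q i 0] by (intro exI[of _ 0] exI[of _ t] exI[of _ q] exI[of _ i]) simp
next
  case (Cons a u)
  from Cons.prems(1) obtain q' i' w' t' r k where *: "(q', i', w', t', r, k) \<in> items" "t' < t" "alt x q i a q' i' w'"
    "deduc x (q', i', w', t', r, k)" "deduc x (r, k, u @ v, t - 1 - t', p, j)"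
    unfolding append_Cons by (rule pops_consD)
  have "r \<in> states N" "k \<le> l + 1" using *(1) by (auto simp: items_def)
  with Cons.IH[OF *(5)] obtain t1 t2 r' k' where IH: "t1 + t2 \<le> t - 1 - t'" "r' \<in> states N" "k' \<le> l + 1"
    "deduc x (r, k, u, t1, r', k')" "deduc x (r', k', v, t2, p, j)"
    by blast
  have "deduc x (q, i, a # u, t1 + 1 + t', r', k')"
    using IH(4) by (intro pops_cons[OF *(1) _ *(3,4)]) simp_all
  moreover have "t1 + 1 + t' + t2 \<le> t" using IH(1) *(2) by simp
  ultimately show ?case using IH by blast
qed

text \<open>Splitting the derivation where \<open>w'\<close> has been popped yields both premises.
  Only the first premise must be a listed item, so whole stacks \<open>z\<close> of any height may
  occur in conclusions.\<close>

lemma pops_step: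
  assumes "alt x q i a q' i' w'" "deduc x (q', i', w' @ z, t, p, j)" "t \<le> fuel"
    "q' \<in> states N" "i' \<le> l + 1" "w' \<in> wset"
  shows "deduc x (q, i, a # z, t + 1, p, j)"
proof -
  obtain t1 t2 r k where *: "t1 + t2 \<le> t" "r \<in> states N" "k \<le> l + 1"
    "deduc x (q', i', w', t1, r, k)" "deduc x (r, k, z, t2, p, j)"
    using pops_append[OF assms(2,4,5)] by blast
  have "(q', i', w', t1, r, k) \<in> items" using * assms by (simp add: items_def)
  moreover have "deduc x (r, k, z, t + 1 - 1 - t1, p, j)" using *(1) by (intro pops_mono[OF *(5)]) simp
  ultimately show ?thesis using * assms(1) by (intro pops_cons) simp_all
qed

text \<open>Each symbol costs one unit. An empty stack admits no move, so in that case
  \<open>goal\<close> and cell \<open>0\<close> must already have been reached.\<close>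

lemma pops_accepting:
  assumes "length z \<le> fuel" "q \<in> acc_states N" "z \<noteq> [] \<or> q = goal \<and> i = 0"
  shows "deduc x (q, i, z, length z, goal, 0)"
  using assms
proof (induction z arbitrary: q i)
  case (Cons a z)
  have "deduc x (goal, 0, [] @ z, length z, goal, 0)"
    using Cons.prems goal_acc by (simp, intro Cons.IH) auto
  then have "deduc x (q, i, a # z, length z + 1, goal, 0)"
    using Cons.prems goal_in by (intro pops_step[where w' = "[]"]) (auto simp: alt_def)
  then show ?case by simp
qed (use pops_nil in auto)

definition inv :: "'a list \<Rightarrow> (nat, nat) config \<Rightarrow> bool" where
  "inv x c \<longleftrightarrow> (case c of (q, i, z) \<Rightarrow> q \<in> states N \<and> i \<le> length x + 1 \<and>
     (\<exists>u. z = u @ [bottom N] \<and> set u \<subseteq> stack_alph N \<and> bottom N \<notin> set u))"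

lemma inv_initial: "inv x (initial N)"
  using N by (auto simp: inv_def initial_def two_npda_def)

lemma inv_step:
  assumes x: "x \<in> lists \<Sigma>" and c: "inv x c" and st: "step N x c c'"
  obtains q i a z p j w where "c = (q, i, a # z)" "c' = (p, j, w @ z)" "alt x q i a p j w"
    "p \<in> states N" "j \<le> length x + 1" "w \<in> wset" "inv x c'"
  using st
proof (cases rule: step.cases)
  case (1 q p d w i a j z)
  have a: "a \<in> stack_alph N"
    using c N 1 unfolding inv_def two_npda_def by (auto simp: Cons_eq_append_conv)
  have sc: "scanned x i \<in> tape_alph \<Sigma>" by (rule scanned_tape_alph[OF x])
  have tr: "p \<in> states N \<and> d \<in> {-1, 0, 1} \<and> w \<in> lists (stack_alph N) \<and>
           (scanned x i = Left_End \<longrightarrow> d \<noteq> -1) \<and> (scanned x i = Right_End \<longrightarrow> d \<noteq> 1) \<and>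
           (a = bottom N \<longrightarrow> (\<exists>u. w = u @ [bottom N] \<and> bottom N \<notin> set u)) \<and>
           (a \<noteq> bottom N \<longrightarrow> bottom N \<notin> set w)"
    by (rule two_npda_trans[OF N 1(3) sc a 1(4)])
  have i: "i \<le> length x + 1" using c 1(1) by (simp add: inv_def)
  have j: "j \<le> length x + 1"
  proof (cases "i = length x + 1")
    case True
    then have "scanned x i = Right_End" by (simp add: scanned_def)
    then show ?thesis using tr 1(5) True by auto
  next
    case False
    then show ?thesis using tr 1(5) i by auto
  qed
  have w: "w \<in> wset"
    using tr length_le_push_size[OF N fin 1(3) sc a 1(4)] by (simp add: wset_def strings_upto_def)
  have alt: "alt x q i a p j w" using 1 by (simp add: alt_def)
  have "\<exists>u. w @ z = u @ [bottom N] \<and> set u \<subseteq> stack_alph N \<and> bottom N \<notin> set u"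
  proof -
    from c 1(1) obtain u where u: "a # z = u @ [bottom N]" "set u \<subseteq> stack_alph N" "bottom N \<notin> set u"
      by (auto simp: inv_def)
    show ?thesis
    proof (cases u)
      case Nil
      then have "a = bottom N" "z = []" using u by auto
      then show ?thesis using tr by auto
    next
      case (Cons b u')
      then have "z = u' @ [bottom N]" "a \<noteq> bottom N" using u by auto
      then show ?thesis using tr u Cons by (intro exI[of _ "w @ u'"]) auto
    qed
  qed
  then have "inv x c'" using 1(2) tr j by (simp add: inv_def)
  then show ?thesis using that 1(1,2) alt tr j w by blast
qed

lemma pops_complete:
  assumes x: "x \<in> lists \<Sigma>" "length x \<le> l"
  shows "inv x c \<Longrightarrow> (step N x ^^ n) c c' \<Longrightarrow> fst c' \<in> acc_states N \<Longrightarrow> n + length (snd (snd c)) + n * e \<le> fuel \<Longrightarrow>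
    deduc x (fst c, fst (snd c), snd (snd c), n + length (snd (snd c)) + n * e, goal, 0)"
proof (induction n arbitrary: c)
  case 0
  then have "snd (snd c) \<noteq> []" by (auto simp: inv_def)
  then show ?case using pops_accepting[of "snd (snd c)" "fst c" "fst (snd c)" x] 0 by auto
next
  case (Suc n)
  obtain d where d: "step N x c d" "(step N x ^^ n) d c'" using relpowp_Suc_D2[OF Suc.prems(2)] by blast
  from inv_step[OF x(1) Suc.prems(1) d(1)] obtain q i a z p j w where *: "c = (q, i, a # z)" "d = (p, j, w @ z)"
    "alt x q i a p j w" "p \<in> states N" "j \<le> length x + 1" "w \<in> wset" "inv x d"
    by metis
  have le: "length w \<le> e" using *(6) by (rule wset_length)
  let ?t = "n + length (w @ z) + n * e"
  have t: "?t + 1 \<le> Suc n + length (a # z) + Suc n * e" using le by simp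
  have "deduc x (p, j, w @ z, ?t, goal, 0)"
    using Suc.IH[OF *(7) d(2) Suc.prems(3)] t Suc.prems(4) unfolding *(1,2) by simp
  then have "deduc x (q, i, a # z, ?t + 1, goal, 0)"
    using * t Suc.prems(4) x(2) by (intro pops_step[OF *(3)]) simp_all
  then show ?case using pops_mono t unfolding *(1) by simp
qed

text \<open>The fictitious pops from accepting states are added to the steps of \<open>N\<close> so
  that every item can be read as a run.\<close>

inductive pop_step :: "'a list \<Rightarrow> (nat, nat) config \<Rightarrow> (nat, nat) config \<Rightarrow> bool" for x where
  step: "step N x c c' \<Longrightarrow> pop_step x c c'"
| pop: "q \<in> acc_states N \<Longrightarrow> pop_step x (q, i, a # z) (goal, 0, z)"

lemma pops_sound: "deduc x it \<Longrightarrow> case it of (q, i, w, t, p, j) \<Rightarrow> \<forall>z. (pop_step x)\<^sup>*\<^sup>* (q, i, w @ z) (p, j, z)"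
proof (induction rule: deduc.induct)
  case (base it)
  then show ?case by (cases it) simp
next
  case (step jt it)
  obtain q i w t p j where it: "it = (q, i, w, t, p, j)" by (cases it)
  obtain q' i' w' t' r k where jt: "jt = (q', i', w', t', r, k)" by (cases jt)
  obtain a w0 where w: "w = a # w0" using step.hyps(2) unfolding it jt by (cases w) auto
  have "pop_step x (q, i, w @ z) (q', i', w' @ w0 @ z)" for z
  proof -
    from step.hyps(3) consider "q \<in> states N - halt_states N" "(q', int i' - int i, w') \<in> trans N q (scanned x i) a"
      | "q \<in> acc_states N" "q' = goal" "i' = 0" "w' = []"
      unfolding it jt w by auto
    then show ?thesis
    proof cases
      case 1
      then show ?thesis unfolding w append_Cons by (intro pop_step.step step.intros[where d = "int i' - int i"]) auto
    next
      case 2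
      then show ?thesis unfolding w append_Cons by (auto intro: pop_step.pop)
    qed
  qed
  note h1 = this
  have h2: "(pop_step x)\<^sup>*\<^sup>* (q', i', w' @ w0 @ z) (r, k, w0 @ z)" for z
    using step.IH(1) unfolding jt by auto
  have h3: "(pop_step x)\<^sup>*\<^sup>* (r, k, w0 @ z) (p, j, z)" for z
    using step.IH(2) unfolding it jt w by auto
  show ?case
    unfolding it using converse_rtranclp_into_rtranclp[OF h1 rtranclp_trans[OF h2 h3]] by simp
qed

definition item0 :: item where
  "item0 = (start N, 0, [bottom N], fuel, goal, 0)"

lemma item0_in: "item0 \<in> set its"
  using N goal_in by (auto simp: its item0_def items_def wset_def two_npda_def)

lemma item0_complete:
  assumes x: "x \<in> lists \<Sigma>" "length x \<le> l" and acc: "accepting_path N x cs" "length cs - 1 \<le> T"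
  shows "deduc x item0"
proof -
  let ?n = "length cs - 1"
  have "(step N x ^^ ?n) (initial N) (last cs)"
    using acc(1) successively_imp_relpow[of "step N x" cs] by (auto simp: accepting_path_def comp_path_def)
  moreover have "fst (last cs) \<in> acc_states N" using acc(1) by (simp add: accepting_path_def)
  moreover have le: "?n + 1 + ?n * e \<le> fuel"
    unfolding fuel_def using acc(2) by (intro add_mono mult_le_mono1) auto
  ultimately have "deduc x (start N, 0, [bottom N], ?n + 1 + ?n * e, goal, 0)"
    using pops_complete[OF x inv_initial, of ?n "last cs"] by (simp add: initial_def)
  then show ?thesis unfolding item0_def using le by (rule pops_mono)
qed

text \<open>If no accepting configuration were reachable, no fictitious pop could ever fire, and the
  run described by \<open>item0\<close> would be a genuine one. But it empties the stack, whereas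
  \<open>N\<close> never removes its bottom marker.\<close>

lemma item0_sound:
  assumes x: "x \<in> lists \<Sigma>" and d: "deduc x item0"
  shows "\<exists>cs. accepting_path N x cs"
proof -
  have "\<exists>c. (step N x)\<^sup>*\<^sup>* (initial N) c \<and> fst c \<in> acc_states N"
  proof (rule ccontr)
    assume no: "\<not> ?thesis"
    have inv: "inv x c" if "(step N x)\<^sup>*\<^sup>* (initial N) c" for c
      using that
    proof (induction rule: rtranclp_induct)
      case base
      show ?case by (rule inv_initial)
    next
      case (step c c')
      from x step(3,2) show ?case by (rule inv_step)
    qed
    have "(step N x)\<^sup>*\<^sup>* (initial N) c" if "(pop_step x)\<^sup>*\<^sup>* (initial N) c" for c
      using that
    proof (induction rule: rtranclp_induct)
      case (step c c')
      note * = step.IH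
      from step.hyps(2) show ?case
      proof (cases rule: pop_step.cases)
        case step
        then show ?thesis using * by simp
      next
        case (pop q i a z)
        then show ?thesis using * no by auto
      qed
    qed simp
    moreover have "(pop_step x)\<^sup>*\<^sup>* (initial N) (goal, 0, [])"
      using pops_sound[OF d] unfolding item0_def initial_def by (auto dest: spec[of _ "[]"])
    ultimately have "inv x (goal, 0, [])" using inv by blast
    then show False by (simp add: inv_def)
  qed
  then obtain c where c: "(step N x)\<^sup>*\<^sup>* (initial N) c" "fst c \<in> acc_states N" by blast
  obtain cs where "cs \<noteq> []" "hd cs = initial N" "last cs = c" "successively (step N x) cs"
    using rtranclp_imp_successively[OF c(1)] by blast
  then show ?thesis using c(2) by (auto simp: accepting_path_def comp_path_def)
qed

end

section \<open>Polynomial bounds\<close>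

lemma card_strings_upto:
  assumes "finite A"
  shows "card (strings_upto A k) \<le> (card A + 1) ^ k"
proof -
  have "strings_upto A k = {xs. set xs \<subseteq> A \<and> length xs \<le> k}"
    by (auto simp: strings_upto_def)
  then have "card (strings_upto A k) = (\<Sum>i\<le>k. card A ^ i)"
    using card_lists_length_le[OF assms, of k] by simp
  also have "\<dots> \<le> (card A + 1) ^ k"
  proof (induction k)
    case (Suc k)
    have "card A ^ k \<le> (card A + 1) ^ k" by (rule power_mono) simp_all
    then have "card A * card A ^ k \<le> card A * (card A + 1) ^ k" by (rule mult_le_mono2)
    from add_mono[OF Suc this] show ?case by simp
  qed simp
  finally show ?thesis .
qed

text \<open>The crude estimate \<open>c < 2 ^ c\<close> suffices; the exponent later serves as the
  number of weight tables.\<close>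

lemma card_strings_upto_less: "finite A \<Longrightarrow> card (strings_upto A k) < 2 ^ ((card A + 1) * k + 1)"
proof -
  assume "finite A"
  then have "card (strings_upto A k) \<le> (card A + 1) ^ k" by (rule card_strings_upto)
  also have "\<dots> \<le> (2 ^ (card A + 1)) ^ k"
    using less_exp[of "card A + 1"] by (intro power_mono) (simp_all del: power_Suc)
  also have "\<dots> < 2 ^ ((card A + 1) * k + 1)"
    by (simp add: power_mult[symmetric] del: power_Suc)
  finally show ?thesis .
qed

lemma (in addr_pda) pda_size_compiled:
  "pda_size \<Sigma> compiled \<le> card St * (L + 1) * (gm + 2) ^ 2"
proof -
  have "card (states compiled) = card (St \<times> {..L})"
    unfolding compiled_def by (simp add: card_image inj_on_def)
  also have "\<dots> = card St * (L + 1)" by (simp add: card_cartesian_product)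
  finally have 1: "card (states compiled) = card St * (L + 1)" .
  have "card (strings_upto {..gm} (push_size \<Sigma> compiled)) \<le> (gm + 2) ^ push_size \<Sigma> compiled"
    using card_strings_upto[of "{..gm}"] by simp
  also have "\<dots> \<le> (gm + 2) ^ 2"
    using push_size_compiled by (intro power_increasing) auto
  finally show ?thesis
    unfolding pda_size_def 1 by (intro mult_le_mono2) (simp add: compiled_def)
qed

lemma poly2_mono: "m \<le> m' \<Longrightarrow> poly2 p n m \<le> poly2 p n m'"
  by (induction p) (auto simp: poly2_def intro!: add_mono mult_le_mono)

lemma poly2_poly: "poly2 p n (poly q n) = poly (poly p q) n"
  by (induction p) (simp_all add: poly2_def)

definition poly_bounded :: "(nat \<Rightarrow> nat) \<Rightarrow> bool" where
  "poly_bounded f \<longleftrightarrow> (\<exists>p. \<forall>n. f n \<le> poly p n)"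

lemma poly_bounded_poly: "poly_bounded (\<lambda>n. poly p n)"
  unfolding poly_bounded_def by blast

lemma poly_bounded_const: "poly_bounded (\<lambda>n. c)"
  unfolding poly_bounded_def by (intro exI[of _ "[:c:]"]) simp

lemma poly_bounded_add:
  assumes "poly_bounded f" "poly_bounded g"
  shows "poly_bounded (\<lambda>n. f n + g n)"
proof -
  obtain p q where "\<forall>n. f n \<le> poly p n" "\<forall>n. g n \<le> poly q n" using assms unfolding poly_bounded_def by blast
  then show ?thesis unfolding poly_bounded_def by (intro exI[of _ "p + q"]) (auto intro: add_mono)
qed

lemma poly_bounded_mult:
  assumes "poly_bounded f" "poly_bounded g"
  shows "poly_bounded (\<lambda>n. f n * g n)"
proof -
  obtain p q where "\<forall>n. f n \<le> poly p n" "\<forall>n. g n \<le> poly q n" using assms unfolding poly_bounded_def by blast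
  then show ?thesis unfolding poly_bounded_def by (intro exI[of _ "p * q"]) (auto intro: mult_le_mono)
qed

lemma poly_bounded_power: "poly_bounded f \<Longrightarrow> poly_bounded (\<lambda>n. f n ^ k)"
  by (induction k) (auto intro: poly_bounded_const poly_bounded_mult)

lemmas poly_bounded_intros =
  poly_bounded_poly poly_bounded_const poly_bounded_add poly_bounded_mult poly_bounded_power

text \<open>Explicit bounds for the machine: \<open>m\<close> gates, proof trees of size \<open>T\<close>, \<open>k\<close> tables with
  weights up to \<open>2 * m\<close>, inputs of length below \<open>L\<close>.\<close>

definition size_bound :: "nat \<Rightarrow> nat \<Rightarrow> nat \<Rightarrow> nat \<Rightarrow> nat" where
  "size_bound m T k L = (2 + (m * (2 * m * T) + m + k + 3) ^ 12) * (L + 1) * (m + 2) ^ 2"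

definition time_bound :: "nat \<Rightarrow> nat \<Rightarrow> nat \<Rightarrow> nat \<Rightarrow> nat" where
  "time_bound m T k L =
     (k * (m * ((m + 1) * (2 * T + 2)) + 1) + m * ((m + 1) * (2 * T + 2)) + 1) * (L + 2) + L"

text \<open>The tables, and with them the automaton, are fixed for all of \<open>X\<close>; only
  then is \<open>counting_run\<close> instantiated for each single input.\<close>

lemma unambiguous_machine_for_circuit:
  assumes C: "circuit C m T L tau" and X: "finite X" "card X < 2 ^ k" "0 < k"
    and len: "\<And>x. x \<in> X \<Longrightarrow> length x + 1 \<le> L"
  shows "\<exists>U :: (nat, 'a, nat) pda. two_npda \<Sigma> U \<and> pda_size \<Sigma> U \<le> size_bound m T k L \<and>
    (\<forall>x \<in> X. halts_within U x (time_bound m T k L) \<and>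
      (der C x (m - 1) \<longleftrightarrow> (\<exists>cs. accepting_path U x cs)) \<and>
      (\<forall>cs cs'. accepting_path U x cs \<longrightarrow> accepting_path U x cs' \<longrightarrow> cs = cs'))"
proof -
  interpret circuit C m T L tau by (rule C)
  obtain W where W: "\<forall>i < k. W i \<in> weight_tables m" "\<forall>x \<in> X. \<exists>i < k. \<forall>v < m. \<not> tie C (W i) x v"
    using exists_good_tables[OF m_pos X(1,2), of C] by (elim exE conjE)
  interpret counting C m T L tau W k "2 * m"
  proof
    fix i v assume "i < k" "v < m"
    then have "W i \<in> weight_tables m" using W(1) by blast
    then have "W i v < 2 * m" using \<open>v < m\<close> by (auto simp: weight_tables_def PiE_iff)
    then show "W i v \<le> 2 * m" by simp
  qed (rule X(3))
  have "card St \<le> 2 + (m * (2 * m * T) + m + k + 3) ^ 12"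
    using card_St unfolding B_def .
  then have "card St * (L + 1) * (m + 2) ^ 2 \<le> size_bound m T k L"
    unfolding size_bound_def by (intro mult_le_mono1)
  then have "pda_size \<Sigma> machine.compiled \<le> size_bound m T k L"
    using machine.pda_size_compiled[of \<Sigma>] by (rule order.trans[rotated])
  moreover have "two_npda \<Sigma> machine.compiled" by (rule machine.two_npda_compiled)
  moreover have "halts_within machine.compiled x (time_bound m T k L) \<and>
      (der C x (m - 1) \<longleftrightarrow> (\<exists>cs. accepting_path machine.compiled x cs)) \<and>
      (\<forall>cs cs'. accepting_path machine.compiled x cs \<longrightarrow> accepting_path machine.compiled x cs' \<longrightarrow> cs = cs')"
    if x: "x \<in> X" for x
  proof -
    interpret counting_run C m T L tau W k "2 * m" x
      by unfold_locales (use len[OF x] W(2) x in auto)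
    have "rank (start_pass (0, 0, 0, 0), []) * (L + 2) + L = time_bound m T k L"
      by (simp add: start_pass_def table_len_def pass_len_def dfs_len_def time_bound_def)
    then have "halts_within machine.compiled x (time_bound m T k L)"
      using grun.halts_compiled by simp
    moreover have "der C x (m - 1) \<longleftrightarrow> (\<exists>cs. accepting_path machine.compiled x cs)"
      using grun.run.accepting_path_imp grun.run.accepting_path_exists unfolding P_def by blast
    ultimately show ?thesis using grun.run.accepting_path_unique by blast
  qed
  ultimately show ?thesis by blast
qed

lemma accepting_path_length:
  "halts_within M x t \<Longrightarrow> accepting_path M x cs \<Longrightarrow> length cs - 1 \<le> t"
  by (simp add: halts_within_def accepting_path_def)

text \<open>Both factors of \<open>pda_size\<close> are positive, so each is bounded by the product.
  The powers of the bottom marker are \<open>push_size + 1\<close> different strings in the second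
  factor.\<close>

lemma card_le_pda_size:
  assumes M: "two_npda \<Sigma> M"
  shows "card (states M) \<le> pda_size \<Sigma> M"
    and "card (strings_upto (stack_alph M) (push_size \<Sigma> M)) \<le> pda_size \<Sigma> M"
    and "push_size \<Sigma> M \<le> pda_size \<Sigma> M"
proof -
  let ?W = "strings_upto (stack_alph M) (push_size \<Sigma> M)"
  have fin: "finite (states M)" "start M \<in> states M" "finite ?W" "bottom M \<in> stack_alph M"
    using M by (simp_all add: two_npda_def finite_strings_upto)
  have Q: "1 \<le> card (states M)" using fin(1,2) by (metis One_nat_def Suc_leI card_gt_0_iff empty_iff)
  have "card ((\<lambda>i. replicate i (bottom M)) ` {..push_size \<Sigma> M}) \<le> card ?W"
    using fin by (intro card_mono) (auto simp: strings_upto_def)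
  moreover have "inj_on (\<lambda>i. replicate i (bottom M)) {..push_size \<Sigma> M}"
    by (rule inj_onI) (metis length_replicate)
  ultimately have W: "push_size \<Sigma> M + 1 \<le> card ?W" by (simp add: card_image)
  show "card (states M) \<le> pda_size \<Sigma> M" using W unfolding pda_size_def by simp
  show 1: "card ?W \<le> pda_size \<Sigma> M" using Q unfolding pda_size_def by simp
  show "push_size \<Sigma> M \<le> pda_size \<Sigma> M" using 1 W by simp
qed

section \<open>Bounds in terms of input length, running time and size of the simulated
  automaton\<close>

definition fuel_bound :: "nat \<Rightarrow> nat \<Rightarrow> nat" where
  "fuel_bound T s = T + 1 + T * (s + 1)"

definition item_bound :: "nat \<Rightarrow> nat \<Rightarrow> nat \<Rightarrow> nat" where
  "item_bound l T s = s * ((l + 2) * ((s + 1) * ((fuel_bound T s + 1) * (s * (l + 2)))))"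

definition tree_bound :: "nat \<Rightarrow> nat \<Rightarrow> nat \<Rightarrow> nat" where
  "tree_bound l T s = (2 * item_bound l T s + 4) * ((s + 1 + 1) * fuel_bound T s + (s + 1) + 1) + item_bound l T s + 1"

definition gate_bound :: "nat \<Rightarrow> nat \<Rightarrow> nat \<Rightarrow> nat" where
  "gate_bound l T s = 4 * (item_bound l T s + 1) ^ 2"

lemma size_bound_mono: "m \<le> m' \<Longrightarrow> T \<le> T' \<Longrightarrow> size_bound m T k L \<le> size_bound m' T' k L"
  unfolding size_bound_def by (intro add_mono mult_le_mono power_mono) simp_all

lemma time_bound_mono: "m \<le> m' \<Longrightarrow> T \<le> T' \<Longrightarrow> time_bound m T k L \<le> time_bound m' T' k L"
  unfolding time_bound_def by (intro add_mono mult_le_mono) simp_all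

lemma halts_within_mono: "halts_within M x t \<Longrightarrow> t \<le> t' \<Longrightarrow> halts_within M x t'"
  unfolding halts_within_def by (meson le_trans)

lemma (in npda_items) unambiguous_machine:
  fixes s k
  defines "s \<equiv> pda_size \<Sigma> N" and "k \<equiv> (card \<Sigma> + 1) * l + 1"
  shows "\<exists>U :: (nat, 'a, nat) pda. two_npda \<Sigma> U \<and>
    pda_size \<Sigma> U \<le> size_bound (gate_bound l T s) (tree_bound l T s) k (l + 1) \<and>
    (\<forall>x \<in> strings_upto \<Sigma> l.
      halts_within U x (time_bound (gate_bound l T s) (tree_bound l T s) k (l + 1)) \<and>
      (deduc x item0 \<longleftrightarrow> (\<exists>cs. accepting_path U x cs)) \<and>
      (\<forall>cs cs'. accepting_path U x cs \<longrightarrow> accepting_path U x cs' \<longrightarrow> cs = cs'))"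
proof -
  have e: "e \<le> s + 1" unfolding e_def s_def using card_le_pda_size(3)[OF N] by simp
  then have f: "fuel \<le> fuel_bound T s"
    unfolding fuel_def fuel_bound_def by (intro add_mono mult_le_mono) simp_all
  have Q: "card (states N) \<le> s" unfolding s_def by (rule card_le_pda_size(1)[OF N])
  have "finite (strings_upto (stack_alph N) (push_size \<Sigma> N))"
    using N by (simp add: two_npda_def finite_strings_upto)
  then have "card wset \<le> s + 1"
    unfolding wset_def s_def using card_le_pda_size(2)[OF N] by (simp add: card_insert_if)
  then have M: "M \<le> item_bound l T s"
    unfolding its items_def item_bound_def card_cartesian_product using f Q
    by (intro mult_le_mono) simp_all
  obtain C m tau where C: "circuit C m ((2 * M + 4) * ((e + 1) * fuel + e + 1) + M + 1) (l + 1) tau"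
    and m: "m \<le> 4 * (M + 1) ^ 2" and der: "\<And>x. der C x (m - 1) \<longleftrightarrow> deduc x item0"
    using circuit_of_deduction[OF item0_in] by blast
  let ?T = "(2 * M + 4) * ((e + 1) * fuel + e + 1) + M + 1"
  have mT: "m \<le> gate_bound l T s" "?T \<le> tree_bound l T s"
  proof -
    have "4 * (M + 1) ^ 2 \<le> gate_bound l T s"
      unfolding gate_bound_def using M by (intro mult_le_mono power_mono) simp_all
    with m show "m \<le> gate_bound l T s" by (rule order.trans)
    show "?T \<le> tree_bound l T s"
      unfolding tree_bound_def using M e f by (intro add_mono mult_le_mono) simp_all
  qed
  have fin_X: "finite (strings_upto \<Sigma> l)" using fin by (rule finite_strings_upto)
  have card_X: "card (strings_upto \<Sigma> l) < 2 ^ k" unfolding k_def by (rule card_strings_upto_less[OF fin])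
  have "0 < k" by (simp add: k_def)
  have "\<exists>U :: (nat, 'a, nat) pda. two_npda \<Sigma> U \<and> pda_size \<Sigma> U \<le> size_bound m ?T k (l + 1) \<and>
    (\<forall>x \<in> strings_upto \<Sigma> l. halts_within U x (time_bound m ?T k (l + 1)) \<and>
      (der C x (m - 1) \<longleftrightarrow> (\<exists>cs. accepting_path U x cs)) \<and>
      (\<forall>cs cs'. accepting_path U x cs \<longrightarrow> accepting_path U x cs' \<longrightarrow> cs = cs'))"
    by (rule unambiguous_machine_for_circuit[OF C fin_X card_X \<open>0 < k\<close>]) (simp add: strings_upto_def)
  then obtain U :: "(nat, 'a, nat) pda" where U: "two_npda \<Sigma> U" "pda_size \<Sigma> U \<le> size_bound m ?T k (l + 1)"
    "\<forall>x \<in> strings_upto \<Sigma> l. halts_within U x (time_bound m ?T k (l + 1)) \<and>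
      (der C x (m - 1) \<longleftrightarrow> (\<exists>cs. accepting_path U x cs)) \<and>
      (\<forall>cs cs'. accepting_path U x cs \<longrightarrow> accepting_path U x cs' \<longrightarrow> cs = cs')"
    by (elim exE conjE)
  show ?thesis
  proof (intro exI[of _ U] conjI ballI)
    show "pda_size \<Sigma> U \<le> size_bound (gate_bound l T s) (tree_bound l T s) k (l + 1)"
      using U(2) size_bound_mono[OF mT] by (rule order.trans)
  next
    fix x assume x: "x \<in> strings_upto \<Sigma> l"
    note Ux = bspec[OF U(3) x]
    show "halts_within U x (time_bound (gate_bound l T s) (tree_bound l T s) k (l + 1))"
      using conjunct1[OF Ux] time_bound_mono[OF mT] by (rule halts_within_mono)
    show "deduc x item0 \<longleftrightarrow> (\<exists>cs. accepting_path U x cs)"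
      using Ux unfolding der by (elim conjE)
    show "\<forall>cs cs'. accepting_path U x cs \<longrightarrow> accepting_path U x cs' \<longrightarrow> cs = cs'"
      using Ux by (elim conjE)
  qed (rule U(1))
qed

lemma solves_within_imp_unambiguous:
  fixes N :: "(nat, 'a, nat) pda"
  assumes N: "two_npda \<Sigma> N" and \<Sigma>: "finite \<Sigma>" and P: "promise_problem_over \<Sigma> P"
    and sol: "solves_within N P t" and t: "\<And>i. i \<le> l \<Longrightarrow> t i \<le> T"
    and len: "\<forall>x \<in> fst P \<union> snd P. length x \<le> l"
  defines "m \<equiv> gate_bound l T (pda_size \<Sigma> N)" and "d \<equiv> tree_bound l T (pda_size \<Sigma> N)"
    and "k \<equiv> (card \<Sigma> + 1) * l + 1"
  shows "\<exists>U :: (nat, 'a, nat) pda. two_npda \<Sigma> U \<and> pda_size \<Sigma> U \<le> size_bound m d k (l + 1) \<and>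
    unambiguous_on U P \<and> solves_within U P (\<lambda>_. time_bound m d k (l + 1))"
proof -
  interpret npda_items \<Sigma> N l T by unfold_locales (fact N, fact \<Sigma>)
  obtain U :: "(nat, 'a, nat) pda" where U: "two_npda \<Sigma> U" "pda_size \<Sigma> U \<le> size_bound m d k (l + 1)"
    "\<forall>x \<in> strings_upto \<Sigma> l. halts_within U x (time_bound m d k (l + 1)) \<and>
      (deduc x item0 \<longleftrightarrow> (\<exists>cs. accepting_path U x cs)) \<and>
      (\<forall>cs cs'. accepting_path U x cs \<longrightarrow> accepting_path U x cs' \<longrightarrow> cs = cs')"
    using unambiguous_machine unfolding m_def d_def k_def by (elim exE conjE)
  have inst: "x \<in> lists \<Sigma>" "length x \<le> l" "x \<in> strings_upto \<Sigma> l" "halts_within N x T"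
    if "x \<in> fst P \<union> snd P" for x
  proof -
    show 1: "x \<in> lists \<Sigma>" using P that by (auto simp: promise_problem_over_def)
    show 2: "length x \<le> l" using len that by blast
    show "x \<in> strings_upto \<Sigma> l" using 1 2 by (simp add: strings_upto_def)
    have "halts_within N x (t (length x))" using sol that by (simp add: solves_within_def)
    then show "halts_within N x T" using t[OF 2] by (rule halts_within_mono)
  qed
  have pos: "\<exists>cs. accepting_path U x cs" if x: "x \<in> fst P" for x
  proof -
    have x': "x \<in> fst P \<union> snd P" using x by simp
    obtain cs where cs: "accepting_path N x cs" using sol x unfolding solves_within_def solves_def by blast
    have "deduc x item0"
      using inst(1,2)[OF x'] cs accepting_path_length[OF inst(4)[OF x'] cs] by (rule item0_complete)
    then show ?thesis using bspec[OF U(3) inst(3)[OF x']] by simp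
  qed
  have neg: "\<not> accepting_path U x cs" if x: "x \<in> snd P" for x cs
  proof
    assume "accepting_path U x cs"
    have x': "x \<in> fst P \<union> snd P" using x by simp
    have "deduc x item0" using bspec[OF U(3) inst(3)[OF x']] \<open>accepting_path U x cs\<close> by blast
    then obtain ds where ds: "accepting_path N x ds" using item0_sound inst(1)[OF x'] by blast
    then have "halting_path N x ds" by (simp add: accepting_path_def halting_path_def halt_states_def)
    then have "rejecting_path N x ds" using sol x unfolding solves_within_def solves_def by blast
    then show False using ds N by (auto simp: accepting_path_def rejecting_path_def two_npda_def)
  qed
  have "solves U P"
    unfolding solves_def
  proof (intro conjI ballI allI impI)
    fix x cs assume x: "x \<in> snd P" and cs: "halting_path U x cs"
    then show "rejecting_path U x cs"
      using neg[OF x, of cs]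
      by (auto simp: halting_path_def accepting_path_def rejecting_path_def halt_states_def)
  qed (rule pos)
  moreover have "\<forall>x \<in> fst P \<union> snd P. halts_within U x (time_bound m d k (l + 1))"
    using U(3) inst(3) by blast
  moreover have "unambiguous_on U P"
    unfolding unambiguous_on_def using U(3) inst(3) by blast
  ultimately show ?thesis using U(1,2) unfolding solves_within_def by blast
qed

lemma poly_bounded_bounds:
  assumes "poly_bounded l" "poly_bounded T" "poly_bounded s" "poly_bounded k"
  shows "poly_bounded (\<lambda>n. size_bound (gate_bound (l n) (T n) (s n)) (tree_bound (l n) (T n) (s n)) (k n) (l n + 1))"
    and "poly_bounded (\<lambda>n. time_bound (gate_bound (l n) (T n) (s n)) (tree_bound (l n) (T n) (s n)) (k n) (l n + 1))"
proof -
  have f: "poly_bounded (\<lambda>n. fuel_bound (T n) (s n))"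
    unfolding fuel_bound_def by (intro poly_bounded_intros assms)
  have i: "poly_bounded (\<lambda>n. item_bound (l n) (T n) (s n))"
    unfolding item_bound_def by (intro poly_bounded_intros assms f)
  have t: "poly_bounded (\<lambda>n. tree_bound (l n) (T n) (s n))"
    unfolding tree_bound_def by (intro poly_bounded_intros assms f i)
  have g: "poly_bounded (\<lambda>n. gate_bound (l n) (T n) (s n))"
    unfolding gate_bound_def by (intro poly_bounded_intros i)
  show "poly_bounded (\<lambda>n. size_bound (gate_bound (l n) (T n) (s n)) (tree_bound (l n) (T n) (s n)) (k n) (l n + 1))"
    unfolding size_bound_def by (intro poly_bounded_intros assms t g)
  show "poly_bounded (\<lambda>n. time_bound (gate_bound (l n) (T n) (s n)) (tree_bound (l n) (T n) (s n)) (k n) (l n + 1))"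
    unfolding time_bound_def by (intro poly_bounded_intros assms t g)
qed

lemma ptime_2NPD_imp_2UPD:
  fixes L :: "'a family"
  assumes L: "L \<in> ptime_2NPD" and ceil: "\<forall>n. \<forall>x \<in> fst (L n) \<union> snd (L n). length x \<le> poly pc n"
  shows "L \<in> ptime_2UPD"
proof -
  obtain \<Sigma> and N :: "'a pda_family" and p where
    \<Sigma>: "alphabet \<Sigma>" and P: "\<forall>n. promise_problem_over \<Sigma> (L n)" and N: "\<forall>n. two_npda \<Sigma> (N n)"
    and sz: "polynomial_size \<Sigma> N" and sol: "\<forall>n. solves_within (N n) (L n) (poly2 p n)"
    using L unfolding ptime_2NPD_def mem_Collect_eq by (elim exE conjE)
  define l where "l n = poly pc n" for n
  \<comment> \<open>Substituting the ceiling for the input length gives one time bound for all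
    instances of the problem.\<close>
  define T where "T n = poly (poly p pc) n" for n
  define s where "s n = pda_size \<Sigma> (N n)" for n
  define k where "k n = (card \<Sigma> + 1) * l n + 1" for n
  define sb where "sb n = size_bound (gate_bound (l n) (T n) (s n)) (tree_bound (l n) (T n) (s n)) (k n) (l n + 1)" for n
  define tb where "tb n = time_bound (gate_bound (l n) (T n) (s n)) (tree_bound (l n) (T n) (s n)) (k n) (l n + 1)" for n
  have "\<exists>U :: (nat, 'a, nat) pda. two_npda \<Sigma> U \<and> pda_size \<Sigma> U \<le> sb n \<and>
    unambiguous_on U (L n) \<and> solves_within U (L n) (\<lambda>_. tb n)" for n
    unfolding sb_def tb_def s_def k_def
  proof (rule solves_within_imp_unambiguous)
    show "two_npda \<Sigma> (N n)" "promise_problem_over \<Sigma> (L n)" "solves_within (N n) (L n) (poly2 p n)"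
      using N P sol by blast+
    show "finite \<Sigma>" using \<Sigma> by (simp add: alphabet_def)
    show "poly2 p n i \<le> T n" if "i \<le> l n" for i
      using poly2_mono[OF that, of p n] by (simp add: T_def l_def poly2_poly)
    show "\<forall>x \<in> fst (L n) \<union> snd (L n). length x \<le> l n" using ceil by (simp add: l_def)
  qed
  then obtain U :: "'a pda_family" where U: "\<And>n. two_npda \<Sigma> (U n) \<and> pda_size \<Sigma> (U n) \<le> sb n \<and>
    unambiguous_on (U n) (L n) \<and> solves_within (U n) (L n) (\<lambda>_. tb n)"
    by metis
  have lb: "poly_bounded l" and Tb: "poly_bounded T"
    unfolding l_def T_def by (rule poly_bounded_poly)+
  have sbd: "poly_bounded s" using sz unfolding poly_bounded_def polynomial_size_def s_def .
  have kb: "poly_bounded k" unfolding k_def by (intro poly_bounded_intros lb)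
  from poly_bounded_bounds[OF lb Tb sbd kb]
  obtain q r where q: "\<forall>n. sb n \<le> poly q n" and r: "\<forall>n. tb n \<le> poly r n"
    unfolding poly_bounded_def sb_def[symmetric] tb_def[symmetric] by (elim exE)
  have "polynomial_size \<Sigma> U"
    unfolding polynomial_size_def using U q by (meson le_trans)
  \<comment> \<open>The bound is constant in the input length, which the ceiling has already
    absorbed.\<close>
  moreover have "solves_within (U n) (L n) (poly2 [:r:] n)" for n
  proof -
    have "tb n \<le> poly2 [:r:] n i" for i using r by (simp add: poly2_def)
    then show ?thesis
      using U[of n] unfolding solves_within_def by (meson halts_within_mono)
  qed
  ultimately show ?thesis
    unfolding ptime_2UPD_def mem_Collect_eq using \<Sigma> P U by blast
qed

lemma ptime_2UPD_subset: "ptime_2UPD \<subseteq> ptime_2NPD"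
  unfolding ptime_2UPD_def ptime_2NPD_def by blast

theorem theorem5p5:
  shows "with_poly_ceiling (ptime_2NPD :: 'a family set) = with_poly_ceiling ptime_2UPD"
proof
  show "with_poly_ceiling (ptime_2NPD :: 'a family set) \<subseteq> with_poly_ceiling ptime_2UPD"
    unfolding with_poly_ceiling_def using ptime_2NPD_imp_2UPD by blast
  show "with_poly_ceiling ptime_2UPD \<subseteq> with_poly_ceiling (ptime_2NPD :: 'a family set)"
    unfolding with_poly_ceiling_def using ptime_2UPD_subset by blast
qed

end
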